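(* Let $f:[a,b]\to\mathbb{R}$ be an increasing continuous function with $f(a)=0$ that is piecewise twice continuously differentiable, with bounded second derivative and with first derivative bounded away from $0$ and $\infty$. Then: (6a) The density of the exterior transition measure for $f$ is equal to $$\frac1\pi(1+f'(x))\sin\left(\frac{\pi}{1+f'(x)}\right)(x-a+f(x))^{-\frac{f'(x)}{1+f'(x)}}(b-x+f(b)-f(x))^{-\frac{1}{1+f'(x)}}\exp\left(\int_a^b\frac{1}{u-x+f(u)-f(x)}\cdot\frac{f'(u)-f'(x)}{1+f'(x)}\,du\right).$$ (6b) The density of the interior transition measure for $f$ is equal to $$\frac{1}{\pi}(1+f'(x))\sin\left(\frac{\pi}{1+f'(x)}\right)(x-a+f(x))^{-\frac{1}{1+f'(x)}}(b-x+f(b)-f(x))^{-\frac{f'(x)}{1+f'(x)}}\exp\left(-\int_a^b\frac{1}{u-x+f(u)-f(x)}\cdot\frac{f'(u)-f'(x)}{1+f'(x)}\,du\right).$$ In particular, for such $f$, $$\int_a^b f(x)\,dx=\int_a^b\left\{\frac1\pi(1+f'(x))\sin\left(\frac{\pi}{1+f'(x)}\right)(x-a+f(x))^{\frac{f'(x)}{1+f'(x)}}(b-x+f(b)-f(x))^{\frac{1}{1+f'(x)}}\exp\left[-\int_a^b\frac{1}{u-x+f(u)-f(x)}\cdot\frac{f'(u)-f'(x)}{1+f'(x)}\,du\right]\right\}dx$$ and $$\pi=\int_a^b\left[(1+f'(x))\sin\left(\frac{\pi}{1+f'(x)}\right)(x-a+f(x))^{-\frac{f'(x)}{1+f'(x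)}}(b-x+f(b)-f(x))^{-\frac{1}{1+f'(x)}}\exp\left(\int_a^b\frac{1}{u-x+f(u)-f(x)}\cdot\frac{f'(u)-f'(x)}{1+f'(x)}\,du\right)\right]dx.$$
   Context: Let $a<b$. For an increasing function $f$ on $[a,b]$ with $f(a)=0$ (an unrotated diagram), the domain is $D_f=\{(x,y):a\le x\le b,\ 0\le y\le f(x)\}$ and the dual domain is $D'_f=\{(x,y):a\le x\le b,\ f(x)\le y\le f(b)\}$. The interior hook of $(x,y)\in D_f$ is the set of $(x',y')\in D_f$ with ($x'\le x$ and $y'=y$) or ($x'=x$ and $y'\ge y$). The exterior hook of $(x,y)\in D'_f$ is the set of $(x',y')\in D'_f$ with ($x'=x$ and $y'\le y$) or ($x'\ge x$ and $y'=y$). The exterior hook walk is the random walk on $D'_f$ that starts at the corner $(a,f(b))$ and at each step moves to a point chosen uniformly (by arc length) from the exterior hook of the current point. The interior hook walk is the random walk on $D_f$ that starts at a point chosen uniformly (by area) in $D_f$ and at each step moves to a point chosen uniformly (by arc length) from the interior hook of the current point. Each walk converges almost surely to a point on the graph of $f$; the distribution of the $x$-coordinate of the limit point is the exterior, respectively interior, transition measure of $f$.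
   Formalization: (6b) as printed fails for f(x)=x on [0,1] (variance 1/8, true value 1/16); it is corrected to have exponents +f'/(1+f') on x-a+f(x) and +1/(1+f') on b-x+f(b)-f(x), with an extra factor 1/∫f, in accord with the first closing identity. *)

theory Defs
  imports "HOL-Probability.Probability"
begin

section \<open>Path law of a Markov chain\<close>

text \<open>
  The law on path space of the time-homogeneous Markov chain with initial distribution \<open>\<mu>\<close> and
  transition kernel \<open>K\<close>, as delivered by the Ionescu-Tulcea construction.  The lemmas below show
  that it is the intended law whenever \<open>\<mu>\<close> is a Borel probability measure and \<open>K\<close> a Markov kernel.
\<close>

definition markov_step ::
  "'a::topological_space measure \<Rightarrow> ('a \<Rightarrow> 'a measure) \<Rightarrow> nat \<Rightarrow> (nat \<Rightarrow> 'a) \<Rightarrow> 'a measure" where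
  "markov_step \<mu> K n \<omega> = (case n of 0 \<Rightarrow> \<mu> | Suc m \<Rightarrow> K (\<omega> m))"

definition markov_law ::
  "'a::topological_space measure \<Rightarrow> ('a \<Rightarrow> 'a measure) \<Rightarrow> (nat \<Rightarrow> 'a) measure" where
  "markov_law \<mu> K =
     projective_family.lim UNIV (Ionescu_Tulcea.CI (markov_step \<mu> K) (\<lambda>_. borel)) (\<lambda>_. borel)"

lemma Ionescu_Tulcea_markov_step:
  assumes "prob_space \<mu>" and \<mu>: "sets \<mu> = sets borel"
    and K: "K \<in> borel \<rightarrow>\<^sub>M subprob_algebra borel" and "\<And>p. prob_space (K p)"
  shows "Ionescu_Tulcea (markov_step \<mu> K) (\<lambda>_. borel)"
proof (rule Ionescu_Tulcea.intro)
  show "markov_step \<mu> K i \<in> (\<Pi>\<^sub>M i\<in>{0..<i}. borel) \<rightarrow>\<^sub>M subprob_algebra borel" for i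
  proof (cases i)
    case 0
    have "\<mu> \<in> space (subprob_algebra borel)"
      using assms by (auto simp: space_subprob_algebra prob_space_imp_subprob_space)
    then show ?thesis by (simp add: markov_step_def[abs_def] 0)
  next
    case (Suc m)
    have "(\<lambda>\<omega>. \<omega> m) \<in> (\<Pi>\<^sub>M i\<in>{0..<Suc m}. borel) \<rightarrow>\<^sub>M borel"
      by (rule measurable_component_singleton) simp
    from measurable_compose[OF this K] show ?thesis
      by (simp add: markov_step_def[abs_def] Suc)
  qed
  show "prob_space (markov_step \<mu> K i x)" if "x \<in> space (\<Pi>\<^sub>M i\<in>{0..<i}. borel)" for i x
    using assms by (cases i) (auto simp: markov_step_def)
qed

lemma
  fixes \<mu> :: "'a::topological_space measure"
  assumes A: "prob_space \<mu>" "sets \<mu> = sets borel" "K \<in> borel \<rightarrow>\<^sub>M subprob_algebra borel"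
    "\<And>p. prob_space (K p)"
  shows prob_space_markov_law: "prob_space (markov_law \<mu> K)"
    and sets_markov_law: "sets (markov_law \<mu> K) = sets (\<Pi>\<^sub>M i\<in>UNIV. borel)"
    and markov_law_initial: "distr (markov_law \<mu> K) borel (\<lambda>\<omega>. \<omega> 0) = \<mu>"
    and markov_law_step:
      "distr (markov_law \<mu> K) (\<Pi>\<^sub>M i\<in>{0..<Suc (Suc n)}. borel) (\<lambda>\<omega>. restrict \<omega> {0..<Suc (Suc n)}) =
       distr (markov_law \<mu> K) (\<Pi>\<^sub>M i\<in>{0..<Suc n}. borel) (\<lambda>\<omega>. restrict \<omega> {0..<Suc n}) \<bind>
         (\<lambda>h. distr (K (h n)) (\<Pi>\<^sub>M i\<in>{0..<Suc (Suc n)}. borel) (\<lambda>q. h(Suc n := q)))"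
proof -
  interpret IT: Ionescu_Tulcea "markov_step \<mu> K" "\<lambda>_. borel"
    using A by (rule Ionescu_Tulcea_markov_step)
  have ml: "markov_law \<mu> K = IT.PF.lim" by (simp add: markov_law_def)
  show S: "sets (markov_law \<mu> K) = sets (\<Pi>\<^sub>M i\<in>UNIV. borel)" unfolding ml by simp
  have up: "IT.up_to {0..<n} = n" for n
    unfolding IT.up_to_def by (rule Least_equality) (auto simp: not_less[symmetric])
  have D: "distr (markov_law \<mu> K) (\<Pi>\<^sub>M i\<in>{0..<n}. borel) (\<lambda>\<omega>. restrict \<omega> {0..<n})
      = IT.C 0 n (\<lambda>_. undefined)" for n
  proof -
    have "restrict \<omega> {0..<n} = \<omega>" if "\<omega> \<in> space (IT.C 0 n (\<lambda>_. undefined))" for \<omega>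
      using that by (subst (asm) IT.space_C) (auto simp: space_PiM extensional_restrict)
    then have "IT.CI {0..<n} = IT.C 0 n (\<lambda>_. undefined)"
      unfolding IT.CI_def up
      by (subst distr_cong[OF refl refl, where g="\<lambda>\<omega>. \<omega>"]) (auto intro!: distr_id2 simp: IT.sets_C)
    then show ?thesis
      unfolding ml by (subst IT.distr_lim) auto
  qed
  show P: "prob_space (markov_law \<mu> K)"
  proof (rule prob_space_distrD)
    show "(\<lambda>\<omega>. restrict \<omega> {0..<0}) \<in> markov_law \<mu> K \<rightarrow>\<^sub>M (\<Pi>\<^sub>M i\<in>{0..<0}. borel)"
      by (subst measurable_cong_sets[OF S refl]) (rule measurable_restrict_subset, simp)
    show "prob_space (distr (markov_law \<mu> K) (\<Pi>\<^sub>M i\<in>{0..<0}. borel) (\<lambda>\<omega>. restrict \<omega> {0..<0}))"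
      unfolding D by (rule IT.prob_space_C) (simp add: space_PiM)
  qed
  show "distr (markov_law \<mu> K) borel (\<lambda>\<omega>. \<omega> 0) = \<mu>"
  proof -
    have "distr (markov_law \<mu> K) borel (\<lambda>\<omega>. \<omega> 0) =
        distr (IT.C 0 (Suc 0) (\<lambda>_. undefined)) borel (\<lambda>\<omega>. \<omega> 0)"
      unfolding D[symmetric]
      by (subst distr_distr)
         (simp_all add: comp_def measurable_cong_sets[OF S refl] measurable_restrict_subset)
    also have "IT.C 0 (Suc 0) (\<lambda>_. undefined) = IT.eP 0 (\<lambda>_. undefined)"
      using bind_return[OF IT.measurable_eP, of "\<lambda>_. undefined" 0] by (simp add: space_PiM)
    also have "distr \<dots> borel (\<lambda>\<omega>. \<omega> 0) = distr \<mu> borel (\<lambda>q. q)"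
      unfolding IT.eP_def
      by (subst distr_distr)
         (auto simp: comp_def markov_step_def A(2) measurable_cong_sets[OF A(2) refl]
               intro!: measurable_fun_upd[where J="{}"] measurable_component_singleton)
    also have "\<dots> = \<mu>"
      by (simp add: distr_id2 A(2))
    finally show ?thesis .
  qed
  show "distr (markov_law \<mu> K) (\<Pi>\<^sub>M i\<in>{0..<Suc (Suc n)}. borel) (\<lambda>\<omega>. restrict \<omega> {0..<Suc (Suc n)}) =
       distr (markov_law \<mu> K) (\<Pi>\<^sub>M i\<in>{0..<Suc n}. borel) (\<lambda>\<omega>. restrict \<omega> {0..<Suc n}) \<bind>
         (\<lambda>h. distr (K (h n)) (\<Pi>\<^sub>M i\<in>{0..<Suc (Suc n)}. borel) (\<lambda>q. h(Suc n := q)))"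
    unfolding D by (simp add: IT.eP_def[abs_def] markov_step_def)
qed

section \<open>Hook walks\<close>

definition diagram_domain :: "real \<Rightarrow> real \<Rightarrow> (real \<Rightarrow> real) \<Rightarrow> (real \<times> real) set" where
  "diagram_domain a b f = {(x, y). a \<le> x \<and> x \<le> b \<and> 0 \<le> y \<and> y \<le> f x}"

definition dual_domain :: "real \<Rightarrow> real \<Rightarrow> (real \<Rightarrow> real) \<Rightarrow> (real \<times> real) set" where
  "dual_domain a b f = {(x, y). a \<le> x \<and> x \<le> b \<and> f x \<le> y \<and> y \<le> f b}"

definition interior_hook ::
  "real \<Rightarrow> real \<Rightarrow> (real \<Rightarrow> real) \<Rightarrow> real \<times> real \<Rightarrow> (real \<times> real) set" where
  "interior_hook a b f = (\<lambda>(x, y).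
     {(x', y') \<in> diagram_domain a b f. x' \<le> x \<and> y' = y \<or> x' = x \<and> y' \<ge> y})"

definition exterior_hook ::
  "real \<Rightarrow> real \<Rightarrow> (real \<Rightarrow> real) \<Rightarrow> real \<times> real \<Rightarrow> (real \<times> real) set" where
  "exterior_hook a b f = (\<lambda>(x, y).
     {(x', y') \<in> dual_domain a b f. x' = x \<and> y' \<le> y \<or> x' \<ge> x \<and> y' = y})"

text \<open>
  Arc length on the union of the horizontal and the vertical line through \<open>p\<close>; the point \<open>p\<close>,
  which lies on both lines, is a null set.
\<close>

definition cross_length :: "real \<times> real \<Rightarrow> (real \<times> real) measure" where
  "cross_length p = measure_of UNIV (sets borel)
     (\<lambda>A. emeasure lborel {x. (x, snd p) \<in> A} + emeasure lborel {y. (fst p, y) \<in> A})"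

text \<open>
  The uniform distribution by arc length on a hook \<open>H\<close> with corner \<open>p\<close>.  For \<open>p\<close> on the graph the
  hook is \<open>{p}\<close>, of length \<open>0\<close>, and the walk stays at \<open>p\<close>.
\<close>

definition uniform_on_hook :: "real \<times> real \<Rightarrow> (real \<times> real) set \<Rightarrow> (real \<times> real) measure" where
  "uniform_on_hook p H =
     (if emeasure (cross_length p) H = 0 then return borel p else uniform_measure (cross_length p) H)"

definition exterior_hook_walk ::
  "real \<Rightarrow> real \<Rightarrow> (real \<Rightarrow> real) \<Rightarrow> (nat \<Rightarrow> real \<times> real) measure" where
  "exterior_hook_walk a b f =
     markov_law (return borel (a, f b)) (\<lambda>p. uniform_on_hook p (exterior_hook a b f p))"

definition interior_hook_walk ::
  "real \<Rightarrow> real \<Rightarrow> (real \<Rightarrow> real) \<Rightarrow> (nat \<Rightarrow> real \<times> real) measure" where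
  "interior_hook_walk a b f =
     markov_law (uniform_measure lborel (diagram_domain a b f))
       (\<lambda>p. uniform_on_hook p (interior_hook a b f p))"

definition exterior_transition_measure :: "real \<Rightarrow> real \<Rightarrow> (real \<Rightarrow> real) \<Rightarrow> real measure" where
  "exterior_transition_measure a b f =
     distr (exterior_hook_walk a b f) borel (\<lambda>\<omega>. fst (lim \<omega>))"

definition interior_transition_measure :: "real \<Rightarrow> real \<Rightarrow> (real \<Rightarrow> real) \<Rightarrow> real measure" where
  "interior_transition_measure a b f =
     distr (interior_hook_walk a b f) borel (\<lambda>\<omega>. fst (lim \<omega>))"

text \<open>The kernels above are Markov kernels, so the lemmas on \<^const>\<open>markov_law\<close> apply.\<close>

lemma emeasure_cross_length:
  assumes "A \<in> sets borel"
  shows "emeasure (cross_length p) A =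
    emeasure lborel {x. (x, snd p) \<in> A} + emeasure lborel {y. (fst p, y) \<in> A}"
proof -
  have [measurable]: "(\<lambda>x. (x, snd p)) \<in> borel_measurable lborel" "(\<lambda>y. (fst p, y)) \<in> borel_measurable lborel"
    by (auto intro!: borel_measurable_continuous_onI continuous_intros)
  let ?X = "distr lborel borel (\<lambda>x. (x, snd p))" and ?Y = "distr lborel borel (\<lambda>y. (fst p, y))"
  have eq: "emeasure lborel {x. (x, snd p) \<in> B} + emeasure lborel {y. (fst p, y) \<in> B} =
      emeasure ?X B + emeasure ?Y B" if "B \<in> sets borel" for B
    using that by (simp add: emeasure_distr vimage_def)
  show ?thesis
    unfolding cross_length_def
  proof (rule emeasure_measure_of_sigma)
    show "sigma_algebra UNIV (sets borel :: (real \<times> real) set set)"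
      using sets.sigma_algebra_axioms[of "borel :: (real \<times> real) measure"] by simp
    show "positive (sets borel)
        (\<lambda>A. emeasure lborel {x. (x, snd p) \<in> A} + emeasure lborel {y. (fst p, y) \<in> A})"
      by (simp add: positive_def)
    show "countably_additive (sets borel)
        (\<lambda>A. emeasure lborel {x. (x, snd p) \<in> A} + emeasure lborel {y. (fst p, y) \<in> A})"
    proof (rule countably_additiveI)
      fix B :: "nat \<Rightarrow> (real \<times> real) set"
      assume B: "range B \<subseteq> sets borel" "disjoint_family B" "(\<Union>i. B i) \<in> sets borel"
      then have B': "B i \<in> sets borel" for i by auto
      have "(\<Sum>i. emeasure ?X (B i) + emeasure ?Y (B i)) =
          emeasure ?X (\<Union>i. B i) + emeasure ?Y (\<Union>i. B i)"
        using B by (simp add: suminf_add[symmetric] suminf_emeasure)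
      then show "(\<Sum>i. emeasure lborel {x. (x, snd p) \<in> B i} + emeasure lborel {y. (fst p, y) \<in> B i}) =
          emeasure lborel {x. (x, snd p) \<in> (\<Union>i. B i)} + emeasure lborel {y. (fst p, y) \<in> (\<Union>i. B i)}"
        using eq[OF B'] eq[OF B(3)] by simp
    qed
  qed (fact assms)
qed

lemma sets_cross_length [simp, measurable_cong]: "sets (cross_length p) = sets borel"
  unfolding cross_length_def
  using sets.sigma_sets_eq[of "borel :: (real \<times> real) measure"] by (simp add: sets_measure_of)

lemma space_cross_length [simp]: "space (cross_length p) = UNIV"
  using sets_eq_imp_space_eq[OF sets_cross_length] by simp

lemma kernel_uniform_on_hook:
  assumes H: "{(p, q). q \<in> H p} \<in> sets (borel :: ((real \<times> real) \<times> (real \<times> real)) measure)"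
    and bnd: "\<And>p. bounded (H p)"
  shows "(\<lambda>p. uniform_on_hook p (H p)) \<in> borel \<rightarrow>\<^sub>M subprob_algebra borel"
    and "prob_space (uniform_on_hook p (H p))"
proof -
  let ?S = "{(p, q). q \<in> H p}"
  have Hs: "H p \<in> sets borel" for p
  proof -
    have "(\<lambda>q. (p, q)) \<in> borel_measurable borel"
      by (intro borel_measurable_continuous_onI continuous_intros)
    from measurable_sets[OF this H] show ?thesis by (simp add: vimage_def)
  qed
  have fin: "emeasure (cross_length p) (H p) \<noteq> \<infinity>" for p
  proof -
    have "bounded {x. (x, snd p) \<in> H p}"
      by (rule bounded_subset[OF bounded_fst[OF bnd[of p]]]) force
    moreover have "bounded {y. (fst p, y) \<in> H p}"
      by (rule bounded_subset[OF bounded_snd[OF bnd[of p]]]) force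
    ultimately show ?thesis
      using emeasure_bounded_finite[of "{x. (x, snd p) \<in> H p}"]
        emeasure_bounded_finite[of "{y. (fst p, y) \<in> H p}"]
      by (auto simp: emeasure_cross_length[OF Hs])
  qed
  show pr: "prob_space (uniform_on_hook p (H p))" for p
    unfolding uniform_on_hook_def using Hs[of p] fin[of p]
    by (auto intro!: prob_space_return prob_space_uniform_measure)
  have m: "(\<lambda>p. emeasure (cross_length p) (H p \<inter> A)) \<in> borel_measurable borel"
    if A: "A \<in> sets borel" for A
  proof -
    have "(UNIV :: (real \<times> real) set) \<times> A \<in> sets (borel \<Otimes>\<^sub>M borel)"
      using A by (intro pair_measureI) simp_all
    then have 1: "?S \<inter> UNIV \<times> A \<in> sets (borel :: ((real \<times> real) \<times> real \<times> real) measure)"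
      using H unfolding borel_prod by (rule sets.Int[rotated])
    have g: "(\<lambda>(p, x). (p, (x, snd p))) \<in> (borel :: ((real \<times> real) \<times> real) measure) \<rightarrow>\<^sub>M borel"
      and h: "(\<lambda>(p, y). (p, (fst p, y))) \<in> (borel :: ((real \<times> real) \<times> real) measure) \<rightarrow>\<^sub>M borel"
      unfolding case_prod_beta by (intro borel_measurable_continuous_onI continuous_intros)+
    have sb: "sets (borel :: ((real \<times> real) \<times> real) measure) = sets (borel \<Otimes>\<^sub>M lborel)"
      unfolding borel_prod[symmetric] by (intro sets_pair_measure_cong) simp_all
    have X: "(\<lambda>p. emeasure lborel {x. (x, snd p) \<in> H p \<inter> A}) \<in> borel_measurable borel"
      using lborel.measurable_emeasure_Pair[OF measurable_sets[OF g 1, simplified sb]]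
      by (simp add: vimage_def)
    have Y: "(\<lambda>p. emeasure lborel {y. (fst p, y) \<in> H p \<inter> A}) \<in> borel_measurable borel"
      using lborel.measurable_emeasure_Pair[OF measurable_sets[OF h 1, simplified sb]]
      by (simp add: vimage_def)
    have "emeasure (cross_length p) (H p \<inter> A) =
        emeasure lborel {x. (x, snd p) \<in> H p \<inter> A} + emeasure lborel {y. (fst p, y) \<in> H p \<inter> A}" for p
      using Hs A by (intro emeasure_cross_length sets.Int)
    then show ?thesis
      using borel_measurable_add[OF X Y] by simp
  qed
  have m0: "(\<lambda>p. emeasure (cross_length p) (H p)) \<in> borel_measurable borel"
    using m[of UNIV] by simp
  show "(\<lambda>p. uniform_on_hook p (H p)) \<in> borel \<rightarrow>\<^sub>M subprob_algebra borel"
  proof (rule measurable_subprob_algebra)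
    show "subprob_space (uniform_on_hook p (H p))" for p
      using pr by (rule prob_space_imp_subprob_space)
    show "sets (uniform_on_hook p (H p)) = sets borel" for p
      by (simp add: uniform_on_hook_def)
    show "(\<lambda>p. emeasure (uniform_on_hook p (H p)) A) \<in> borel_measurable borel"
      if [measurable]: "A \<in> sets borel" for A
    proof -
      have "emeasure (uniform_on_hook p (H p)) A =
          (if emeasure (cross_length p) (H p) = 0 then indicator A p
           else emeasure (cross_length p) (H p \<inter> A) / emeasure (cross_length p) (H p))" for p
        using Hs[of p] by (simp add: uniform_on_hook_def)
      then show ?thesis
        using m[of A] m0 by simp
    qed
  qed
qed

lemma compact_domains:
  assumes f: "continuous_on {a..b} f"
  shows "compact (diagram_domain a b f)" "compact (dual_domain a b f)"
proof -
  obtain B where "\<forall>x\<in>{a..b}. \<bar>f x\<bar> \<le> B"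
    using compact_imp_bounded[OF compact_continuous_image[OF f compact_Icc]]
    by (auto simp: bounded_iff)
  then have B: "f x \<le> \<bar>B\<bar> + \<bar>f b\<bar>" "- \<bar>B\<bar> - \<bar>f b\<bar> \<le> f x" if "a \<le> x" "x \<le> b" for x
    using that by (force simp: abs_le_iff)+
  let ?R = "{a..b} \<times> {-\<bar>B\<bar> - \<bar>f b\<bar>..\<bar>B\<bar> + \<bar>f b\<bar>}"
  have R: "compact ?R" by (intro compact_Times compact_Icc)
  have c: "continuous_on ?R (\<lambda>p. f (fst p))"
    by (rule continuous_on_compose2[OF f]) (auto intro!: continuous_intros)
  have "closed {p \<in> ?R. 0 \<le> snd p}" "closed {p \<in> ?R. snd p \<le> f (fst p)}"
       "closed {p \<in> ?R. f (fst p) \<le> snd p}" "closed {p \<in> ?R. snd p \<le> f b}"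
    by (intro continuous_on_closed_Collect_le c continuous_intros compact_imp_closed[OF R])+
  note compact_Int_closed[OF R closed_Int[OF this(1,2)]] compact_Int_closed[OF R closed_Int[OF this(3,4)]]
  moreover have "?R \<inter> ({p \<in> ?R. 0 \<le> snd p} \<inter> {p \<in> ?R. snd p \<le> f (fst p)}) = diagram_domain a b f"
    by (auto simp: diagram_domain_def intro: order_trans[OF _ B(1)] order_trans[of _ 0])
  moreover have "?R \<inter> ({p \<in> ?R. f (fst p) \<le> snd p} \<inter> {p \<in> ?R. snd p \<le> f b}) = dual_domain a b f"
    by (auto simp: dual_domain_def intro: order_trans[OF B(2)])
  ultimately show "compact (diagram_domain a b f)" "compact (dual_domain a b f)"
    by simp_all
qed

lemma
  assumes f: "continuous_on {a..b} f"
  shows exterior_kernel: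
      "(\<lambda>p. uniform_on_hook p (exterior_hook a b f p)) \<in> borel \<rightarrow>\<^sub>M subprob_algebra borel"
      "prob_space (uniform_on_hook p (exterior_hook a b f p))"
    and interior_kernel:
      "(\<lambda>p. uniform_on_hook p (interior_hook a b f p)) \<in> borel \<rightarrow>\<^sub>M subprob_algebra borel"
      "prob_space (uniform_on_hook p (interior_hook a b f p))"
proof -
  note c = compact_domains[OF f]
  have cl: "closed ((UNIV :: (real \<times> real) set) \<times> diagram_domain a b f)"
      "closed ((UNIV :: (real \<times> real) set) \<times> dual_domain a b f)"
    by (intro closed_Times closed_UNIV compact_imp_closed c)+
  have "{(p, q). q \<in> exterior_hook a b f p} = UNIV \<times> dual_domain a b f \<inter>
      ({r. fst (snd r) = fst (fst r)} \<inter> {r. snd (snd r) \<le> snd (fst r)} \<union>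
       {r. fst (fst r) \<le> fst (snd r)} \<inter> {r. snd (snd r) = snd (fst r)})"
    by (auto simp: exterior_hook_def)
  also have "closed \<dots>"
    by (intro closed_Int closed_Un cl closed_Collect_eq closed_Collect_le continuous_intros)
  finally have e: "{(p, q). q \<in> exterior_hook a b f p} \<in> sets borel" by simp
  have "{(p, q). q \<in> interior_hook a b f p} = UNIV \<times> diagram_domain a b f \<inter>
      ({r. fst (snd r) \<le> fst (fst r)} \<inter> {r. snd (snd r) = snd (fst r)} \<union>
       {r. fst (snd r) = fst (fst r)} \<inter> {r. snd (fst r) \<le> snd (snd r)})"
    by (auto simp: interior_hook_def)
  also have "closed \<dots>"
    by (intro closed_Int closed_Un cl closed_Collect_eq closed_Collect_le continuous_intros)
  finally have i: "{(p, q). q \<in> interior_hook a b f p} \<in> sets borel" by simp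
  have be: "bounded (exterior_hook a b f p)" for p
    by (rule bounded_subset[OF compact_imp_bounded[OF c(2)]]) (auto simp: exterior_hook_def)
  have bi: "bounded (interior_hook a b f p)" for p
    by (rule bounded_subset[OF compact_imp_bounded[OF c(1)]]) (auto simp: interior_hook_def)
  show "(\<lambda>p. uniform_on_hook p (exterior_hook a b f p)) \<in> borel \<rightarrow>\<^sub>M subprob_algebra borel"
    "prob_space (uniform_on_hook p (exterior_hook a b f p))"
    by (rule kernel_uniform_on_hook[OF e be])+
  show "(\<lambda>p. uniform_on_hook p (interior_hook a b f p)) \<in> borel \<rightarrow>\<^sub>M subprob_algebra borel"
    "prob_space (uniform_on_hook p (interior_hook a b f p))"
    by (rule kernel_uniform_on_hook[OF i bi])+
qed

section \<open>The integral in the density formulas\<close>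

definition diagram_integral :: "real \<Rightarrow> real \<Rightarrow> (real \<Rightarrow> real) \<Rightarrow> real \<Rightarrow> real" where
  "diagram_integral a b f x =
     (LBINT u:{a..b}. 1 / (u - x + f u - f x) * ((deriv f u - deriv f x) / (1 + deriv f x)))"

end

theory Submission
  imports Defs
begin

text \<open>
  Put \<open>s x = x + f x\<close> and \<open>g = f\<^sup>-\<^sup>1\<close>.  The hook of \<open>(x, y)\<close> has length \<open>\<bar>s (g y) - s x\<bar>\<close>, for both walks.
  With \<open>A u = \<integral>\<^sub>a\<^sup>u dv / (z - s v)\<close> the function \<open>H (x, y) = exp (A (g y) - A x) / (z - s x)\<close> equals its mean
  over every hook of either walk: up to constant factors its integrals along the two arms are
  exact differentials, of \<open>exp (- A u)\<close> and of \<open>(s u - z) exp (A u)\<close>.  A step shrinks the hook length in mean by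
  the factor \<open>3 / 4\<close>, so the walk tends to a point \<open>(X, f X)\<close> of the graph and \<open>E (1 / (z - s X))\<close> is the
  mean of \<open>H\<close> over the starting distribution, namely \<open>G z = exp (A b) / (z - a)\<close> for the exterior walk
  and \<open>(z - b - 1 / G z) / \<integral>f\<close> for the interior one.

  Stieltjes inversion recovers the law of \<open>X\<close>.  Writing \<open>1 + f' x = (1 + f' u) - (f' u - f' x)\<close> in
  \<open>(1 + f' x) A b = \<integral> (1 + f' x) / (z - s u) du\<close> gives logarithms plus an integral that stays bounded as \<open>z\<close>
  tends to \<open>s x\<close>, which yields the boundary values of \<open>A b\<close>.  Atoms at the kinks and at the end points are excluded because
  \<open>\<epsilon> G (s x + \<i> \<epsilon>)\<close> tends to \<open>0\<close>.
\<close>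

section \<open>Markov chains on path space\<close>

text \<open>One scheme serves both walks because a hook matters only through its two arms, each a
  segment from the corner to the graph. Passing from one side of the graph to the other reverses
  both arms, and the common change of sign leaves the mean value property intact. \<open>H\<close>
  is a product of a function of \<open>x\<close> and a function of \<open>y\<close>, so along an arm
  only one factor varies.

  The obstacle is the kinks. There the boundary limit of the transform is out of control, so the
  inversion is done on compact intervals inside the open set where \<open>f\<close> is smooth, and
  the finitely many other points are dealt with by ruling out atoms. This is where the bounds on the
  slope act: at height \<open>\<epsilon>\<close> the exponent grows at most like
  \<open>ln (1 / \<epsilon>) / (1 + c)\<close>, and the factor \<open>\<epsilon>\<close> wins.

  All transforms live in the strictly increasing coordinate \<open>s x\<close>. Hence the factor
  \<open>1 + f'\<close> in the densities is a Jacobian, while the sine comes from the imaginary part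
  \<open>\<pi>\<close> of the logarithm of a negative number. The two integral identities express
  that both laws have total mass one.\<close>

locale markov_chain =
  fixes \<mu> :: "'a::{second_countable_topology, t2_space} measure" and K :: "'a \<Rightarrow> 'a measure"
  assumes prob_init: "prob_space \<mu>" and sets_init: "sets \<mu> = sets borel"
    and kernel [measurable]: "K \<in> borel \<rightarrow>\<^sub>M subprob_algebra borel"
    and prob_kernel: "\<And>p. prob_space (K p)"
begin

abbreviation P where "P \<equiv> markov_law \<mu> K"

lemmas chain_assms = prob_init sets_init kernel prob_kernel

sublocale P: prob_space P
  by (rule prob_space_markov_law[OF chain_assms])

lemma sets_P [measurable_cong]: "sets P = sets (\<Pi>\<^sub>M i\<in>UNIV. borel)"
  by (rule sets_markov_law[OF chain_assms])

lemma sets_kernel_borel [simp]: "sets (K p) = sets borel"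
  using kernel by (rule sets_kernel) simp

lemma measurable_coordinate [measurable]: "(\<lambda>\<omega>. \<omega> n) \<in> P \<rightarrow>\<^sub>M borel"
  by (subst measurable_cong_sets[OF sets_P refl]) simp

text \<open>The path law is accessible only through its finite prefixes. The expectation is
  therefore moved to the law of the first \<open>n + 2\<close> coordinates, where
  \<open>markov_law_step\<close> exhibits the last step as a bind, and the inner integral is then
  the conditional mean given the history.\<close>

lemma nn_integral_step:
  assumes [measurable]: "case_prod \<phi> \<in> borel_measurable (borel \<Otimes>\<^sub>M borel)"
  shows "(\<integral>\<^sup>+\<omega>. \<phi> (\<omega> n) (\<omega> (Suc n)) \<partial>P) = (\<integral>\<^sup>+\<omega>. \<integral>\<^sup>+q. \<phi> (\<omega> n) q \<partial>K (\<omega> n) \<partial>P)"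
proof -
  define B where "B k = (\<Pi>\<^sub>M i\<in>{0..<k}. (borel :: 'a measure))" for k :: nat
  define D where "D k = distr P (B k) (\<lambda>\<omega>. restrict \<omega> {0..<k})" for k
  have r [measurable]: "(\<lambda>\<omega>. restrict \<omega> {0..<k}) \<in> P \<rightarrow>\<^sub>M B k" for k
    unfolding B_def by (subst measurable_cong_sets[OF sets_P refl]) (rule measurable_restrict_subset, simp)
  have coord [measurable]: "(\<lambda>h. h i) \<in> B k \<rightarrow>\<^sub>M borel" if "i < k" for i k
    unfolding B_def using that by (intro measurable_component_singleton) simp
  have [measurable_cong]: "sets (D k) = sets (B k)" for k by (simp add: D_def)
  let ?T = "\<lambda>h q. h(Suc n := q)"
  have T: "case_prod ?T \<in> B (Suc n) \<Otimes>\<^sub>M borel \<rightarrow>\<^sub>M B (Suc (Suc n))"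
    unfolding B_def case_prod_beta
    by (intro measurable_fun_upd[where J="{0..<Suc n}"]) auto
  have T1: "?T h \<in> borel \<rightarrow>\<^sub>M B (Suc (Suc n))" if "h \<in> space (B (Suc n))" for h
    using measurable_compose[OF measurable_Pair1'[OF that] T] by simp
  have N: "(\<lambda>h. distr (K (h n)) (B (Suc (Suc n))) (?T h)) \<in> D (Suc n) \<rightarrow>\<^sub>M subprob_algebra (B (Suc (Suc n)))"
    by (rule measurable_distr2[where M=borel])
       (use T in \<open>auto simp: measurable_cong_sets[OF \<open>sets (D (Suc n)) = _\<close>] cong: measurable_cong_sets\<close>)
  have "(\<lambda>p. (fst p n, snd p)) \<in> B (Suc n) \<Otimes>\<^sub>M borel \<rightarrow>\<^sub>M borel \<Otimes>\<^sub>M (borel :: 'a measure)"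
    by (intro measurable_Pair measurable_compose[OF measurable_fst coord] measurable_snd) simp
  from measurable_compose[OF this assms]
  have measurable_step: "(\<lambda>(h, q). \<phi> (h n) q) \<in> borel_measurable (B (Suc n) \<Otimes>\<^sub>M borel)"
    by (simp add: case_prod_beta)
  have "(\<integral>\<^sup>+\<omega>. \<phi> (\<omega> n) (\<omega> (Suc n)) \<partial>P) = (\<integral>\<^sup>+h. \<phi> (h n) (h (Suc n)) \<partial>D (Suc (Suc n)))"
    unfolding D_def by (subst nn_integral_distr) simp_all
  also have "D (Suc (Suc n)) = D (Suc n) \<bind> (\<lambda>h. distr (K (h n)) (B (Suc (Suc n))) (?T h))"
    using markov_law_step[OF chain_assms, of n] by (simp add: D_def B_def)
  also have "(\<integral>\<^sup>+h. \<phi> (h n) (h (Suc n)) \<partial>\<dots>) =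
      (\<integral>\<^sup>+h. \<integral>\<^sup>+h'. \<phi> (h' n) (h' (Suc n)) \<partial>distr (K (h n)) (B (Suc (Suc n))) (?T h) \<partial>D (Suc n))"
    by (rule nn_integral_bind[OF _ N]) simp
  also have "\<dots> = (\<integral>\<^sup>+h. \<integral>\<^sup>+q. \<phi> (h n) q \<partial>K (h n) \<partial>D (Suc n))"
  proof (rule nn_integral_cong)
    fix h assume "h \<in> space (D (Suc n))"
    then have h: "h \<in> space (B (Suc n))" by (simp add: D_def)
    show "(\<integral>\<^sup>+h'. \<phi> (h' n) (h' (Suc n)) \<partial>distr (K (h n)) (B (Suc (Suc n))) (?T h)) =
        (\<integral>\<^sup>+q. \<phi> (h n) q \<partial>K (h n))"
      by (subst nn_integral_distr) (use T1[OF h] in \<open>auto cong: measurable_cong_sets\<close>)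
  qed
  also have "\<dots> = (\<integral>\<^sup>+\<omega>. \<integral>\<^sup>+q. \<phi> (\<omega> n) q \<partial>K (\<omega> n) \<partial>P)"
    unfolding D_def
    by (subst nn_integral_distr)
       (auto intro!: nn_integral_measurable_subprob_algebra2[where N=borel] measurable_step)
  finally show ?thesis .
qed

text \<open>Turns the one-step identity for nonnegative functions into an identity of laws, through
  which \<open>integral_bind\<close> then handles bounded functions of either sign.\<close>

lemma distr_Suc: "distr P borel (\<lambda>\<omega>. \<omega> (Suc n)) = distr P borel (\<lambda>\<omega>. \<omega> n) \<bind> K"
proof (rule measure_eqI)
  show "sets (distr P borel (\<lambda>\<omega>. \<omega> (Suc n))) = sets (distr P borel (\<lambda>\<omega>. \<omega> n) \<bind> K)"
    by (simp add: sets_bind[where N=borel])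
  fix A assume "A \<in> sets (distr P borel (\<lambda>\<omega>. \<omega> (Suc n)))"
  then have [measurable]: "A \<in> sets borel" by simp
  have "emeasure (distr P borel (\<lambda>\<omega>. \<omega> (Suc n))) A = (\<integral>\<^sup>+\<omega>. indicator A (\<omega> (Suc n)) \<partial>P)"
    by (subst nn_integral_indicator[symmetric], simp, subst nn_integral_distr) simp_all
  also have "\<dots> = (\<integral>\<^sup>+\<omega>. \<integral>\<^sup>+q. indicator A q \<partial>K (\<omega> n) \<partial>P)"
    by (rule nn_integral_step) simp
  also have "\<dots> = emeasure (distr P borel (\<lambda>\<omega>. \<omega> n) \<bind> K) A"
    by (subst emeasure_bind[where N=borel]) (auto simp: nn_integral_distr)
  finally show "emeasure (distr P borel (\<lambda>\<omega>. \<omega> (Suc n))) A = emeasure (distr P borel (\<lambda>\<omega>. \<omega> n) \<bind> K) A" .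
qed

lemma integral_step:
  fixes F :: "'a \<Rightarrow> real"
  assumes [measurable]: "F \<in> borel_measurable borel" and B: "\<And>p. \<bar>F p\<bar> \<le> B"
  shows "(\<integral>\<omega>. F (\<omega> (Suc n)) \<partial>P) = (\<integral>\<omega>. (\<integral>q. F q \<partial>K (\<omega> n)) \<partial>P)"
proof -
  have "(\<integral>\<omega>. F (\<omega> (Suc n)) \<partial>P) = integral\<^sup>L (distr P borel (\<lambda>\<omega>. \<omega> (Suc n))) F"
    by (subst integral_distr) auto
  also have "\<dots> = (\<integral>p. (\<integral>q. F q \<partial>K p) \<partial>distr P borel (\<lambda>\<omega>. \<omega> n))"
    unfolding distr_Suc
    by (rule integral_bind[where B=B and B'=1 and K=borel])
       (auto simp: B prob_space.emeasure_space_1[OF prob_kernel]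
          intro!: prob_space.finite_measure P.prob_space_distr)
  also have "\<dots> = (\<integral>\<omega>. (\<integral>q. F q \<partial>K (\<omega> n)) \<partial>P)"
    by (subst integral_distr) (auto intro!: measurable_compose[OF kernel integral_measurable_subprob_algebra])
  finally show ?thesis .
qed

text \<open>The indicator of a bad step has conditional mean zero as long as the walk is in
  \<open>D\<close>, so each single step is bad with probability zero, and there are only countably
  many steps. The relation \<open>R\<close> is meant to record the direction in which the walk
  moves.\<close>

lemma AE_step:
  assumes D: "D \<in> sets borel" "AE p in \<mu>. p \<in> D" and R: "R \<in> sets (borel \<Otimes>\<^sub>M borel)"
    and "\<And>p. p \<in> D \<Longrightarrow> AE q in K p. q \<in> D \<and> (p, q) \<in> R"
  shows "AE \<omega> in P. \<forall>n. \<omega> n \<in> D \<and> (\<omega> n, \<omega> (Suc n)) \<in> R"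
proof -
  note [measurable] = D(1) R
  have [measurable]: "Measurable.pred (borel \<Otimes>\<^sub>M borel) (\<lambda>(p, q). (p, q) \<in> R)" by simp
  have step: "AE \<omega> in P. \<omega> (Suc n) \<in> D \<and> (\<omega> n, \<omega> (Suc n)) \<in> R" if "AE \<omega> in P. \<omega> n \<in> D" for n
  proof -
    define \<phi> :: "'a \<Rightarrow> 'a \<Rightarrow> ennreal" where "\<phi> p q = (if q \<in> D \<and> (p, q) \<in> R then 0 else 1)" for p q
    have \<phi> [measurable]: "case_prod \<phi> \<in> borel_measurable (borel \<Otimes>\<^sub>M borel)"
      unfolding \<phi>_def case_prod_beta by measurable
    have "AE \<omega> in P. (\<integral>\<^sup>+q. \<phi> (\<omega> n) q \<partial>K (\<omega> n)) = 0"
      using that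
    proof eventually_elim
      fix \<omega> assume *: "\<omega> n \<in> D"
      have "AE q in K (\<omega> n). \<phi> (\<omega> n) q = 0"
        using assms(4)[OF *] by eventually_elim (simp add: \<phi>_def)
      then show "(\<integral>\<^sup>+q. \<phi> (\<omega> n) q \<partial>K (\<omega> n)) = 0"
        by (simp cong: nn_integral_cong_AE)
    qed
    then have "(\<integral>\<^sup>+\<omega>. \<integral>\<^sup>+q. \<phi> (\<omega> n) q \<partial>K (\<omega> n) \<partial>P) = 0"
      by (simp cong: nn_integral_cong_AE)
    with nn_integral_step[OF \<phi>, of n] have "(\<integral>\<^sup>+\<omega>. \<phi> (\<omega> n) (\<omega> (Suc n)) \<partial>P) = 0" by simp
    then have "AE \<omega> in P. \<phi> (\<omega> n) (\<omega> (Suc n)) = 0"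
      by (subst (asm) nn_integral_0_iff_AE) simp_all
    then show ?thesis by eventually_elim (simp add: \<phi>_def split: if_splits)
  qed
  have "AE p in distr P borel (\<lambda>\<omega>. \<omega> 0). p \<in> D"
    unfolding markov_law_initial[OF chain_assms] by (rule D(2))
  then have 0: "AE \<omega> in P. \<omega> 0 \<in> D"
    by (subst (asm) AE_distr_iff) simp_all
  have "AE \<omega> in P. \<omega> n \<in> D" for n
  proof (induction n)
    case (Suc n)
    from step[OF this] show ?case by eventually_elim simp
  qed (rule 0)
  then show ?thesis
    using step unfolding AE_all_countable AE_conj_iff by blast
qed

end

text \<open>Convergence is a pathwise matter: almost every path respects \<open>R\<close> at all
  times, and \<open>conv\<close> is a deterministic statement about such paths.\<close>

lemma (in markov_chain) AE_limit:
  assumes D: "closed D" "AE p in \<mu>. p \<in> D" and R: "R \<in> sets (borel \<Otimes>\<^sub>M borel)"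
    and K: "\<And>p. p \<in> D \<Longrightarrow> AE q in K p. q \<in> D \<and> (p, q) \<in> R"
    and conv: "\<And>\<omega>. (\<And>n. \<omega> n \<in> D) \<Longrightarrow> (\<And>n. (\<omega> n, \<omega> (Suc n)) \<in> R) \<Longrightarrow> convergent \<omega>"
  shows "AE \<omega> in P. (\<forall>n. \<omega> n \<in> D) \<and> \<omega> \<longlonglongrightarrow> lim \<omega> \<and> lim \<omega> \<in> D"
proof -
  have "AE \<omega> in P. \<forall>n. \<omega> n \<in> D \<and> (\<omega> n, \<omega> (Suc n)) \<in> R"
    using D(1) by (intro AE_step D R K) simp
  then show ?thesis
  proof eventually_elim
    case (elim \<omega>)
    then have "\<omega> \<longlonglongrightarrow> lim \<omega>"
      using conv[of \<omega>] by (simp add: convergent_LIMSEQ_iff)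
    moreover from Lim_in_closed_set[OF D(1) _ _ this] elim have "lim \<omega> \<in> D" by simp
    ultimately show ?case using elim by blast
  qed
qed

locale convergent_chain = markov_chain \<mu> K
  for \<mu> :: "'a::{banach, second_countable_topology} measure" and K :: "'a \<Rightarrow> 'a measure" +
  fixes D :: "'a set"
  assumes stays: "AE \<omega> in P. (\<forall>n. \<omega> n \<in> D) \<and> \<omega> \<longlonglongrightarrow> lim \<omega> \<and> lim \<omega> \<in> D"
begin

lemma measurable_lim [measurable]: "lim \<in> P \<rightarrow>\<^sub>M borel"
  using borel_measurable_lim_metric[of "\<lambda>i \<omega>. \<omega> i" P] by simp

lemma integral_coordinate_LIMSEQ:
  fixes F :: "'a \<Rightarrow> real"
  assumes F: "continuous_on UNIV F" and B: "\<And>p. \<bar>F p\<bar> \<le> B"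
  shows "(\<lambda>n. \<integral>\<omega>. F (\<omega> n) \<partial>P) \<longlonglongrightarrow> (\<integral>\<omega>. F (lim \<omega>) \<partial>P)"
proof (rule integral_dominated_convergence[where w="\<lambda>_. B"])
  have [measurable]: "F \<in> borel_measurable borel"
    using F by (rule borel_measurable_continuous_onI)
  show "(\<lambda>\<omega>. F (lim \<omega>)) \<in> borel_measurable P" "(\<lambda>\<omega>. F (\<omega> n)) \<in> borel_measurable P" for n
    by measurable
  show "AE \<omega> in P. (\<lambda>n. F (\<omega> n)) \<longlonglongrightarrow> F (lim \<omega>)"
    using stays by eventually_elim (use continuous_on_tendsto_compose[OF F] in auto)
qed (use B in auto)

text \<open>A bounded martingale argument: harmonicity on \<open>D\<close> makes the mean of
  \<open>F (\<omega> n)\<close> the same for all \<open>n\<close>, and dominated convergence carries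
  this value to the limit point.\<close>

lemma expectation_lim_invariant:
  fixes F :: "'a \<Rightarrow> real"
  assumes F: "continuous_on UNIV F" and B: "\<And>p. \<bar>F p\<bar> \<le> B"
    and inv: "\<And>p. p \<in> D \<Longrightarrow> (\<integral>q. F q \<partial>K p) = F p"
  shows "(\<integral>\<omega>. F (lim \<omega>) \<partial>P) = (\<integral>p. F p \<partial>\<mu>)"
proof -
  have m [measurable]: "F \<in> borel_measurable borel"
    using F by (rule borel_measurable_continuous_onI)
  have "(\<integral>\<omega>. F (\<omega> n) \<partial>P) = (\<integral>p. F p \<partial>\<mu>)" for n
  proof (induction n)
    case 0
    have "(\<integral>p. F p \<partial>distr P borel (\<lambda>\<omega>. \<omega> 0)) = (\<integral>\<omega>. F (\<omega> 0) \<partial>P)"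
      by (rule integral_distr) measurable
    then show ?case by (simp add: markov_law_initial[OF chain_assms])
  next
    case (Suc n)
    have "(\<integral>\<omega>. F (\<omega> (Suc n)) \<partial>P) = (\<integral>\<omega>. (\<integral>q. F q \<partial>K (\<omega> n)) \<partial>P)"
      by (rule integral_step[OF m B])
    also have "\<dots> = (\<integral>\<omega>. F (\<omega> n) \<partial>P)"
    proof (rule integral_cong_AE)
      show "(\<lambda>\<omega>. \<integral>q. F q \<partial>K (\<omega> n)) \<in> borel_measurable P"
        by (rule measurable_compose[OF measurable_coordinate])
           (rule measurable_compose[OF kernel integral_measurable_subprob_algebra[OF m]])
      show "AE \<omega> in P. (\<integral>q. F q \<partial>K (\<omega> n)) = F (\<omega> n)"
        using stays by eventually_elim (use inv in auto)
    qed measurable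
    finally show ?case using Suc.IH by simp
  qed
  with integral_coordinate_LIMSEQ[OF F B] show ?thesis
    by (simp add: LIMSEQ_const_iff)
qed

text \<open>The means decay like \<open>\<rho> ^ n\<close>, so the nonnegative variable
  \<open>F (lim \<omega>)\<close> has mean zero and must vanish almost surely.\<close>

lemma AE_lim_contraction:
  fixes F :: "'a \<Rightarrow> real"
  assumes F: "continuous_on UNIV F" and B: "\<And>p. 0 \<le> F p" "\<And>p. F p \<le> B"
    and contr: "\<And>p. p \<in> D \<Longrightarrow> (\<integral>q. F q \<partial>K p) \<le> \<rho> * F p" and \<rho>: "0 \<le> \<rho>" "\<rho> < 1"
  shows "AE \<omega> in P. F (lim \<omega>) = 0"
proof -
  have m [measurable]: "F \<in> borel_measurable borel"
    using F by (rule borel_measurable_continuous_onI)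
  have B': "\<bar>F p\<bar> \<le> B" for p using B[of p] by simp
  have bnd: "integrable P (\<lambda>\<omega>. F (h \<omega>))" if [measurable]: "h \<in> P \<rightarrow>\<^sub>M borel" for h
    by (rule P.integrable_const_bound[where B=B]) (use B' in auto)
  have "(\<integral>\<omega>. F (\<omega> n) \<partial>P) \<le> \<rho> ^ n * B" for n
  proof (induction n)
    case 0
    have "(\<integral>\<omega>. F (\<omega> 0) \<partial>P) \<le> (\<integral>\<omega>. B \<partial>P)"
      by (rule integral_mono[OF bnd]) (use B in auto)
    then show ?case by (simp add: P.prob_space)
  next
    case (Suc n)
    have mK: "(\<lambda>p. \<integral>q. F q \<partial>K p) \<in> borel_measurable borel"
      by (rule measurable_compose[OF kernel integral_measurable_subprob_algebra[OF m]])
    have "\<bar>\<integral>q. F q \<partial>K p\<bar> \<le> B" for p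
    proof -
      interpret K: prob_space "K p" by (rule prob_kernel)
      have "F \<in> borel_measurable (K p)"
        using m by (subst measurable_cong_sets[OF sets_kernel_borel refl])
      have "\<bar>\<integral>q. F q \<partial>K p\<bar> \<le> (\<integral>q. \<bar>F q\<bar> \<partial>K p)" by simp
      also have "\<dots> \<le> (\<integral>q. B \<partial>K p)"
        using B' \<open>F \<in> borel_measurable (K p)\<close> order_trans[OF abs_ge_zero B'[of p]]
        by (intro integral_mono K.integrable_const_bound[where B=B] borel_measurable_abs) auto
      finally show ?thesis by (simp add: K.prob_space)
    qed
    then have i: "integrable P (\<lambda>\<omega>. \<integral>q. F q \<partial>K (\<omega> n))"
      by (intro P.integrable_const_bound[where B=B] measurable_compose[OF measurable_coordinate mK]) auto
    have "(\<integral>\<omega>. F (\<omega> (Suc n)) \<partial>P) = (\<integral>\<omega>. (\<integral>q. F q \<partial>K (\<omega> n)) \<partial>P)"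
      by (rule integral_step[OF m B'])
    also have "\<dots> \<le> (\<integral>\<omega>. \<rho> * F (\<omega> n) \<partial>P)"
    proof (rule integral_mono_AE[OF i])
      show "AE \<omega> in P. (\<integral>q. F q \<partial>K (\<omega> n)) \<le> \<rho> * F (\<omega> n)"
        using stays by eventually_elim (use contr in auto)
    qed (simp add: bnd)
    also have "\<dots> = \<rho> * (\<integral>\<omega>. F (\<omega> n) \<partial>P)" by simp
    also have "\<dots> \<le> \<rho> * (\<rho> ^ n * B)" using Suc.IH \<rho> by (intro mult_left_mono)
    finally show ?case by (simp add: mult_ac)
  qed
  moreover have "(\<lambda>n. \<rho> ^ n * B) \<longlonglongrightarrow> 0 * B"
    using \<rho> by (intro tendsto_intros LIMSEQ_realpow_zero)
  ultimately have "(\<integral>\<omega>. F (lim \<omega>) \<partial>P) \<le> 0 * B"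
    using integral_coordinate_LIMSEQ[OF F B'] by (intro LIMSEQ_le) auto
  moreover have "0 \<le> (\<integral>\<omega>. F (lim \<omega>) \<partial>P)" using B by simp
  ultimately have "(\<integral>\<omega>. F (lim \<omega>) \<partial>P) = 0" by simp
  then show ?thesis
    using integral_nonneg_eq_0_iff_AE[OF bnd[OF measurable_lim]] B by simp
qed

end

section \<open>Integration over a hook\<close>

text \<open>\<open>cross_length\<close> is known by its values on sets, so the formula is extended
  from indicators through multiples, sums and increasing limits.\<close>

lemma nn_integral_cross_length:
  assumes "F \<in> borel_measurable borel"
  shows "(\<integral>\<^sup>+q. F q \<partial>cross_length p) =
    (\<integral>\<^sup>+x. F (x, snd p) \<partial>lborel) + (\<integral>\<^sup>+y. F (fst p, y) \<partial>lborel)"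
proof -
  have c [measurable]: "(\<lambda>x. (x, snd p)) \<in> borel_measurable borel" "(\<lambda>y. (fst p, y)) \<in> borel_measurable borel"
    by (intro borel_measurable_continuous_onI continuous_intros)+
  have "F \<in> borel_measurable (borel :: (real \<times> real) measure)" by fact
  then show ?thesis
  proof (induction rule: borel_measurable_induct)
    case (cong f g)
    then show ?case by (auto cong: nn_integral_cong)
  next
    case (set A)
    note [measurable] = set
    have "{x. (x, snd p) \<in> A} \<in> sets borel" "{y. (fst p, y) \<in> A} \<in> sets borel"
      using measurable_sets[OF c(1) set] measurable_sets[OF c(2) set] by (simp_all add: vimage_def)
    moreover have "(\<lambda>x. indicator A (x, snd p) :: ennreal) = indicator {x. (x, snd p) \<in> A}"
      "(\<lambda>y. indicator A (fst p, y) :: ennreal) = indicator {y. (fst p, y) \<in> A}"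
      by (auto simp: indicator_def)
    ultimately show ?case
      using emeasure_cross_length[OF set, of p] set by simp
  next
    case (mult u c)
    note [measurable] = mult(2)
    show ?case
      by (subst (1 2 3) nn_integral_cmult) (use mult in \<open>auto simp: distrib_left\<close>)
  next
    case (add u v)
    note [measurable] = add(1,4)
    show ?case
      by (subst (1 2 3) nn_integral_add) (use add in \<open>auto simp: ac_simps\<close>)
  next
    case (seq U)
    note [measurable] = seq(1)
    have mono: "U m q \<le> U n q" if "m \<le> n" for m n q
      using incseqD[OF seq(3) that] by (rule le_funD)
    have eq: "(\<integral>\<^sup>+x. (SUP i. U i) (h x) \<partial>M) = (SUP i. \<integral>\<^sup>+x. U i (h x) \<partial>M)"
      if [measurable]: "h \<in> M \<rightarrow>\<^sub>M borel" for h and M :: "'b measure"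
      unfolding SUP_apply
      by (rule nn_integral_monotone_convergence_SUP) (auto simp: incseq_def le_fun_def mono)
    have inc: "incseq (\<lambda>i. \<integral>\<^sup>+x. U i (h x) \<partial>M)" for h and M :: "'b measure"
      by (auto simp: incseq_def intro!: nn_integral_mono mono)
    have "(\<integral>\<^sup>+q. (SUP i. U i) q \<partial>cross_length p) = (SUP i. \<integral>\<^sup>+q. U i q \<partial>cross_length p)"
      unfolding SUP_apply
      by (rule nn_integral_monotone_convergence_SUP) (auto simp: incseq_def le_fun_def mono)
    also have "\<dots> = (SUP i. (\<integral>\<^sup>+x. U i (x, snd p) \<partial>lborel) + (\<integral>\<^sup>+y. U i (fst p, y) \<partial>lborel))"
      using seq by simp
    also have "\<dots> = (SUP i. \<integral>\<^sup>+x. U i (x, snd p) \<partial>lborel) + (SUP i. \<integral>\<^sup>+y. U i (fst p, y) \<partial>lborel)"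
      by (intro ennreal_SUP_add inc)
    finally have "(\<integral>\<^sup>+q. (SUP i. U i) q \<partial>cross_length p) =
      (SUP i. \<integral>\<^sup>+x. U i (x, snd p) \<partial>lborel) + (SUP i. \<integral>\<^sup>+y. U i (fst p, y) \<partial>lborel)" .
    moreover have "(\<integral>\<^sup>+x. (SUP i. U i) (x, snd p) \<partial>lborel) = (SUP i. \<integral>\<^sup>+x. U i (x, snd p) \<partial>lborel)"
      "(\<integral>\<^sup>+y. (SUP i. U i) (fst p, y) \<partial>lborel) = (SUP i. \<integral>\<^sup>+y. U i (fst p, y) \<partial>lborel)"
      by (rule eq, simp)+
    ultimately show ?case by (simp only:)
  qed
qed

text \<open>The arms are given as \<open>closed_segment\<close>, which does not care about the order
  of its end points, so that hooks on both sides of the graph are covered. \<open>pos\<close>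
  excludes the hook of length zero, on which the step is a point mass.\<close>

lemma integral_uniform_on_hook:
  fixes F :: "real \<times> real \<Rightarrow> real"
  assumes F [measurable]: "F \<in> borel_measurable borel" and B: "\<And>q. \<bar>F q\<bar> \<le> B"
    and N [measurable]: "N \<in> sets borel"
    and N1: "{x'. (x', y) \<in> N} = closed_segment x w" and N2: "{y'. (x, y') \<in> N} = closed_segment y v"
    and pos: "0 < \<bar>w - x\<bar> + \<bar>v - y\<bar>"
  shows "(\<integral>q. F q \<partial>uniform_on_hook (x, y) N) =
    ((LBINT t:closed_segment x w. F (t, y)) + (LBINT t:closed_segment y v. F (x, t))) /
      (\<bar>w - x\<bar> + \<bar>v - y\<bar>)"
proof -
  have c [measurable]: "(\<lambda>t. (t, y)) \<in> borel_measurable borel" "(\<lambda>t. (x, t)) \<in> borel_measurable borel"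
    by (intro borel_measurable_continuous_onI continuous_intros)+
  define l where "l = \<bar>w - x\<bar> + \<bar>v - y\<bar>"
  have seg: "emeasure lborel (closed_segment p q) = ennreal \<bar>q - p\<bar>" "closed_segment p q \<in> sets borel"
    for p q :: real
    by (auto simp: closed_segment_eq_real_ivl)
  have em: "emeasure (cross_length (x, y)) N = ennreal l"
    by (simp add: emeasure_cross_length[OF N] N1 N2 seg l_def)
  then have "emeasure (cross_length (x, y)) N \<noteq> 0"
    using pos by (simp add: l_def del: ennreal_plus)
  then have U: "uniform_on_hook (x, y) N = uniform_measure (cross_length (x, y)) N"
    by (simp add: uniform_on_hook_def)
  interpret U: prob_space "uniform_on_hook (x, y) N"
    unfolding U by (rule prob_space_uniform_measure) (use em \<open>_ \<noteq> 0\<close> in auto)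
  have sets_U [measurable_cong]: "sets (uniform_on_hook (x, y) N) = sets borel"
    by (simp add: U)
  have bint: "set_integrable lborel (closed_segment p q) h"
    if "h \<in> borel_measurable borel" "\<And>t. \<bar>h t\<bar> \<le> B'" for p q B' and h :: "real \<Rightarrow> real"
    unfolding set_integrable_def
    by (rule integrableI_bounded_set[where A="closed_segment p q" and B=B'])
       (use that seg[of p q] in \<open>auto split: split_indicator\<close>)
  have pos_case: "(\<integral>q. F q \<partial>uniform_on_hook (x, y) N) =
      ((LBINT t:closed_segment x w. F (t, y)) + (LBINT t:closed_segment y v. F (x, t))) / l"
    if F [measurable]: "F \<in> borel_measurable borel" and nn: "\<And>q. 0 \<le> F q" and B: "\<And>q. F q \<le> B"
    for F :: "real \<times> real \<Rightarrow> real" and B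
  proof -
    let ?I = "LBINT t:closed_segment x w. F (t, y)" and ?J = "LBINT t:closed_segment y v. F (x, t)"
    have ind: "(indicator N (t, y) :: ennreal) = indicator (closed_segment x w) t"
      "(indicator N (x, t) :: ennreal) = indicator (closed_segment y v) t" for t
      using N1 N2 by (auto simp: indicator_def)
    have lb: "(\<integral>\<^sup>+t. ennreal (h t) * indicator (closed_segment p q) t \<partial>lborel) = ennreal (LBINT t:closed_segment p q. h t)"
      if "h \<in> borel_measurable borel" "\<And>t. 0 \<le> h t" "\<And>t. h t \<le> B" for p q and h :: "real \<Rightarrow> real"
    proof -
      have i: "integrable lborel (\<lambda>t. indicator (closed_segment p q) t *\<^sub>R h t)"
        using bint[of h B p q] that unfolding set_integrable_def by auto
      have "(\<integral>\<^sup>+t. ennreal (h t) * indicator (closed_segment p q) t \<partial>lborel) =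
          (\<integral>\<^sup>+t. ennreal (indicator (closed_segment p q) t *\<^sub>R h t) \<partial>lborel)"
        by (rule nn_integral_cong) (auto simp: indicator_def)
      also have "\<dots> = ennreal (LBINT t:closed_segment p q. h t)"
        unfolding set_lebesgue_integral_def by (rule nn_integral_eq_integral[OF i]) (use that in auto)
      finally show ?thesis .
    qed
    have I: "0 \<le> ?I" "0 \<le> ?J"
      unfolding set_lebesgue_integral_def using nn by (auto intro!: Bochner_Integration.integral_nonneg)
    have "(\<integral>\<^sup>+q. ennreal (F q) \<partial>uniform_on_hook (x, y) N) =
        (\<integral>\<^sup>+q. ennreal (F q) * indicator N q \<partial>cross_length (x, y)) / ennreal l"
      unfolding U by (subst nn_integral_uniform_measure) (auto simp: em)
    also have "(\<integral>\<^sup>+q. ennreal (F q) * indicator N q \<partial>cross_length (x, y)) =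
        (\<integral>\<^sup>+t. ennreal (F (t, y)) * indicator (closed_segment x w) t \<partial>lborel) +
        (\<integral>\<^sup>+t. ennreal (F (x, t)) * indicator (closed_segment y v) t \<partial>lborel)"
      by (subst nn_integral_cross_length) (auto simp: ind)
    also have "\<dots> = ennreal (?I + ?J)"
      using I by (subst (1 2) lb) (auto simp: nn B)
    finally have *: "(\<integral>\<^sup>+q. ennreal (F q) \<partial>uniform_on_hook (x, y) N) = ennreal ((?I + ?J) / l)"
      using I pos by (simp add: divide_ennreal l_def del: ennreal_plus)
    have "(\<integral>q. F q \<partial>uniform_on_hook (x, y) N) = enn2real (ennreal ((?I + ?J) / l))"
      unfolding *[symmetric] by (rule integral_eq_nn_integral) (use nn in auto)
    then show ?thesis
      using I pos by (simp add: l_def)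
  qed
  \<comment> \<open>Shifting by \<open>B\<close> makes the integrand nonnegative. The shift adds
    \<open>B\<close> to the mean and \<open>B\<close> times each arm length to the numerator, and
    since the lengths add up to \<open>l\<close> both contributions cancel.\<close>
  have B0: "F q + B \<ge> 0" "F q + B \<le> 2 * B" for q using B[of q] by auto
  have "(\<integral>q. F q + B \<partial>uniform_on_hook (x, y) N) = (\<integral>q. F q \<partial>uniform_on_hook (x, y) N) + B"
  proof (subst Bochner_Integration.integral_add)
    show "integrable (uniform_on_hook (x, y) N) F"
      by (rule U.integrable_const_bound[where B=B]) (use B in auto)
  qed (auto simp: U.prob_space)
  moreover have "(LBINT t:closed_segment p q. h t + B) = (LBINT t:closed_segment p q. h t) + \<bar>q - p\<bar> * B"
    if "h \<in> borel_measurable borel" "\<And>t. \<bar>h t\<bar> \<le> B" for p q and h :: "real \<Rightarrow> real"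
  proof -
    have "(LBINT t:closed_segment p q. h t + B) = (LBINT t:closed_segment p q. h t) + (LBINT t:closed_segment p q. B)"
      using bint[OF that, of p q] bint[of "\<lambda>_. B" "\<bar>B\<bar>" p q] by (intro set_integral_add) auto
    also have "(LBINT t:closed_segment p q. B) = \<bar>q - p\<bar> * B"
      unfolding set_lebesgue_integral_def using seg[of p q] by (simp add: measure_def)
    finally show ?thesis .
  qed
  ultimately have "(\<integral>q. F q \<partial>uniform_on_hook (x, y) N) + B =
      ((LBINT t:closed_segment x w. F (t, y)) + \<bar>w - x\<bar> * B +
       ((LBINT t:closed_segment y v. F (x, t)) + \<bar>v - y\<bar> * B)) / l"
    using pos_case[of "\<lambda>q. F q + B" "2 * B"] B B0 by simp
  then show ?thesis
    using pos by (simp add: field_simps l_def)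
qed

text \<open>\<open>p \<in> N\<close> covers a hook of length zero, where the walk stays at
  \<open>p\<close>.\<close>

lemma AE_uniform_on_hook:
  assumes N: "N \<in> sets borel" and p: "p \<in> N"
  shows "AE q in uniform_on_hook p N. q \<in> N"
proof (cases "emeasure (cross_length p) N = 0")
  case True
  moreover have "AE q in return borel p. q \<in> N"
    using p N by (subst AE_return) simp_all
  ultimately show ?thesis unfolding uniform_on_hook_def by (simp only: if_True simp_thms)
next
  case False
  have "AE q in uniform_measure (cross_length p) N. q \<in> N"
    using N by (intro AE_uniform_measureI) simp_all
  with False show ?thesis unfolding uniform_on_hook_def by (simp only: if_False)
qed

section \<open>Calculus along the boundary of the diagram\<close>

text \<open>
  \<open>f\<close> is continued by constants outside \<open>{a..b}\<close>; on the finite set \<open>S\<close> and outside \<open>{a<..<b}\<close> the values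
  of \<open>f'\<close> carry no meaning.
\<close>

locale smooth_diagram =
  fixes a b :: real and f f' :: "real \<Rightarrow> real" and S :: "real set" and c C M :: real
  assumes ab: "a < b" and cont: "continuous_on UNIV f"
    and f_below: "\<And>x. x \<le> a \<Longrightarrow> f x = 0" and f_above: "\<And>x. b \<le> x \<Longrightarrow> f x = f b"
    and fin: "finite S"
    and deriv: "\<And>x. x \<in> {a<..<b} - S \<Longrightarrow> (f has_real_derivative f' x) (at x)"
    and f'_meas [measurable]: "f' \<in> borel_measurable borel"
    and c: "0 < c" "\<And>x. c \<le> f' x" and C: "\<And>x. f' x \<le> C"
    and lip: "\<And>x y. closed_segment x y \<subseteq> {a<..<b} - S \<Longrightarrow> \<bar>f' x - f' y\<bar> \<le> M * \<bar>x - y\<bar>"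
begin

text \<open>Clamping makes \<open>g\<close>, \<open>s\<close> and \<open>A z\<close> continuous and bounded on the whole line.\<close>

definition clamp :: "real \<Rightarrow> real" where "clamp x = max a (min b x)"

lemma clamp_in [simp]: "a \<le> clamp x" "clamp x \<le> b"
  using ab by (auto simp: clamp_def)

lemma clamp_id [simp]: "a \<le> x \<Longrightarrow> x \<le> b \<Longrightarrow> clamp x = x"
  by (auto simp: clamp_def)

lemma f_clamp: "f (clamp x) = f x"
  using f_below[of x] f_below[of a] f_above[of x] ab by (auto simp: clamp_def max_def min_def)

lemma continuous_clamp [continuous_intros]: "continuous_on A h \<Longrightarrow> continuous_on A (\<lambda>x. clamp (h x))"
  unfolding clamp_def by (intro continuous_intros)

lemma f_integral:
  assumes "a \<le> x" "x \<le> y" "y \<le> b"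
  shows "(f' has_integral f y - f x) {x..y}"
  using assms
  by (intro fundamental_theorem_of_calculus_interior_strong[OF fin])
     (auto intro!: deriv continuous_on_subset[OF cont] simp flip: has_real_derivative_iff_has_vector_derivative)

text \<open>Since \<open>f\<close> may have kinks between \<open>x\<close> and \<open>y\<close>, the
  bounds on the slope are integrated instead of being applied at an intermediate point.\<close>

lemma f_diff:
  assumes "a \<le> x" "x \<le> y" "y \<le> b"
  shows "c * (y - x) \<le> f y - f x" "f y - f x \<le> C * (y - x)"
  using has_integral_le[OF has_integral_const_real[of c x y] f_integral[OF assms]]
    has_integral_le[OF f_integral[OF assms] has_integral_const_real[of C x y]] c C assms
  by (auto simp: mult.commute)

lemma f_mono: "x \<le> y \<Longrightarrow> f x \<le> f y"
proof -
  assume "x \<le> y"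
  then have xy: "clamp x \<le> clamp y" by (auto simp: clamp_def)
  then have "0 \<le> c * (clamp y - clamp x)" using c by simp
  also have "\<dots> \<le> f (clamp y) - f (clamp x)" using f_diff(1) xy by simp
  finally show ?thesis by (simp add: f_clamp)
qed

lemma f_strict: "a \<le> x \<Longrightarrow> x < y \<Longrightarrow> y \<le> b \<Longrightarrow> f x < f y"
  using f_diff(1)[of x y] mult_pos_pos[of c "y - x"] c by linarith

lemma f_le_iff: "x \<in> {a..b} \<Longrightarrow> y \<in> {a..b} \<Longrightarrow> f x \<le> f y \<longleftrightarrow> x \<le> y"
  using f_mono[of x y] f_strict[of y x] by (cases "x \<le> y") auto

lemma f_bounds [simp]: "0 \<le> f x" "f x \<le> f b"
  using f_mono[of a "clamp x"] f_mono[of "clamp x" b] f_below[of a] by (auto simp: f_clamp)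

lemma f_a [simp]: "f a = 0" by (simp add: f_below)

lemma f_b_pos: "0 < f b" using f_strict[of a b] ab by simp

definition g :: "real \<Rightarrow> real" where "g y = inv_into {a..b} f (max 0 (min (f b) y))"

lemma f_image: "f ` {a..b} = {0..f b}"
proof
  show "{0..f b} \<subseteq> f ` {a..b}"
    using IVT'[of f a _ b] ab continuous_on_subset[OF cont] by (fastforce simp: image_iff)
qed auto

lemma f_inj: "inj_on f {a..b}"
  by (rule inj_onI) (metis f_le_iff order.antisym order.refl)

lemma g_in [simp]: "a \<le> g y" "g y \<le> b"
  using inv_into_into[of "max 0 (min (f b) y)" f "{a..b}"] f_b_pos by (auto simp: g_def f_image)

lemma f_g [simp]: "0 \<le> y \<Longrightarrow> y \<le> f b \<Longrightarrow> f (g y) = y"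
  unfolding g_def using f_inv_into_f[of "max 0 (min (f b) y)" f "{a..b}"] by (simp add: f_image)

lemma g_f [simp]: "a \<le> x \<Longrightarrow> x \<le> b \<Longrightarrow> g (f x) = x"
  unfolding g_def using inv_into_f_f[OF f_inj, of x] by simp

lemma continuous_g [continuous_intros]: "continuous_on A h \<Longrightarrow> continuous_on A (\<lambda>y. g (h y))"
proof -
  have "continuous_on (f ` {a..b}) (inv_into {a..b} f)"
    by (rule continuous_on_inv[OF continuous_on_subset[OF cont]]) (auto simp: f_inj inv_into_f_f)
  then have "continuous_on A (\<lambda>y. inv_into {a..b} f (max 0 (min (f b) (h y))))" if "continuous_on A h"
    by (rule continuous_on_compose2) (use that f_b_pos in \<open>auto simp: f_image intro!: continuous_intros\<close>)
  then show "continuous_on A h \<Longrightarrow> continuous_on A (\<lambda>y. g (h y))"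
    unfolding g_def .
qed

lemma f_le_iff_g: "a \<le> x \<Longrightarrow> x \<le> b \<Longrightarrow> 0 \<le> y \<Longrightarrow> y \<le> f b \<Longrightarrow> f x \<le> y \<longleftrightarrow> x \<le> g y"
  using f_le_iff[of x "g y"] by simp

lemma g_le_iff_f: "a \<le> x \<Longrightarrow> x \<le> b \<Longrightarrow> 0 \<le> y \<Longrightarrow> y \<le> f b \<Longrightarrow> y \<le> f x \<longleftrightarrow> g y \<le> x"
  using f_le_iff[of "g y" x] by simp

definition s :: "real \<Rightarrow> real" where "s x = clamp x + f x"

lemma continuous_f [continuous_intros]: "continuous_on A h \<Longrightarrow> continuous_on A (\<lambda>x. f (h x))"
  by (rule continuous_on_compose2[OF cont]) auto

lemma continuous_s [continuous_intros]: "continuous_on A h \<Longrightarrow> continuous_on A (\<lambda>x. s (h x))"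
  unfolding s_def by (intro continuous_intros)

lemma s_meas [measurable]: "s \<in> borel_measurable borel" "f \<in> borel_measurable borel"
  by (intro borel_measurable_continuous_onI continuous_intros)+

lemma s_eq: "a \<le> x \<Longrightarrow> x \<le> b \<Longrightarrow> s x = x + f x"
  by (simp add: s_def)

lemma s_a [simp]: "s a = a"
  using ab by (simp add: s_def)

lemma s_mono: "x \<le> y \<Longrightarrow> s x \<le> s y"
  using f_mono[of x y] by (auto simp: s_def clamp_def)

lemma s_diff: "a \<le> x \<Longrightarrow> x \<le> y \<Longrightarrow> y \<le> b \<Longrightarrow> y - x \<le> s y - s x"
  using f_mono[of x y] by (auto simp: s_eq)

lemma s_diff_abs: "x \<in> {a..b} \<Longrightarrow> y \<in> {a..b} \<Longrightarrow> \<bar>y - x\<bar> \<le> \<bar>s y - s x\<bar>"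
  using s_diff[of x y] s_diff[of y x] by (cases "x \<le> y") auto

lemma s_deriv: "x \<in> {a<..<b} - S \<Longrightarrow> (s has_real_derivative 1 + f' x) (at x)"
proof -
  assume x: "x \<in> {a<..<b} - S"
  then have "((\<lambda>x. x + f x) has_real_derivative 1 + f' x) (at x)"
    by (auto intro!: derivative_eq_intros deriv)
  then show ?thesis
    by (rule has_field_derivative_transform_within_open[where S="{a<..<b}"])
       (use x in \<open>auto simp: s_eq\<close>)
qed

lemma f'_pos: "0 < f' x" "0 < 1 + f' x"
  using c(1) c(2)[of x] by auto

text \<open>The Cauchy kernel pulled back along \<open>s\<close>: its mean under the law of
  \<open>X\<close> is the Cauchy transform of the law of \<open>s X\<close>.\<close>

definition cauchy_kernel :: "complex \<Rightarrow> real \<Rightarrow> complex" where "cauchy_kernel z u = 1 / (z - of_real (s u))"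

definition A :: "complex \<Rightarrow> real \<Rightarrow> complex" where "A z u = integral {a..clamp u} (cauchy_kernel z)"

lemma A_a [simp]: "A z a = 0"
  using ab by (simp add: A_def)

lemma A_clamp: "A z (clamp u) = A z u"
  by (simp add: A_def)

context
  fixes z :: complex
  assumes z: "Im z \<noteq> 0"
begin

lemma z_minus_s [simp]: "z - of_real r \<noteq> 0" "z \<noteq> of_real r"
  using z by (auto simp: complex_eq_iff)

lemma continuous_cauchy_kernel [continuous_intros]: "continuous_on T h \<Longrightarrow> continuous_on T (\<lambda>u. cauchy_kernel z (h u))"
  unfolding cauchy_kernel_def by (intro continuous_intros) auto

lemma cauchy_kernel_mult [simp]: "(z - of_real (s u)) * cauchy_kernel z u = 1" "cauchy_kernel z u * (z - of_real (s u)) = 1"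
  by (auto simp: cauchy_kernel_def)

lemma norm_cauchy_kernel_le: "norm (cauchy_kernel z u) \<le> 1 / \<bar>Im z\<bar>"
  using abs_Im_le_cmod[of "z - of_real (s u)"] z
  by (auto simp: cauchy_kernel_def norm_divide intro!: divide_left_mono mult_pos_pos)

lemma continuous_A [continuous_intros]: "continuous_on T h \<Longrightarrow> continuous_on T (\<lambda>u. A z (h u))"
proof -
  have "continuous_on {a..b} (\<lambda>u. integral {a..u} (cauchy_kernel z))"
    by (intro indefinite_integral_continuous_1 integrable_continuous_real continuous_intros)
  then show "continuous_on T h \<Longrightarrow> continuous_on T (\<lambda>u. A z (h u))"
    unfolding A_def by (rule continuous_on_compose2) (auto intro: continuous_intros)
qed

lemma A_deriv: "u \<in> {a<..<b} \<Longrightarrow> (A z has_vector_derivative cauchy_kernel z u) (at u)"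
proof -
  assume u: "u \<in> {a<..<b}"
  have "((\<lambda>u. integral {a..u} (cauchy_kernel z)) has_vector_derivative cauchy_kernel z u) (at u within {a..b})"
    using u by (intro integral_has_vector_derivative continuous_intros) auto
  then have "((\<lambda>u. integral {a..u} (cauchy_kernel z)) has_vector_derivative cauchy_kernel z u) (at u)"
    using u by (simp add: at_within_Icc_at)
  then show ?thesis
    by (rule has_vector_derivative_transform_within_open[where S="{a<..<b}"])
       (use u in \<open>auto simp: A_def\<close>)
qed

lemma exp_A_deriv:
  "u \<in> {a<..<b} \<Longrightarrow> ((\<lambda>u. exp (k * A z u)) has_vector_derivative k * cauchy_kernel z u * exp (k * A z u)) (at u)"
  using field_vector_diff_chain_at[of "\<lambda>u. k * A z u" "k * cauchy_kernel z u" u exp "exp (k * A z u)"]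
    has_vector_derivative_mult_right[OF A_deriv, of u k]
  by (auto simp: o_def intro: DERIV_exp)

lemma integral_horizontal:
  assumes "a \<le> x" "x \<le> w" "w \<le> b"
  shows "((\<lambda>u. cauchy_kernel z u * exp (- A z u)) has_integral exp (- A z x) - exp (- A z w)) {x..w}"
proof -
  have "((\<lambda>u. cauchy_kernel z u * exp (- A z u)) has_integral - exp (- A z w) - - exp (- A z x)) {x..w}"
  proof (rule fundamental_theorem_of_calculus_interior_strong[OF finite.emptyI])
    show "((\<lambda>u. - exp (- A z u)) has_vector_derivative cauchy_kernel z u * exp (- A z u)) (at u)"
      if "u \<in> {x<..<w} - {}" for u
      using has_vector_derivative_minus[OF exp_A_deriv[of u "-1"]] that assms by auto
  qed (use assms in \<open>auto intro!: continuous_intros\<close>)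
  then show ?thesis by simp
qed

lemma integral_vertical:
  assumes "a \<le> x" "x \<le> w" "w \<le> b"
  shows "((\<lambda>y. exp (A z (g y))) has_integral
    (of_real (s w) - z) * exp (A z w) - (of_real (s x) - z) * exp (A z x)) {f x..f w}"
proof -
  let ?\<Phi> = "\<lambda>y. (of_real (g y + y) - z) * exp (A z (g y))"
  have "((\<lambda>y. exp (A z (g y))) has_integral ?\<Phi> (f w) - ?\<Phi> (f x)) {f x..f w}"
  proof (rule fundamental_theorem_of_calculus_interior_strong)
    show "finite (f ` S)" using fin by simp
    show "f x \<le> f w" using assms by (simp add: f_mono)
    show "continuous_on {f x..f w} ?\<Phi>" by (intro continuous_intros)
    fix y assume y: "y \<in> {f x<..<f w} - f ` S"
    define u where "u = g y"
    have "f x < y" "y < f w" using y by auto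
    then have y0: "0 \<le> y" "y \<le> f b" using f_bounds(1)[of x] f_bounds(2)[of w] by linarith+
    then have fu: "f u = y" by (simp add: u_def)
    have "u \<notin> S" using y fu by auto
    then have u: "u \<in> {x<..<w} - S"
      using y f_le_iff_g[of w y] g_le_iff_f[of x y] y0 assms fu by (auto simp: u_def)
    have gd: "(g has_real_derivative inverse (f' u)) (at y)"
    proof (rule DERIV_inverse_function[where f=f and a="f x" and b="f w"])
      show "(f has_real_derivative f' u) (at (g y))"
        using u assms by (simp add: u_def deriv)
      show "isCont g y"
        using continuous_on_eq_continuous_at[of UNIV g] continuous_g[OF continuous_on_id, of UNIV] by simp
      show "f (g t) = t" if "f x < t" "t < f w" for t
        using that f_bounds(1)[of x] f_bounds(2)[of w] by (intro f_g) linarith+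
    qed (use y f'_pos[of u] in auto)
    then have g: "(g has_vector_derivative inverse (f' u)) (at y)"
      by (simp add: has_real_derivative_iff_has_vector_derivative)
    have e: "((\<lambda>u. exp (A z u)) has_vector_derivative cauchy_kernel z u * exp (A z u)) (at (g y))"
      using exp_A_deriv[of u 1] u assms by (simp add: u_def)
    have 1: "((\<lambda>y. exp (A z (g y))) has_vector_derivative inverse (f' u) *\<^sub>R (cauchy_kernel z u * exp (A z u))) (at y)"
      using vector_diff_chain_at[OF g e] by (simp add: o_def)
    have 2: "((\<lambda>y. of_real (g y + y) - z) has_vector_derivative of_real (inverse (f' u) + 1)) (at y)"
      by (auto intro!: derivative_eq_intros gd)
    have su: "g y + y = s u" using u assms fu by (simp add: u_def[symmetric] s_eq)
    have "(?\<Phi> has_vector_derivative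
        (of_real (g y + y) - z) * (inverse (f' u) *\<^sub>R (cauchy_kernel z u * exp (A z u))) +
        of_real (inverse (f' u) + 1) * exp (A z (g y))) (at y)"
      by (rule has_vector_derivative_mult[OF 2 1])
    also have "(of_real (g y + y) - z) * (inverse (f' u) *\<^sub>R (cauchy_kernel z u * exp (A z u))) =
        - (of_real (inverse (f' u)) * ((z - of_real (s u)) * cauchy_kernel z u) * exp (A z u))"
      unfolding su by (simp add: scaleR_conv_of_real algebra_simps)
    also have "\<dots> + of_real (inverse (f' u) + 1) * exp (A z (g y)) = exp (A z (g y))"
      unfolding cauchy_kernel_mult by (simp add: u_def[symmetric] algebra_simps)
    finally show "(?\<Phi> has_vector_derivative exp (A z (g y))) (at y)" .
  qed
  then show ?thesis using assms by (simp add: s_eq)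
qed

text \<open>\<open>1 + f'\<close> is the derivative of \<open>s\<close>, and \<open>0 < Im z\<close>
  keeps \<open>z - s u\<close> off the branch cut of the principal logarithm.\<close>

lemma integral_log:
  assumes "a \<le> x" "x \<le> w" "w \<le> b" and "0 < Im z"
  shows "((\<lambda>u. of_real (1 + f' u) * cauchy_kernel z u) has_integral Ln (z - of_real (s x)) - Ln (z - of_real (s w))) {x..w}"
proof -
  have np: "z - of_real (s u) \<notin> \<real>\<^sub>\<le>\<^sub>0" for u
    using assms by (auto simp: complex_nonpos_Reals_iff)
  have "((\<lambda>u. of_real (1 + f' u) * cauchy_kernel z u) has_integral - Ln (z - of_real (s w)) - - Ln (z - of_real (s x))) {x..w}"
  proof (rule fundamental_theorem_of_calculus_interior_strong[OF fin])
    show "continuous_on {x..w} (\<lambda>u. - Ln (z - of_real (s u)))"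
      by (intro continuous_intros) (use np in auto)
    fix u assume u: "u \<in> {x<..<w} - S"
    have "((\<lambda>u. z - of_real (s u)) has_vector_derivative - of_real (1 + f' u)) (at u)"
      using s_deriv[of u] u assms
      by (auto intro!: derivative_eq_intros simp: has_real_derivative_iff_has_vector_derivative)
    from field_vector_diff_chain_at[OF this has_field_derivative_Ln[OF np]]
    have "((\<lambda>u. Ln (z - of_real (s u))) has_vector_derivative - (of_real (1 + f' u) * cauchy_kernel z u)) (at u)"
      by (simp add: o_def cauchy_kernel_def divide_inverse algebra_simps)
    then show "((\<lambda>u. - Ln (z - of_real (s u))) has_vector_derivative of_real (1 + f' u) * cauchy_kernel z u) (at u)"
      using has_vector_derivative_minus by fastforce
  qed (use assms in auto)
  then show ?thesis by simp
qed

end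

end

section \<open>Hooks and harmonic functions\<close>

lemma uniform_on_hook_degenerate:
  assumes N: "N \<in> sets borel"
    and "{x'. (x', y) \<in> N} = {x}" and "{y'. (x, y') \<in> N} = {y}"
  shows "uniform_on_hook (x, y) N = return borel (x, y)"
  using assms by (simp add: uniform_on_hook_def emeasure_cross_length)

lemma set_integrable_continuous_segment:
  fixes h :: "real \<Rightarrow> 'b::euclidean_space"
  shows "continuous_on (closed_segment p q) h \<Longrightarrow> set_integrable lborel (closed_segment p q) h"
  by (auto simp: closed_segment_eq_real_ivl intro!: borel_integrable_atLeastAtMost' split: if_splits)

text \<open>Meant for the hook length along an arm from \<open>p\<close> to \<open>q\<close>: at
  \<open>t\<close> the rest of this arm has length \<open>\<bar>t - q\<bar>\<close>, and
  \<open>k\<close> bounds the other arm.\<close>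

lemma LBINT_distance_to_end:
  fixes p q :: real
  shows "(LBINT t:closed_segment p q. \<bar>t - q\<bar> + k) = (q - p)\<^sup>2 / 2 + k * \<bar>q - p\<bar>"
proof -
  have "((\<lambda>t. \<bar>t - q\<bar> + k) has_integral (q - p)\<^sup>2 / 2 + k * \<bar>q - p\<bar>) (closed_segment p q)"
  proof (cases "p \<le> q")
    case True
    have "((\<lambda>t. (q - t) + k) has_integral (- (q - q)\<^sup>2 / 2 + k * q) - (- (q - p)\<^sup>2 / 2 + k * p)) {p..q}"
      using True
      by (intro fundamental_theorem_of_calculus)
         (auto intro!: derivative_eq_intros simp: field_simps simp flip: has_real_derivative_iff_has_vector_derivative)
    then have "((\<lambda>t. \<bar>t - q\<bar> + k) has_integral (- (q - q)\<^sup>2 / 2 + k * q) - (- (q - p)\<^sup>2 / 2 + k * p)) {p..q}"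
      by (rule has_integral_eq[rotated]) auto
    then show ?thesis using True by (simp add: closed_segment_eq_real_ivl algebra_simps)
  next
    case False
    have "((\<lambda>t. (t - q) + k) has_integral ((p - q)\<^sup>2 / 2 + k * p) - ((q - q)\<^sup>2 / 2 + k * q)) {q..p}"
      using False
      by (intro fundamental_theorem_of_calculus)
         (auto intro!: derivative_eq_intros simp: field_simps simp flip: has_real_derivative_iff_has_vector_derivative)
    then have "((\<lambda>t. \<bar>t - q\<bar> + k) has_integral ((p - q)\<^sup>2 / 2 + k * p) - ((q - q)\<^sup>2 / 2 + k * q)) {q..p}"
      by (rule has_integral_eq[rotated]) auto
    then show ?thesis using False by (simp add: closed_segment_eq_real_ivl algebra_simps power2_commute)
  qed
  moreover have "set_integrable lborel (closed_segment p q) (\<lambda>t. \<bar>t - q\<bar> + k)"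
    by (intro set_integrable_continuous_segment continuous_intros)
  ultimately show ?thesis
    by (simp add: set_borel_integral_eq_integral integral_unique)
qed

context smooth_diagram
begin

definition H :: "complex \<Rightarrow> real \<times> real \<Rightarrow> complex" where
  "H z p = exp (A z (g (snd p)) - A z (fst p)) * cauchy_kernel z (fst p)"

lemma continuous_H: "Im z \<noteq> 0 \<Longrightarrow> continuous_on UNIV (H z)"
  unfolding H_def[abs_def] by (intro continuous_intros)

lemma A_bounded:
  assumes "Im z \<noteq> 0"
  obtains B where "\<And>u. norm (A z u) \<le> B"
proof -
  have "bounded (A z ` {a..b})"
    by (intro compact_imp_bounded compact_continuous_image continuous_A assms compact_Icc continuous_on_id)
  then obtain B where "\<forall>v\<in>A z ` {a..b}. norm v \<le> B"
    unfolding bounded_iff by blast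
  then have "norm (A z (clamp u)) \<le> B" for u by simp
  then show ?thesis using that[of B] unfolding A_clamp by blast
qed

lemma H_bounded:
  assumes "Im z \<noteq> 0"
  obtains B where "\<And>p. norm (H z p) \<le> B"
proof -
  obtain B where B: "\<And>u. norm (A z u) \<le> B" using A_bounded[OF assms] by blast
  have "norm (H z p) \<le> exp (2 * B) * (1 / \<bar>Im z\<bar>)" for p
  proof -
    have "Re (A z u) \<le> B" "- B \<le> Re (A z u)" for u
      using order_trans[OF abs_Re_le_cmod B[of u]] by (auto simp: abs_le_iff)
    from this(1)[of "g (snd p)"] this(2)[of "fst p"] show ?thesis
      unfolding H_def norm_mult norm_exp_eq_Re
      by (intro mult_mono norm_cauchy_kernel_le assms) auto
  qed
  then show ?thesis by (rule that)
qed

text \<open>With \<open>E = exp (A w - A x)\<close>, \<open>w = g y\<close> and \<open>k\<close> the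
  kernel at \<open>x\<close>, the horizontal arm yields \<open>E - 1\<close> and the vertical arm
  \<open>(s w - z) * k * E + 1\<close>. As \<open>E = k * (z - s x) * E\<close>, the sum is
  \<open>(s w - s x) * k * E\<close>, which is \<open>(s w - s x) * H z (x, y)\<close>. Below the
  graph both arms are traversed backwards and the whole identity changes sign; this is the case
  distinction.\<close>

lemma harmonic:
  assumes z: "Im z \<noteq> 0" and x: "a \<le> x" "x \<le> b" and y: "0 \<le> y" "y \<le> f b"
  shows "\<exists>I J. ((\<lambda>t. H z (t, y)) has_integral I) (closed_segment x (g y)) \<and>
    ((\<lambda>t. H z (x, t)) has_integral J) (closed_segment y (f x)) \<and>
    I + J = of_real \<bar>s (g y) - s x\<bar> * H z (x, y)"
proof -
  let ?w = "g y" and ?E = "exp (A z (g y) - A z x)"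
  have fw: "f ?w = y" using y by simp
  have hor: "((\<lambda>t. H z (t, y)) has_integral exp (A z ?w) * (exp (- A z p) - exp (- A z q))) {p..q}"
    if "a \<le> p" "p \<le> q" "q \<le> b" for p q
  proof -
    have "H z (t, y) = exp (A z ?w) * (cauchy_kernel z t * exp (- A z t))" for t
      by (simp add: H_def exp_diff exp_minus divide_inverse)
    then show ?thesis
      using has_integral_mult_right[OF integral_horizontal[OF z that], of "exp (A z ?w)"] by simp
  qed
  have ver: "((\<lambda>t. H z (x, t)) has_integral cauchy_kernel z x * exp (- A z x) *
      ((of_real (s q) - z) * exp (A z q) - (of_real (s p) - z) * exp (A z p))) {f p..f q}"
    if "a \<le> p" "p \<le> q" "q \<le> b" for p q
  proof -
    have "H z (x, t) = cauchy_kernel z x * exp (- A z x) * exp (A z (g t))" for t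
      by (simp add: H_def exp_diff exp_minus divide_inverse mult_ac)
    then show ?thesis
      using has_integral_mult_right[OF integral_vertical[OF z that], of "cauchy_kernel z x * exp (- A z x)"] by simp
  qed
  have alg: "exp (A z ?w) * (exp (- A z x) - exp (- A z ?w)) + cauchy_kernel z x * exp (- A z x) *
      ((of_real (s ?w) - z) * exp (A z ?w) - (of_real (s x) - z) * exp (A z x)) =
      of_real (s ?w - s x) * H z (x, y)" (is "?L = _")
  proof -
    have e: "exp (A z u) * exp (- A z u) = 1" "exp (- A z u) * exp (A z u) = 1" for u
      by (simp_all flip: exp_add)
    have E: "exp (A z ?w) * exp (- A z x) = ?E" by (simp flip: exp_add)
    have k: "cauchy_kernel z x * of_real (s x) = cauchy_kernel z x * z - 1"
      using cauchy_kernel_mult(2)[OF z, of x] by (simp add: algebra_simps)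
    have "?L = ?E - 1 + (of_real (s ?w) - z) * cauchy_kernel z x * ?E + (cauchy_kernel z x * (z - of_real (s x))) * 1"
      using e(1)[of ?w] e(2)[of x] E by (simp add: algebra_simps)
    also have "\<dots> = ?E + (of_real (s ?w) - z) * cauchy_kernel z x * ?E"
      by (simp add: z)
    also have "\<dots> = (of_real (s ?w) - of_real (s x)) * cauchy_kernel z x * ?E"
      using arg_cong[OF k, of "\<lambda>t. t * ?E"] by (simp add: algebra_simps)
    finally show ?thesis by (simp add: H_def mult_ac)
  qed
  show ?thesis
  proof (cases "x \<le> ?w")
    case True
    then have "f x \<le> y" using f_mono[OF True] fw by simp
    then have seg: "closed_segment x ?w = {x..?w}" "closed_segment y (f x) = {f x..f ?w}"
      using True fw by (auto simp: closed_segment_eq_real_ivl)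
    have abs: "\<bar>s ?w - s x\<bar> = s ?w - s x" using s_mono[OF True] by simp
    show ?thesis
      unfolding seg abs using hor[OF x(1) True g_in(2)] ver[OF x(1) True g_in(2)] alg by blast
  next
    case False
    then have wx: "?w \<le> x" by simp
    then have "y \<le> f x" using f_mono[of ?w x] fw by simp
    then have seg: "closed_segment x ?w = {?w..x}" "closed_segment y (f x) = {f ?w..f x}"
      using False fw by (auto simp: closed_segment_eq_real_ivl)
    have abs: "\<bar>s ?w - s x\<bar> = - (s ?w - s x)" using s_mono[of ?w x] False by simp
    have alg': "exp (A z ?w) * (exp (- A z ?w) - exp (- A z x)) + cauchy_kernel z x * exp (- A z x) *
        ((of_real (s x) - z) * exp (A z x) - (of_real (s ?w) - z) * exp (A z ?w)) =
        of_real (- (s ?w - s x)) * H z (x, y)"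
      unfolding of_real_minus mult_minus_left alg[symmetric] by (simp only: algebra_simps) simp
    show ?thesis
      unfolding seg abs using hor[OF g_in(1) wx x(2)] ver[OF g_in(1) wx x(2)] alg' by blast
  qed
qed

text \<open>The hook length, expressed by \<open>s\<close> and \<open>g\<close> so that it is a
  bounded continuous function on the whole plane; on the rectangle \<open>len_eq\<close> splits it
  into the two arms.\<close>

definition len :: "real \<times> real \<Rightarrow> real" where
  "len p = \<bar>s (g (snd p)) - s (fst p)\<bar>"

lemma len_eq:
  assumes "a \<le> x" "x \<le> b" "0 \<le> y" "y \<le> f b"
  shows "len (x, y) = \<bar>g y - x\<bar> + \<bar>f x - y\<bar>"
  using assms f_mono[of x "g y"] f_mono[of "g y" x]
  by (cases "x \<le> g y") (auto simp: len_def s_eq)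

lemma continuous_len: "continuous_on UNIV len"
  unfolding len_def[abs_def] by (intro continuous_intros)

lemma s_bounds: "a \<le> s x" "s x \<le> b + f b"
  using f_bounds[of x] clamp_in[of x] unfolding s_def by linarith+

lemma len_bounds: "0 \<le> len p" "len p \<le> b + f b - a"
  using s_bounds[of "g (snd p)"] s_bounds[of "fst p"] by (auto simp: len_def)

lemma len_0D:
  assumes "len p = 0" "fst p \<in> {a..b}" "snd p \<in> {0..f b}"
  shows "snd p = f (fst p)"
  using assms len_eq[of "fst p" "snd p"] by auto

context
  fixes x y :: real and N :: "(real \<times> real) set"
  assumes x: "a \<le> x" "x \<le> b" and y: "0 \<le> y" "y \<le> f b" and N: "N \<in> sets borel"
    and N1: "{x'. (x', y) \<in> N} = closed_segment x (g y)"
    and N2: "{y'. (x, y') \<in> N} = closed_segment y (f x)"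
begin

lemma hook_cases:
  obtains "len (x, y) = 0" "uniform_on_hook (x, y) N = return borel (x, y)"
  | "0 < len (x, y)" "0 < \<bar>g y - x\<bar> + \<bar>f x - y\<bar>"
proof (cases "len (x, y) = 0")
  case True
  then have "g y = x" "f x = y" using len_eq[OF x y] by auto
  then have "uniform_on_hook (x, y) N = return borel (x, y)"
    using N1 N2 by (intro uniform_on_hook_degenerate N) auto
  with True that show ?thesis by blast
next
  case False
  then show ?thesis using that len_bounds(1)[of "(x, y)"] len_eq[OF x y] by auto
qed

text \<open>\<open>\<phi>\<close> will be \<open>Re\<close> and \<open>Im\<close>, because the facts
  about chains are stated for real functions. Being linear and bounded, it commutes with the
  integrals along the arms.\<close>

lemma integral_hook_H:
  fixes \<phi> :: "complex \<Rightarrow> real"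
  assumes z: "Im z \<noteq> 0" and \<phi>: "bounded_linear \<phi>"
  shows "(\<integral>q. \<phi> (H z q) \<partial>uniform_on_hook (x, y) N) = \<phi> (H z (x, y))"
proof -
  interpret \<phi>: bounded_linear \<phi> by (rule \<phi>)
  have contH: "continuous_on T (\<lambda>t. H z (h t))" if "continuous_on T h" for T and h :: "real \<Rightarrow> _"
    by (rule continuous_on_compose2[OF continuous_H[OF z] that]) simp
  have cont\<phi>: "continuous_on UNIV (\<lambda>q. \<phi> (H z q))"
    using continuous_on_compose2[OF \<phi>.continuous_on[OF continuous_on_id] continuous_H[OF z], of UNIV] by simp
  then have meas: "(\<lambda>q. \<phi> (H z q)) \<in> borel_measurable borel"
    by (rule borel_measurable_continuous_onI)
  obtain B where B: "\<And>p. norm (H z p) \<le> B" using H_bounded[OF z] by blast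
  obtain K where K: "\<And>v. \<bar>\<phi> v\<bar> \<le> norm v * K" "0 < K" using \<phi>.pos_bounded by auto
  have bnd: "\<bar>\<phi> (H z p)\<bar> \<le> B * K" for p
    using K B[of p] by (meson mult_right_mono less_imp_le order_trans)
  show ?thesis
  proof (cases rule: hook_cases)
    case 1
    then show ?thesis using meas by (simp add: integral_return)
  next
    case 2
    obtain I J where I: "((\<lambda>t. H z (t, y)) has_integral I) (closed_segment x (g y))"
      and J: "((\<lambda>t. H z (x, t)) has_integral J) (closed_segment y (f x))"
      and IJ: "I + J = of_real \<bar>s (g y) - s x\<bar> * H z (x, y)"
      using harmonic[OF z x y] by blast
    have seg: "(LBINT t:closed_segment p q. \<phi> (h t)) = \<phi> I"
      if "(h has_integral I) (closed_segment p q)" "continuous_on (closed_segment p q) h" for h I and p q :: real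
    proof -
      have "set_integrable lborel (closed_segment p q) (\<lambda>t. \<phi> (h t))"
        using that by (intro set_integrable_continuous_segment \<phi>.continuous_on)
      moreover have "((\<lambda>t. \<phi> (h t)) has_integral \<phi> I) (closed_segment p q)"
        using has_integral_linear[OF that(1) \<phi>] by (simp add: o_def)
      ultimately show ?thesis by (simp add: set_borel_integral_eq_integral integral_unique)
    qed
    have "(LBINT t:closed_segment x (g y). \<phi> (H z (t, y))) + (LBINT t:closed_segment y (f x). \<phi> (H z (x, t))) =
        \<phi> (I + J)"
      using I J by (subst (1 2) seg) (auto intro!: contH continuous_intros simp: \<phi>.add)
    also have "\<dots> = \<phi> (\<bar>s (g y) - s x\<bar> *\<^sub>R H z (x, y))"
      by (simp add: IJ scaleR_conv_of_real)
    also have "\<dots> = len (x, y) * \<phi> (H z (x, y))"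
      by (simp add: \<phi>.scaleR len_def)
    finally show ?thesis
      using integral_uniform_on_hook[OF meas bnd N N1 N2] 2 by (simp add: len_eq[OF x y])
  qed
qed

text \<open>For arms of lengths \<open>P\<close> and \<open>Q\<close>, a point at distance
  \<open>r\<close> from the end of one arm has hook length at most \<open>r\<close> plus the other
  arm. Averaging gives at most \<open>(P + Q) / 2 + P * Q / (P + Q)\<close>, and
  \<open>P * Q \<le> (P + Q)^2 / 4\<close> turns this into \<open>3 / 4\<close> of
  \<open>P + Q\<close>.\<close>

lemma integral_hook_len: "(\<integral>q. len q \<partial>uniform_on_hook (x, y) N) \<le> 3 / 4 * len (x, y)"
proof (cases rule: hook_cases)
  case 1
  have "len \<in> borel_measurable borel"
    using continuous_len by (rule borel_measurable_continuous_onI)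
  then show ?thesis using 1 by (simp add: integral_return)
next
  case 2
  define P where "P = \<bar>g y - x\<bar>"
  define Q where "Q = \<bar>f x - y\<bar>"
  have contl: "continuous_on T (\<lambda>t. len (h t))" if "continuous_on T h" for T and h :: "real \<Rightarrow> _"
    by (rule continuous_on_compose2[OF continuous_len that]) simp
  have "(LBINT t:closed_segment x (g y). len (t, y)) \<le> (LBINT t:closed_segment x (g y). \<bar>t - g y\<bar> + Q)"
  proof (rule set_integral_mono)
    fix t assume t: "t \<in> closed_segment x (g y)"
    then have t': "a \<le> t" "t \<le> b"
      using x by (auto simp: closed_segment_eq_real_ivl split: if_splits
          intro: order_trans[OF g_in(1)] order_trans[OF _ g_in(2)])
    \<comment> \<open>As \<open>f\<close> is monotone, the vertical distance to the graph can only
      shrink on the way from \<open>x\<close> to \<open>g y\<close>.\<close>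
    have "\<bar>f t - y\<bar> \<le> Q"
      using t f_mono[of t "g y"] f_mono[of "g y" t] f_mono[of t x] f_mono[of x t] y
      by (auto simp: Q_def closed_segment_eq_real_ivl split: if_splits)
    then show "len (t, y) \<le> \<bar>t - g y\<bar> + Q"
      using len_eq[OF t' y] by simp
  qed (intro set_integrable_continuous_segment contl continuous_intros)+
  also have "\<dots> = P\<^sup>2 / 2 + Q * P" by (simp add: LBINT_distance_to_end P_def)
  finally have I: "(LBINT t:closed_segment x (g y). len (t, y)) \<le> P\<^sup>2 / 2 + Q * P" .
  have "(LBINT t:closed_segment y (f x). len (x, t)) \<le> (LBINT t:closed_segment y (f x). \<bar>t - f x\<bar> + P)"
  proof (rule set_integral_mono)
    fix t assume t: "t \<in> closed_segment y (f x)"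
    then have t': "0 \<le> t" "t \<le> f b"
      using y f_bounds[of x] by (auto simp: closed_segment_eq_real_ivl simp del: f_bounds split: if_splits)
    have "f x \<le> t \<longleftrightarrow> x \<le> g t" "t \<le> f x \<longleftrightarrow> g t \<le> x"
      by (rule f_le_iff_g g_le_iff_f; use x t' in simp)+
    moreover have "g t \<le> g y \<longleftrightarrow> t \<le> y" "g y \<le> g t \<longleftrightarrow> y \<le> t"
      using g_le_iff_f[of "g y" t] f_le_iff_g[of "g y" t] t' y by simp_all
    ultimately have "\<bar>g t - x\<bar> \<le> P"
      using t by (auto simp: P_def closed_segment_eq_real_ivl split: if_splits)
    then show "len (x, t) \<le> \<bar>t - f x\<bar> + P"
      using len_eq[OF x t'] by simp
  qed (intro set_integrable_continuous_segment contl continuous_intros)+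
  also have "\<dots> = Q\<^sup>2 / 2 + P * Q" by (simp add: LBINT_distance_to_end Q_def)
  finally have J: "(LBINT t:closed_segment y (f x). len (x, t)) \<le> Q\<^sup>2 / 2 + P * Q" .
  have PQ: "0 < P + Q" using 2 by (simp add: P_def Q_def)
  have "len \<in> borel_measurable borel"
    using continuous_len by (rule borel_measurable_continuous_onI)
  then have "(\<integral>q. len q \<partial>uniform_on_hook (x, y) N) =
      ((LBINT t:closed_segment x (g y). len (t, y)) + (LBINT t:closed_segment y (f x). len (x, t))) / (P + Q)"
    unfolding P_def Q_def using len_bounds 2
    by (intro integral_uniform_on_hook[where B="b + f b - a"] N N1 N2) auto
  also have "\<dots> \<le> (P\<^sup>2 / 2 + Q * P + (Q\<^sup>2 / 2 + P * Q)) / (P + Q)"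
    using I J PQ by (intro divide_right_mono add_mono) auto
  also have "\<dots> \<le> 3 / 4 * (P + Q)"
    using PQ zero_le_power2[of "P - Q"] by (simp add: field_simps power2_eq_square)
  also have "P + Q = len (x, y)" by (simp add: len_eq[OF x y] P_def Q_def)
  finally show ?thesis .
qed

end

end

section \<open>The limit law of the hook walks\<close>

lemma convergent_monoseq_prod:
  fixes \<omega> :: "nat \<Rightarrow> real \<times> real"
  assumes "bounded (range \<omega>)" "monoseq (\<lambda>n. fst (\<omega> n))" "monoseq (\<lambda>n. snd (\<omega> n))"
  shows "convergent \<omega>"
proof -
  have "Bseq (\<lambda>n. fst (\<omega> n))" "Bseq (\<lambda>n. snd (\<omega> n))"
    using bounded_fst[OF assms(1)] bounded_snd[OF assms(1)]
    by (simp_all add: Bseq_eq_bounded image_image)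
  then have "convergent (\<lambda>n. fst (\<omega> n))" "convergent (\<lambda>n. snd (\<omega> n))"
    using assms by (auto intro: Bseq_monoseq_convergent)
  then obtain l m where "(\<lambda>n. fst (\<omega> n)) \<longlonglongrightarrow> l" "(\<lambda>n. snd (\<omega> n)) \<longlonglongrightarrow> m"
    by (auto simp: convergent_def)
  then have "(\<lambda>n. (fst (\<omega> n), snd (\<omega> n))) \<longlonglongrightarrow> (l, m)" by (rule tendsto_Pair)
  then show ?thesis by (auto simp: convergent_def)
qed

text \<open>What both walks have in common. \<open>N1\<close> and \<open>N2\<close> describe a hook
  by its traces on the two lines through the corner, as segments ending on the graph, whichever side
  the corner lies on. \<open>R\<close> holds the monotonicity of the steps from which
  \<open>conv\<close> is to be proved.\<close>

locale hook_walk = smooth_diagram a b f f' S c C M + markov_chain \<mu> "\<lambda>p. uniform_on_hook p (N p)"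
  for a b :: real and f f' S c C M \<mu> and N :: "real \<times> real \<Rightarrow> (real \<times> real) set" +
  fixes D :: "(real \<times> real) set" and R :: "((real \<times> real) \<times> real \<times> real) set"
  assumes D: "D \<subseteq> {a..b} \<times> {0..f b}" "closed D" "AE p in \<mu>. p \<in> D"
    and R: "closed R"
    and N: "\<And>p. p \<in> D \<Longrightarrow> N p \<in> sets borel" "\<And>p. p \<in> D \<Longrightarrow> p \<in> N p"
      "\<And>p q. p \<in> D \<Longrightarrow> q \<in> N p \<Longrightarrow> q \<in> D \<and> (p, q) \<in> R"
    and N1: "\<And>x y. (x, y) \<in> D \<Longrightarrow> {x'. (x', y) \<in> N (x, y)} = closed_segment x (g y)"
    and N2: "\<And>x y. (x, y) \<in> D \<Longrightarrow> {y'. (x, y') \<in> N (x, y)} = closed_segment y (f x)"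
    and conv: "\<And>\<omega>. (\<And>n. \<omega> n \<in> D) \<Longrightarrow> (\<And>n. (\<omega> n, \<omega> (Suc n)) \<in> R) \<Longrightarrow> convergent \<omega>"
begin

sublocale convergent_chain \<mu> "\<lambda>p. uniform_on_hook p (N p)" D
proof unfold_locales
  show "AE \<omega> in P. (\<forall>n. \<omega> n \<in> D) \<and> \<omega> \<longlonglongrightarrow> lim \<omega> \<and> lim \<omega> \<in> D"
  proof (rule AE_limit[OF D(2,3)])
    show "R \<in> sets (borel \<Otimes>\<^sub>M borel)"
      unfolding borel_prod using R by simp
    show "AE q in uniform_on_hook p (N p). q \<in> D \<and> (p, q) \<in> R" if "p \<in> D" for p
      using AE_uniform_on_hook[OF N(1,2)[OF that]] by eventually_elim (use N(3) that in blast)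
  qed (rule conv)
qed

abbreviation transition_law :: "real measure" where
  "transition_law \<equiv> distr P borel (\<lambda>\<omega>. fst (lim \<omega>))"

lemma fst_lim_measurable [measurable]: "(\<lambda>\<omega>. fst (lim \<omega>)) \<in> P \<rightarrow>\<^sub>M borel"
  by (rule measurable_compose[OF measurable_lim]) (intro borel_measurable_continuous_onI continuous_intros)

lemma prob_space_transition_law: "prob_space transition_law"
  by (rule P.prob_space_distr) measurable

lemma AE_transition_law: "AE x in transition_law. x \<in> {a..b}"
proof (subst AE_distr_iff)
  show "AE \<omega> in P. fst (lim \<omega>) \<in> {a..b}"
    using stays by eventually_elim (use D(1) in auto)
qed measurable

lemma in_rectangle: "p \<in> D \<Longrightarrow> a \<le> fst p" "p \<in> D \<Longrightarrow> fst p \<le> b" "p \<in> D \<Longrightarrow> 0 \<le> snd p" "p \<in> D \<Longrightarrow> snd p \<le> f b"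
  using D(1) by auto

text \<open>The contraction forces the hook at the limit point to have length zero, and inside the
  rectangle only points of the graph have such a hook.\<close>

lemma AE_lim_on_graph: "AE \<omega> in P. snd (lim \<omega>) = f (fst (lim \<omega>))"
proof -
  have "AE \<omega> in P. len (lim \<omega>) = 0"
  proof (rule AE_lim_contraction[OF continuous_len len_bounds(1,2), where \<rho>="3/4"])
    fix p assume p: "p \<in> D"
    show "(\<integral>q. len q \<partial>uniform_on_hook p (N p)) \<le> 3 / 4 * len p"
      using integral_hook_len[OF in_rectangle[OF p], of "N p"] N(1)[OF p] N1[of "fst p" "snd p"] N2[of "fst p" "snd p"] p
      by simp
  qed auto
  then show ?thesis
    using stays
  proof eventually_elim
    case (elim \<omega>)
    then show ?case using in_rectangle[of "lim \<omega>"] by (intro len_0D) auto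
  qed
qed

text \<open>At a point of the graph \<open>g (snd p) = fst p\<close>, so the exponent in
  \<open>H\<close> is zero and the kernel alone is left. Harmonicity then moves the mean from the
  limit point back to the start, for \<open>Re\<close> and \<open>Im\<close> separately.\<close>

lemma cauchy_transform:
  assumes z: "Im z \<noteq> 0"
  shows "(\<integral>x. cauchy_kernel z x \<partial>transition_law) = (\<integral>p. H z p \<partial>\<mu>)"
proof -
  interpret \<mu>: prob_space \<mu> by (rule prob_init)
  interpret \<nu>: prob_space transition_law by (rule prob_space_transition_law)
  have [measurable]: "cauchy_kernel z \<in> borel_measurable borel" "H z \<in> borel_measurable borel"
    by (intro borel_measurable_continuous_onI continuous_cauchy_kernel continuous_H z continuous_on_id)+
  have [measurable]: "H z \<in> borel_measurable \<mu>"
    by (subst measurable_cong_sets[OF sets_init refl]) measurable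
  obtain B where B: "\<And>p. norm (H z p) \<le> B" using H_bounded[OF z] by blast
  have iH: "integrable \<mu> (H z)"
    by (rule \<mu>.integrable_const_bound[where B=B]) (use B in auto)
  have ik: "integrable transition_law (cauchy_kernel z)"
    by (rule \<nu>.integrable_const_bound[where B="1 / \<bar>Im z\<bar>"]) (use norm_cauchy_kernel_le[OF z] in auto)
  have eq: "\<phi> (\<integral>x. cauchy_kernel z x \<partial>transition_law) = \<phi> (\<integral>p. H z p \<partial>\<mu>)"
    if \<phi>: "bounded_linear \<phi>" for \<phi> :: "complex \<Rightarrow> real"
  proof -
    interpret \<phi>: bounded_linear \<phi> by (rule \<phi>)
    obtain K where K: "\<And>v. \<bar>\<phi> v\<bar> \<le> norm v * K" "0 < K" using \<phi>.pos_bounded by auto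
    have bnd: "\<bar>\<phi> (H z p)\<bar> \<le> B * K" for p
      using K B[of p] by (meson mult_right_mono less_imp_le order_trans)
    have cont: "continuous_on UNIV (\<lambda>p. \<phi> (H z p))"
      using continuous_on_compose2[OF \<phi>.continuous_on[OF continuous_on_id] continuous_H[OF z], of UNIV] by simp
    have [measurable]: "\<phi> \<in> borel_measurable borel"
      by (intro borel_measurable_continuous_onI \<phi>.continuous_on continuous_on_id)
    have "\<phi> (\<integral>x. cauchy_kernel z x \<partial>transition_law) = (\<integral>x. \<phi> (cauchy_kernel z x) \<partial>transition_law)"
      by (rule integral_bounded_linear[OF \<phi> ik, symmetric])
    also have "\<dots> = (\<integral>\<omega>. \<phi> (cauchy_kernel z (fst (lim \<omega>))) \<partial>P)"
      by (rule integral_distr) measurable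
    also have "\<dots> = (\<integral>\<omega>. \<phi> (H z (lim \<omega>)) \<partial>P)"
    proof (rule integral_cong_AE)
      show "(\<lambda>\<omega>. \<phi> (cauchy_kernel z (fst (lim \<omega>)))) \<in> borel_measurable P"
        by measurable
      show "(\<lambda>\<omega>. \<phi> (H z (lim \<omega>))) \<in> borel_measurable P"
        by measurable
      show "AE \<omega> in P. \<phi> (cauchy_kernel z (fst (lim \<omega>))) = \<phi> (H z (lim \<omega>))"
        using AE_lim_on_graph stays
      proof eventually_elim
        case (elim \<omega>)
        then have "g (snd (lim \<omega>)) = fst (lim \<omega>)" using in_rectangle[of "lim \<omega>"] by simp
        then show ?case by (simp add: H_def)
      qed
    qed
    also have "\<dots> = (\<integral>p. \<phi> (H z p) \<partial>\<mu>)"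
    proof (rule expectation_lim_invariant[OF cont bnd])
      fix p assume p: "p \<in> D"
      show "(\<integral>q. \<phi> (H z q) \<partial>uniform_on_hook p (N p)) = \<phi> (H z p)"
        using integral_hook_H[OF in_rectangle[OF p], of "N p" z \<phi>] N(1)[OF p]
          N1[of "fst p" "snd p"] N2[of "fst p" "snd p"] p z \<phi>
        by simp
    qed
    also have "\<dots> = \<phi> (\<integral>p. H z p \<partial>\<mu>)"
      by (rule integral_bounded_linear[OF \<phi> iH])
    finally show ?thesis .
  qed
  show ?thesis
    by (rule complex_eqI) (rule eq bounded_linear_Re bounded_linear_Im)+
qed

end

section \<open>The two walks as instances, and their Cauchy transforms\<close>

context smooth_diagram
begin

lemma compact_diagram: "compact (diagram_domain a b f)" "compact (dual_domain a b f)"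
  using compact_domains continuous_on_subset[OF cont] by auto

text \<open>The relation says that a step moves right or down. In a compact domain this makes both
  coordinates of a path bounded monotone sequences, hence convergent. The horizontal arm ends at
  \<open>g y\<close> because \<open>f x' \<le> y\<close> means \<open>x' \<le> g y\<close>.\<close>

lemma exterior_hook_walk:
  "hook_walk a b f f' S c C M (return borel (a, f b)) (exterior_hook a b f) (dual_domain a b f)
    {r. fst (fst r) \<le> fst (snd r) \<and> snd (snd r) \<le> snd (fst r)}"
proof -
  have D: "dual_domain a b f \<subseteq> {a..b} \<times> {0..f b}"
    using f_bounds by (force simp: dual_domain_def intro: order_trans[OF f_bounds(1)])
  have cD: "closed (dual_domain a b f)"
    by (rule compact_imp_closed[OF compact_diagram(2)])
  interpret markov_chain "return borel (a, f b)" "\<lambda>p. uniform_on_hook p (exterior_hook a b f p)"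
  proof (rule markov_chain.intro)
    show "prob_space (return borel (a, f b))" by (rule prob_space_return) simp
  qed (simp, (rule exterior_kernel, rule continuous_on_subset[OF cont], simp)+)
  show ?thesis
  proof unfold_locales
    show "dual_domain a b f \<subseteq> {a..b} \<times> {0..f b}" "closed (dual_domain a b f)" by fact+
    have "dual_domain a b f \<in> sets borel" using cD by simp
    moreover have "(a, f b) \<in> dual_domain a b f"
      using ab by (simp add: dual_domain_def)
    ultimately show "AE p in return borel (a, f b). p \<in> dual_domain a b f"
      by (subst AE_return) simp_all
    show "closed {r :: (real \<times> real) \<times> real \<times> real. fst (fst r) \<le> fst (snd r) \<and> snd (snd r) \<le> snd (fst r)}"
      by (intro closed_Collect_conj closed_Collect_le continuous_intros)
    fix p assume p: "p \<in> dual_domain a b f"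
    have "exterior_hook a b f p = dual_domain a b f \<inter>
        ({q. fst q = fst p \<and> snd q \<le> snd p} \<union> {q. fst p \<le> fst q \<and> snd q = snd p})"
      by (auto simp: exterior_hook_def case_prod_beta)
    also have "closed \<dots>"
      by (intro closed_Int closed_Un cD closed_Collect_conj closed_Collect_le closed_Collect_eq continuous_intros)
    finally show "exterior_hook a b f p \<in> sets borel" by simp
    show "p \<in> exterior_hook a b f p"
      using p by (auto simp: exterior_hook_def)
    show "q \<in> dual_domain a b f \<and> (p, q) \<in> {r. fst (fst r) \<le> fst (snd r) \<and> snd (snd r) \<le> snd (fst r)}"
      if "q \<in> exterior_hook a b f p" for q
      using that by (auto simp: exterior_hook_def)
  next
    fix x y assume xy: "(x, y) \<in> dual_domain a b f"
    with D have x: "a \<le> x" "x \<le> b" and y: "0 \<le> y" "y \<le> f b" by auto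
    have "x \<le> g y" "f x \<le> y" using xy f_le_iff_g[OF x y] by (auto simp: dual_domain_def)
    then have seg: "closed_segment x (g y) = {x..g y}" "closed_segment y (f x) = {f x..y}"
      by (simp_all add: closed_segment_eq_real_ivl1 closed_segment_commute[of y])
    have "(x', y) \<in> exterior_hook a b f (x, y) \<longleftrightarrow> x \<le> x' \<and> x' \<le> g y" for x'
      using x y \<open>x \<le> g y\<close> f_le_iff_g[of x' y] order_trans[OF _ g_in(2), of x' y]
      by (auto simp: exterior_hook_def dual_domain_def)
    then show "{x'. (x', y) \<in> exterior_hook a b f (x, y)} = closed_segment x (g y)"
      unfolding seg by (simp add: set_eq_iff)
    have "(x, y') \<in> exterior_hook a b f (x, y) \<longleftrightarrow> f x \<le> y' \<and> y' \<le> y" for y'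
      unfolding exterior_hook_def dual_domain_def using x y(2) \<open>f x \<le> y\<close> by auto
    then show "{y'. (x, y') \<in> exterior_hook a b f (x, y)} = closed_segment y (f x)"
      unfolding seg by (simp add: set_eq_iff)
  next
    fix \<omega> :: "nat \<Rightarrow> real \<times> real"
    assume *: "\<And>n. \<omega> n \<in> dual_domain a b f"
      "\<And>n. (\<omega> n, \<omega> (Suc n)) \<in> {r. fst (fst r) \<le> fst (snd r) \<and> snd (snd r) \<le> snd (fst r)}"
    show "convergent \<omega>"
    proof (rule convergent_monoseq_prod)
      show "bounded (range \<omega>)"
        by (rule bounded_subset[OF compact_imp_bounded[OF compact_diagram(2)]]) (use *(1) in auto)
    qed (use *(2) in \<open>auto simp: monoseq_Suc\<close>)
  qed
qed

definition area :: real where "area = (LBINT x:{a..b}. f x)"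

lemma f_set_integrable: "set_integrable lborel {a..b} f"
  by (intro borel_integrable_atLeastAtMost' continuous_on_subset[OF cont]) auto

lemma area_pos: "0 < area"
proof -
  have "(LBINT x:{a..b}. c * (x - a)) \<le> area"
    unfolding area_def
  proof (rule set_integral_mono[OF _ f_set_integrable])
    show "set_integrable lborel {a..b} (\<lambda>x. c * (x - a))"
      by (intro borel_integrable_atLeastAtMost' continuous_intros)
    show "c * (x - a) \<le> f x" if "x \<in> {a..b}" for x
      using f_diff(1)[of a x] that by simp
  qed
  moreover have "(LBINT x:{a..b}. c * (x - a)) = c * (b - a)\<^sup>2 / 2"
  proof -
    have "(LBINT x:{a..b}. \<bar>x - a\<bar> + 0) = (b - a)\<^sup>2 / 2"
      using LBINT_distance_to_end[of b a 0] ab by (simp add: closed_segment_eq_real_ivl power2_commute)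
    moreover have "(LBINT x:{a..b}. \<bar>x - a\<bar> + 0) = (LBINT x:{a..b}. (x - a))"
      by (rule set_lebesgue_integral_cong) auto
    ultimately show ?thesis by simp
  qed
  ultimately show ?thesis
    using c ab by (smt (verit) divide_pos_pos mult_pos_pos zero_less_power)
qed

lemma emeasure_diagram: "emeasure lborel (diagram_domain a b f) = ennreal area"
proof -
  have D: "diagram_domain a b f \<in> sets (lborel \<Otimes>\<^sub>M lborel)"
    unfolding lborel_prod using compact_imp_closed[OF compact_diagram(1)] by simp
  have "emeasure lborel (diagram_domain a b f) =
      (\<integral>\<^sup>+x. emeasure lborel (Pair x -` diagram_domain a b f) \<partial>lborel)"
    unfolding lborel_prod[symmetric] by (rule lborel.emeasure_pair_measure_alt[OF D])
  also have "\<dots> = (\<integral>\<^sup>+x. ennreal (indicator {a..b} x *\<^sub>R f x) \<partial>lborel)"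
  proof (rule nn_integral_cong)
    fix x
    have "Pair x -` diagram_domain a b f = (if x \<in> {a..b} then {0..f x} else {})"
      by (auto simp: diagram_domain_def)
    then show "emeasure lborel (Pair x -` diagram_domain a b f) = ennreal (indicator {a..b} x *\<^sub>R f x)"
      by simp
  qed
  also have "\<dots> = ennreal area"
    unfolding area_def set_lebesgue_integral_def
    by (rule nn_integral_eq_integral) (use f_set_integrable in \<open>auto simp: set_integrable_def\<close>)
  finally show ?thesis .
qed

lemma interior_hook_walk:
  "hook_walk a b f f' S c C M (uniform_measure lborel (diagram_domain a b f)) (interior_hook a b f)
    (diagram_domain a b f) {r. fst (snd r) \<le> fst (fst r) \<and> snd (fst r) \<le> snd (snd r)}"
proof -
  have D: "diagram_domain a b f \<subseteq> {a..b} \<times> {0..f b}"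
    by (auto simp: diagram_domain_def intro: order_trans[OF _ f_bounds(2)])
  have cD: "closed (diagram_domain a b f)"
    by (rule compact_imp_closed[OF compact_diagram(1)])
  interpret markov_chain "uniform_measure lborel (diagram_domain a b f)" "\<lambda>p. uniform_on_hook p (interior_hook a b f p)"
  proof (rule markov_chain.intro)
    show "prob_space (uniform_measure lborel (diagram_domain a b f))"
      by (rule prob_space_uniform_measure) (use emeasure_diagram area_pos in auto)
  qed (simp, (rule interior_kernel, rule continuous_on_subset[OF cont], simp)+)
  show ?thesis
  proof unfold_locales
    show "diagram_domain a b f \<subseteq> {a..b} \<times> {0..f b}" "closed (diagram_domain a b f)" by fact+
    then show "AE p in uniform_measure lborel (diagram_domain a b f). p \<in> diagram_domain a b f"
      by (intro AE_uniform_measureI) auto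
    show "closed {r :: (real \<times> real) \<times> real \<times> real. fst (snd r) \<le> fst (fst r) \<and> snd (fst r) \<le> snd (snd r)}"
      by (intro closed_Collect_conj closed_Collect_le continuous_intros)
    fix p assume p: "p \<in> diagram_domain a b f"
    have "interior_hook a b f p = diagram_domain a b f \<inter>
        ({q. fst q \<le> fst p \<and> snd q = snd p} \<union> {q. fst q = fst p \<and> snd p \<le> snd q})"
      by (auto simp: interior_hook_def case_prod_beta)
    also have "closed \<dots>"
      by (intro closed_Int closed_Un cD closed_Collect_conj closed_Collect_le closed_Collect_eq continuous_intros)
    finally show "interior_hook a b f p \<in> sets borel" by simp
    show "p \<in> interior_hook a b f p"
      using p by (auto simp: interior_hook_def)
    show "q \<in> diagram_domain a b f \<and> (p, q) \<in> {r. fst (snd r) \<le> fst (fst r) \<and> snd (fst r) \<le> snd (snd r)}"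
      if "q \<in> interior_hook a b f p" for q
      using that by (auto simp: interior_hook_def)
  next
    fix x y assume xy: "(x, y) \<in> diagram_domain a b f"
    with D have x: "a \<le> x" "x \<le> b" and y: "0 \<le> y" "y \<le> f b" by auto
    have "g y \<le> x" "y \<le> f x" using xy g_le_iff_f[OF x y] by (auto simp: diagram_domain_def)
    then have seg: "closed_segment x (g y) = {g y..x}" "closed_segment y (f x) = {y..f x}"
      by (simp_all add: closed_segment_eq_real_ivl1 closed_segment_commute[of x])
    have "(x', y) \<in> interior_hook a b f (x, y) \<longleftrightarrow> g y \<le> x' \<and> x' \<le> x" for x'
      using x y \<open>g y \<le> x\<close> g_le_iff_f[of x' y] order_trans[OF g_in(1), of y x']
      by (auto simp: interior_hook_def diagram_domain_def)
    then show "{x'. (x', y) \<in> interior_hook a b f (x, y)} = closed_segment x (g y)"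
      unfolding seg by (simp add: set_eq_iff)
    have "(x, y') \<in> interior_hook a b f (x, y) \<longleftrightarrow> y \<le> y' \<and> y' \<le> f x" for y'
      unfolding interior_hook_def diagram_domain_def using x y(1) \<open>y \<le> f x\<close> by auto
    then show "{y'. (x, y') \<in> interior_hook a b f (x, y)} = closed_segment y (f x)"
      unfolding seg by (simp add: set_eq_iff)
  next
    fix \<omega> :: "nat \<Rightarrow> real \<times> real"
    assume *: "\<And>n. \<omega> n \<in> diagram_domain a b f"
      "\<And>n. (\<omega> n, \<omega> (Suc n)) \<in> {r. fst (snd r) \<le> fst (fst r) \<and> snd (fst r) \<le> snd (snd r)}"
    show "convergent \<omega>"
    proof (rule convergent_monoseq_prod)
      show "bounded (range \<omega>)"
        by (rule bounded_subset[OF compact_imp_bounded[OF compact_diagram(1)]]) (use *(1) in auto)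
    qed (use *(2) in \<open>auto simp: monoseq_Suc\<close>)
  qed
qed

lemma exterior_transition:
  shows "prob_space (exterior_transition_measure a b f)"
    and "AE x in exterior_transition_measure a b f. x \<in> {a..b}"
    and "Im z \<noteq> 0 \<Longrightarrow> (\<integral>x. cauchy_kernel z x \<partial>exterior_transition_measure a b f) = exp (A z b) / (z - of_real a)"
proof -
  interpret hook_walk a b f f' S c C M "return borel (a, f b)" "exterior_hook a b f" "dual_domain a b f"
    "{r. fst (fst r) \<le> fst (snd r) \<and> snd (snd r) \<le> snd (fst r)}"
    by (rule exterior_hook_walk)
  have eq: "transition_law = exterior_transition_measure a b f"
    by (simp add: exterior_transition_measure_def exterior_hook_walk_def)
  show "prob_space (exterior_transition_measure a b f)"
    "AE x in exterior_transition_measure a b f. x \<in> {a..b}"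
    using prob_space_transition_law AE_transition_law unfolding eq by auto
  assume z: "Im z \<noteq> 0"
  have "(\<integral>x. cauchy_kernel z x \<partial>exterior_transition_measure a b f) = H z (a, f b)"
    using cauchy_transform[OF z] borel_measurable_continuous_onI[OF continuous_H[OF z]]
    unfolding eq by (simp add: integral_return)
  then show "(\<integral>x. cauchy_kernel z x \<partial>exterior_transition_measure a b f) = exp (A z b) / (z - of_real a)"
    using ab by (simp add: H_def cauchy_kernel_def)
qed

text \<open>By Fubini the inner integral runs over a full vertical line from height
  \<open>f a = 0\<close> to the graph and is exact by \<open>integral_vertical\<close>. Its upper
  end contributes the constant \<open>-1\<close>, its lower end a multiple of
  \<open>cauchy_kernel z x * exp (- A z x)\<close>, which \<open>integral_horizontal\<close>
  integrates in turn.\<close>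

lemma interior_start:
  assumes z: "Im z \<noteq> 0"
  shows "(\<integral>p. H z p \<partial>uniform_measure lborel (diagram_domain a b f)) =
    (z - of_real b - (z - of_real a) * exp (- A z b)) / of_real area"
proof -
  let ?D = "diagram_domain a b f"
  have D [measurable]: "?D \<in> sets borel"
    using compact_imp_closed[OF compact_diagram(1)] by simp
  have [measurable]: "H z \<in> borel_measurable borel"
    by (intro borel_measurable_continuous_onI continuous_H z)
  obtain B where B: "\<And>p. norm (H z p) \<le> B" using H_bounded[OF z] by blast
  have "1 / ennreal area = ennreal (1 / area)"
    using divide_ennreal[of 1 area] area_pos by simp
  then have "(\<lambda>p. indicator ?D p / ennreal area) = (\<lambda>p. ennreal (indicator ?D p / area))"
    by (auto simp: fun_eq_iff indicator_def)
  then have "uniform_measure lborel ?D = density lborel (\<lambda>p. ennreal (indicator ?D p / area))"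
    by (simp only: uniform_measure_def emeasure_diagram)
  then have "(\<integral>p. H z p \<partial>uniform_measure lborel ?D) = (\<integral>p. (indicator ?D p / area) *\<^sub>R H z p \<partial>lborel)"
    using area_pos by (simp only:, subst integral_density) auto
  also have "\<dots> = (1 / area) *\<^sub>R (\<integral>p. indicator ?D p *\<^sub>R H z p \<partial>lborel)"
    by (subst integral_scaleR_right[symmetric]) (auto intro!: Bochner_Integration.integral_cong)
  also have "(\<integral>p. indicator ?D p *\<^sub>R H z p \<partial>lborel) =
      (\<integral>x. \<integral>y. indicator ?D (x, y) *\<^sub>R H z (x, y) \<partial>lborel \<partial>lborel)"
  proof -
    have "integrable lborel (\<lambda>p. indicator ?D p *\<^sub>R H z p)"
      by (rule integrableI_bounded_set[where A="?D" and B=B])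
         (use B emeasure_diagram order_trans[OF norm_ge_zero B] in \<open>auto split: split_indicator\<close>)
    then show ?thesis
      unfolding lborel_prod[symmetric] by (rule lborel_pair.integral_fst'[symmetric])
  qed
  also have "\<dots> = (LBINT x:{a..b}. -1 + (z - of_real a) * (cauchy_kernel z x * exp (- A z x)))"
    unfolding set_lebesgue_integral_def
  proof (rule Bochner_Integration.integral_cong[OF refl])
    fix x
    show "(\<integral>y. indicator ?D (x, y) *\<^sub>R H z (x, y) \<partial>lborel) =
        indicator {a..b} x *\<^sub>R (-1 + (z - of_real a) * (cauchy_kernel z x * exp (- A z x)))"
    proof (cases "x \<in> {a..b}")
      case False
      then have "indicator ?D (x, y) = (0 :: real)" for y
        by (auto simp: diagram_domain_def indicator_def)
      with False show ?thesis by simp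
    next
      case True
      have "H z (x, t) = cauchy_kernel z x * exp (- A z x) * exp (A z (g t))" for t
        by (simp add: H_def exp_diff exp_minus divide_inverse mult_ac)
      then have "((\<lambda>y. H z (x, y)) has_integral cauchy_kernel z x * exp (- A z x) *
          ((of_real (s x) - z) * exp (A z x) - (of_real (s a) - z) * exp (A z a))) {f a..f x}"
        using has_integral_mult_right[OF integral_vertical[OF z], of a x "cauchy_kernel z x * exp (- A z x)"] True by simp
      also have "cauchy_kernel z x * exp (- A z x) * ((of_real (s x) - z) * exp (A z x) - (of_real (s a) - z) * exp (A z a)) =
          - ((cauchy_kernel z x * (z - of_real (s x))) * (exp (- A z x) * exp (A z x))) +
          (z - of_real a) * (cauchy_kernel z x * exp (- A z x))"
        by (simp add: algebra_simps)
      also have "\<dots> = -1 + (z - of_real a) * (cauchy_kernel z x * exp (- A z x))"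
        by (simp add: z flip: exp_add)
      finally have I: "((\<lambda>y. H z (x, y)) has_integral -1 + (z - of_real a) * (cauchy_kernel z x * exp (- A z x))) {0..f x}"
        by simp
      have "continuous_on {0..f x} (\<lambda>y. H z (x, y))"
        by (rule continuous_on_compose2[OF continuous_H[OF z]]) (auto intro!: continuous_intros)
      then have "set_integrable lborel {0..f x} (\<lambda>y. H z (x, y))"
        by (rule borel_integrable_atLeastAtMost')
      then have "(LBINT y:{0..f x}. H z (x, y)) = -1 + (z - of_real a) * (cauchy_kernel z x * exp (- A z x))"
        using I by (simp add: set_borel_integral_eq_integral integral_unique)
      moreover have "indicator ?D (x, y) = (indicator {0..f x} y :: real)" for y
        using True by (auto simp: diagram_domain_def indicator_def)
      ultimately show ?thesis using True by (simp add: set_lebesgue_integral_def)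
    qed
  qed
  also have "\<dots> = - of_real (b - a) + (z - of_real a) * (1 - exp (- A z b))"
  proof -
    have 1: "((\<lambda>x. - 1 :: complex) has_integral - of_real (b - a)) {a..b}"
      using has_integral_const_real[of "- 1 :: complex" a b] ab by (simp add: scaleR_conv_of_real)
    have "((\<lambda>x. -1 + (z - of_real a) * (cauchy_kernel z x * exp (- A z x))) has_integral
        - of_real (b - a) + (z - of_real a) * (exp (- A z a) - exp (- A z b))) {a..b}"
      using ab by (intro has_integral_add 1 has_integral_mult_right integral_horizontal z) auto
    moreover have "set_integrable lborel {a..b} (\<lambda>x. -1 + (z - of_real a) * (cauchy_kernel z x * exp (- A z x)))"
      by (intro borel_integrable_atLeastAtMost' continuous_intros continuous_cauchy_kernel continuous_A z)
    ultimately show ?thesis by (simp add: set_borel_integral_eq_integral integral_unique)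
  qed
  also have "\<dots> = z - of_real b - (z - of_real a) * exp (- A z b)"
    by (simp add: algebra_simps)
  finally show ?thesis by (simp add: scaleR_conv_of_real)
qed

lemma interior_transition:
  shows "prob_space (interior_transition_measure a b f)"
    and "AE x in interior_transition_measure a b f. x \<in> {a..b}"
    and "Im z \<noteq> 0 \<Longrightarrow> (\<integral>x. cauchy_kernel z x \<partial>interior_transition_measure a b f) =
      (z - of_real b - (z - of_real a) * exp (- A z b)) / of_real area"
proof -
  interpret hook_walk a b f f' S c C M "uniform_measure lborel (diagram_domain a b f)"
    "interior_hook a b f" "diagram_domain a b f" "{r. fst (snd r) \<le> fst (fst r) \<and> snd (fst r) \<le> snd (snd r)}"
    by (rule interior_hook_walk)
  have eq: "transition_law = interior_transition_measure a b f"
    by (simp add: interior_transition_measure_def interior_hook_walk_def)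
  show "prob_space (interior_transition_measure a b f)"
    "AE x in interior_transition_measure a b f. x \<in> {a..b}"
    using prob_space_transition_law AE_transition_law unfolding eq by auto
  show "(\<integral>x. cauchy_kernel z x \<partial>interior_transition_measure a b f) =
      (z - of_real b - (z - of_real a) * exp (- A z b)) / of_real area" if "Im z \<noteq> 0"
    using cauchy_transform[OF that] interior_start[OF that] unfolding eq by simp
qed

end

section \<open>Boundary values of the Cauchy transforms\<close>

context smooth_diagram
begin

abbreviation "U \<equiv> {a<..<b} - S"

lemma open_U: "open U"
  using fin by (intro open_Diff finite_imp_closed) auto

lemma f'_diff_le: "\<bar>f' u - f' x\<bar> \<le> C"
  using c(1) c(2)[of u] c(2)[of x] C[of u] C[of x] by auto

text \<open>The compact interval keeps a distance \<open>d\<close> from the kinks and the end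
  points. If no such point separates \<open>u\<close> from \<open>x\<close>, the Lipschitz bound
  applies; otherwise \<open>\<bar>u - x\<bar> \<ge> d\<close> and the crude bound
  \<open>C \<le> C / d * \<bar>u - x\<bar>\<close> is enough. The constant is uniform in
  \<open>x\<close>, as the later domination requires.\<close>

lemma difference_quotient_bound:
  assumes sub: "{x1..x2} \<subseteq> U"
  shows "\<exists>K\<ge>0. \<forall>x\<in>{x1..x2}. \<forall>u\<in>{a..b}. \<bar>f' u - f' x\<bar> \<le> K * \<bar>s u - s x\<bar>"
proof -
  obtain d where d: "0 < d" "\<And>x y. x \<in> {x1..x2} \<Longrightarrow> y \<in> - U \<Longrightarrow> d \<le> dist x y"
    using separate_compact_closed[OF compact_Icc closed_Compl[OF open_U]] sub by blast
  have C0: "0 \<le> C" using f'_diff_le[of a a] by simp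
  show ?thesis
  proof (intro exI conjI ballI)
    show "0 \<le> \<bar>M\<bar> + C / d" using C0 d(1) by simp
    fix x u assume x: "x \<in> {x1..x2}" and u: "u \<in> {a..b}"
    have xab: "x \<in> {a..b}" using x sub by auto
    have "\<bar>f' u - f' x\<bar> \<le> (\<bar>M\<bar> + C / d) * \<bar>u - x\<bar>"
    proof (cases "closed_segment u x \<subseteq> U")
      case True
      have "\<bar>f' u - f' x\<bar> \<le> M * \<bar>u - x\<bar>" by (rule lip[OF True])
      also have "\<dots> \<le> (\<bar>M\<bar> + C / d) * \<bar>u - x\<bar>"
        using C0 d(1) by (intro mult_right_mono) (simp_all add: add_increasing2)
      finally show ?thesis .
    next
      case False
      then obtain y where y: "y \<in> closed_segment u x" "y \<in> - U" by blast
      have "d \<le> dist x y" using d(2)[OF x y(2)] .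
      also have "\<dots> \<le> \<bar>u - x\<bar>"
        using y(1) by (auto simp: closed_segment_eq_real_ivl dist_real_def split: if_splits)
      finally have "d \<le> \<bar>u - x\<bar>" .
      then have "C \<le> C / d * \<bar>u - x\<bar>"
        using d(1) C0 by (simp add: field_simps mult_left_mono)
      also have "\<dots> \<le> (\<bar>M\<bar> + C / d) * \<bar>u - x\<bar>"
        by (intro mult_right_mono) simp_all
      finally show ?thesis using f'_diff_le[of u x] by linarith
    qed
    also have "\<dots> \<le> (\<bar>M\<bar> + C / d) * \<bar>s u - s x\<bar>"
      using s_diff_abs[OF xab u] C0 d(1) by (intro mult_left_mono) auto
    finally show "\<bar>f' u - f' x\<bar> \<le> (\<bar>M\<bar> + C / d) * \<bar>s u - s x\<bar>" .
  qed
qed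

lemma integrable_indicator_Icc: "integrable lborel (indicat_real {a..b})"
  using ab by (intro integrable_real_indicator) simp_all

text \<open>The numerator vanishes at \<open>u = x\<close> and so compensates for the singularity
  that the kernel acquires when \<open>z\<close> reaches \<open>s x\<close>.\<close>

definition remainder :: "complex \<Rightarrow> real \<Rightarrow> complex" where
  "remainder z x = (LBINT u:{a..b}. of_real (f' u - f' x) * cauchy_kernel z u)"

lemma A_eq:
  assumes z: "0 < Im z"
  shows "of_real (1 + f' x) * A z b = Ln (z - of_real a) - Ln (z - of_real (s b)) - remainder z x"
proof -
  have z': "Im z \<noteq> 0" using z by simp
  have [measurable]: "cauchy_kernel z \<in> borel_measurable borel"
    by (intro borel_measurable_continuous_onI continuous_cauchy_kernel z' continuous_on_id)
  have "set_integrable lborel {a..b} (\<lambda>u. of_real (f' u - f' x) * cauchy_kernel z u)"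
    unfolding set_integrable_def
  proof (rule integrableI_bounded_set[where A="{a..b}" and B="C * (1 / \<bar>Im z\<bar>)"])
    have "norm (complex_of_real (f' u - f' x) * cauchy_kernel z u) \<le> C * (1 / \<bar>Im z\<bar>)" for u
      unfolding norm_mult norm_of_real
      by (intro mult_mono f'_diff_le norm_cauchy_kernel_le z' order_trans[OF abs_ge_zero f'_diff_le]) simp
    then show "AE u in lborel. u \<in> {a..b} \<longrightarrow>
        norm (indicator {a..b} u *\<^sub>R (complex_of_real (f' u - f' x) * cauchy_kernel z u)) \<le> C * (1 / \<bar>Im z\<bar>)"
      by (simp del: of_real_diff)
  qed (use ab in auto)
  moreover have "((\<lambda>u. of_real (1 + f' u) * cauchy_kernel z u - of_real (1 + f' x) * cauchy_kernel z u) has_integral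
      (Ln (z - of_real (s a)) - Ln (z - of_real (s b))) - of_real (1 + f' x) * A z b) {a..b}"
  proof (intro has_integral_diff has_integral_mult_right integral_log z z')
    show "(cauchy_kernel z has_integral A z b) {a..b}"
      unfolding A_def using ab z'
      by (auto intro!: integrable_integral integrable_continuous_real continuous_intros)
  qed (use ab in auto)
  then have "((\<lambda>u. of_real (f' u - f' x) * cauchy_kernel z u) has_integral
      (Ln (z - of_real (s a)) - Ln (z - of_real (s b))) - of_real (1 + f' x) * A z b) {a..b}"
    by (rule has_integral_eq[rotated]) (simp add: algebra_simps)
  ultimately have "remainder z x = (Ln (z - of_real (s a)) - Ln (z - of_real (s b))) - of_real (1 + f' x) * A z b"
    unfolding remainder_def by (simp add: set_borel_integral_eq_integral integral_unique)
  then show ?thesis by simp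
qed

definition approach :: "real \<Rightarrow> real \<Rightarrow> complex" where "approach x e = Complex (s x) e"

lemma approach_simps [simp]: "Re (approach x e) = s x" "Im (approach x e) = e"
  by (simp_all add: approach_def)

lemma norm_approach_ge: "\<bar>s x - s u\<bar> \<le> norm (approach x e - of_real (s u))" "\<bar>e\<bar> \<le> norm (approach x e - of_real (s u))"
  using abs_Re_le_cmod[of "approach x e - of_real (s u)"] abs_Im_le_cmod[of "approach x e - of_real (s u)"] by auto

lemma norm_remainder_integrand:
  assumes K: "0 \<le> K" "\<bar>f' u - f' x\<bar> \<le> K * \<bar>s u - s x\<bar>" and e: "0 < e"
  shows "norm (of_real (f' u - f' x) * cauchy_kernel (approach x e) u) \<le> K"
proof -
  let ?n = "norm (approach x e - of_real (s u))"
  have n: "0 < ?n" using norm_approach_ge(2)[of e x u] e by linarith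
  have "norm (of_real (f' u - f' x) * cauchy_kernel (approach x e) u) = \<bar>f' u - f' x\<bar> / ?n"
    by (simp add: cauchy_kernel_def norm_mult norm_divide del: of_real_diff)
  also have "\<dots> \<le> K * ?n / ?n"
    using K norm_approach_ge(1)[of x u e]
    by (intro divide_right_mono) (auto simp: abs_minus_commute intro: order_trans mult_left_mono)
  finally show ?thesis using n by simp
qed

lemma norm_remainder:
  assumes K: "0 \<le> K" "\<And>u. u \<in> {a..b} \<Longrightarrow> \<bar>f' u - f' x\<bar> \<le> K * \<bar>s u - s x\<bar>" and e: "0 < e"
  shows "norm (remainder (approach x e) x) \<le> K * (b - a)"
proof -
  let ?h = "\<lambda>u. of_real (f' u - f' x) * cauchy_kernel (approach x e) u"
  have "norm (remainder (approach x e) x) \<le> (\<integral>u. norm (indicator {a..b} u *\<^sub>R ?h u) \<partial>lborel)"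
    unfolding remainder_def set_lebesgue_integral_def by (rule integral_norm_bound)
  also have "\<dots> \<le> (\<integral>u. indicator {a..b} u *\<^sub>R K \<partial>lborel)"
  proof (rule integral_mono')
    show "norm (indicator {a..b} u *\<^sub>R ?h u) \<le> indicator {a..b} u *\<^sub>R K" for u
      using norm_remainder_integrand[OF K(1) K(2)[of u] e] by (cases "u \<in> {a..b}") simp_all
  qed (use K in \<open>auto simp: integrable_indicator_Icc\<close>)
  finally show ?thesis using ab by (simp add: mult.commute)
qed

text \<open>The counterpart of \<open>diagram_integral\<close> in the coordinate \<open>s\<close>,
  with \<open>f'\<close> as derivative. At \<open>u = x\<close> the integrand is 0.\<close>

definition diag :: "real \<Rightarrow> real" where
  "diag x = (LBINT u:{a..b}. 1 / (s u - s x) * ((f' u - f' x) / (1 + f' x)))"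

definition eps :: "nat \<Rightarrow> real" where "eps n = inverse (real (Suc n))"

lemma eps: "0 < eps n" "eps n \<le> 1" "eps \<longlonglongrightarrow> 0"
  unfolding eps_def[abs_def] using LIMSEQ_inverse_real_of_nat by (simp_all add: field_simps)

lemma approach_tendsto: "(\<lambda>n. approach x (eps n)) \<longlonglongrightarrow> of_real (s x)"
  unfolding approach_def complex_of_real_def by (intro tendsto_Complex tendsto_const eps)

lemma remainder_tendsto:
  assumes x: "x \<in> U"
  shows "(\<lambda>n. remainder (approach x (eps n)) x) \<longlonglongrightarrow> of_real (- ((1 + f' x) * diag x))"
proof -
  obtain K where K: "0 \<le> K" "\<And>u. u \<in> {a..b} \<Longrightarrow> \<bar>f' u - f' x\<bar> \<le> K * \<bar>s u - s x\<bar>"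
    using difference_quotient_bound[of x x] x by auto
  have xab: "x \<in> {a..b}" using x by auto
  let ?h = "\<lambda>u. complex_of_real (f' u - f' x) * (1 / of_real (s x - s u))"
  have kzm [measurable]: "cauchy_kernel (approach x (eps n)) \<in> borel_measurable borel" for n
    using eps(1)[of n] by (intro borel_measurable_continuous_onI continuous_cauchy_kernel continuous_on_id) auto
  have "(\<lambda>n. remainder (approach x (eps n)) x) \<longlonglongrightarrow> (LBINT u:{a..b}. ?h u)"
    unfolding remainder_def set_lebesgue_integral_def
  proof (rule integral_dominated_convergence[where w="\<lambda>u. indicator {a..b} u *\<^sub>R K"])
    show "AE u in lborel. (\<lambda>n. indicator {a..b} u *\<^sub>R (complex_of_real (f' u - f' x) * cauchy_kernel (approach x (eps n)) u))
        \<longlonglongrightarrow> indicator {a..b} u *\<^sub>R ?h u"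
    proof (rule AE_I2)
      fix u
      show "(\<lambda>n. indicator {a..b} u *\<^sub>R (complex_of_real (f' u - f' x) * cauchy_kernel (approach x (eps n)) u))
        \<longlonglongrightarrow> indicator {a..b} u *\<^sub>R ?h u"
      proof (cases "u \<in> {a..b} \<and> u \<noteq> x")
        case True
        then have ne: "complex_of_real (s x) - complex_of_real (s u) \<noteq> 0"
          using s_diff_abs[of x u] xab by auto
        have "(\<lambda>n. 1 / (approach x (eps n) - of_real (s u))) \<longlonglongrightarrow> 1 / (of_real (s x) - of_real (s u))"
          by (intro tendsto_intros approach_tendsto ne)
        then show ?thesis
          unfolding cauchy_kernel_def by (intro tendsto_scaleR tendsto_mult tendsto_const) simp
      next
        \<comment> \<open>Outside \<open>{a..b}\<close> the indicator is 0, and at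
          \<open>u = x\<close> the factor \<open>f' u - f' x\<close> is 0, so both the sequence and
          its limit vanish there.\<close>
        case False
        then show ?thesis by (cases "u = x") simp_all
      qed
    qed
    show "AE u in lborel. norm (indicator {a..b} u *\<^sub>R (complex_of_real (f' u - f' x) * cauchy_kernel (approach x (eps n)) u))
        \<le> indicator {a..b} u *\<^sub>R K" for n
    proof (rule AE_I2)
      fix u
      show "norm (indicator {a..b} u *\<^sub>R (complex_of_real (f' u - f' x) * cauchy_kernel (approach x (eps n)) u))
        \<le> indicator {a..b} u *\<^sub>R K"
        using norm_remainder_integrand[OF K(1) K(2)[of u] eps(1)[of n]] by (cases "u \<in> {a..b}") simp_all
    qed
  qed (auto simp: integrable_indicator_Icc)
  also have "(LBINT u:{a..b}. ?h u) =
      (LBINT u:{a..b}. complex_of_real (- (1 + f' x) * (1 / (s u - s x) * ((f' u - f' x) / (1 + f' x)))))"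
  proof (rule set_lebesgue_integral_cong, simp, intro allI impI)
    fix u
    \<comment> \<open>The case \<open>s u = s x\<close> has a zero denominator on both sides, where
      division by zero makes both sides 0.\<close>
    have "- (1 + f' x) * (1 / (s u - s x) * ((f' u - f' x) / (1 + f' x))) = (f' u - f' x) * (1 / (s x - s u))"
      using f'_pos(2)[of x] by (cases "s u = s x") (simp_all add: divide_simps, simp add: algebra_simps)
    then show "?h u = complex_of_real (- (1 + f' x) * (1 / (s u - s x) * ((f' u - f' x) / (1 + f' x))))"
      by (simp only: of_real_mult of_real_divide of_real_1)
  qed
  also have "\<dots> = of_real (LBINT u:{a..b}. - (1 + f' x) * (1 / (s u - s x) * ((f' u - f' x) / (1 + f' x))))"
    by (rule set_integral_complex_of_real)
  also have "(LBINT u:{a..b}. - (1 + f' x) * (1 / (s u - s x) * ((f' u - f' x) / (1 + f' x)))) = - ((1 + f' x) * diag x)"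
    unfolding diag_def set_integral_mult_right by (rule minus_mult_left[symmetric])
  finally show ?thesis .
qed

text \<open>When \<open>z\<close> descends to \<open>s x\<close>, the number \<open>z - s b\<close>
  tends to the negative axis, where \<open>Ln\<close> jumps. Passing to \<open>- w\<close> makes the
  logarithm continuous at the limit and splits off \<open>\<i> * pi\<close>, the only source of an
  imaginary part in \<open>A_lim\<close>.\<close>

lemma Ln_upper: "0 < Im w \<Longrightarrow> Ln w = Ln (- w) + \<i> * pi"
  using Ln_minus[of w] by (cases "w = 0") auto

definition A_lim :: "real \<Rightarrow> complex" where
  "A_lim x = (of_real (ln (s x - a) - ln (s b - s x) + (1 + f' x) * diag x) - \<i> * pi) / of_real (1 + f' x)"

lemma s_strict: "x \<in> U \<Longrightarrow> a < s x" "x \<in> U \<Longrightarrow> s x < s b"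
  using s_diff[of a x] s_diff[of x b] by auto

lemma A_tendsto:
  assumes x: "x \<in> U"
  shows "(\<lambda>n. A (approach x (eps n)) b) \<longlonglongrightarrow> A_lim x"
proof -
  let ?z = "\<lambda>n. approach x (eps n)"
  have ne: "of_real (1 + f' x) \<noteq> (0 :: complex)"
    using f'_pos(2)[of x] by (metis of_real_eq_0_iff less_irrefl)
  have eq: "A (?z n) b = (Ln (?z n - of_real a) - (Ln (of_real (s b) - ?z n) + \<i> * pi) - remainder (?z n) x) / of_real (1 + f' x)" for n
    using A_eq[of "?z n" x] eps(1)[of n] ne Ln_upper[of "?z n - of_real (s b)"] by (simp add: nonzero_eq_divide_eq mult.commute)
  have np: "of_real r \<notin> \<real>\<^sub>\<le>\<^sub>0" if "0 < r" for r
    using that by simp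
  have "(\<lambda>n. (Ln (?z n - of_real a) - (Ln (of_real (s b) - ?z n) + \<i> * pi) - remainder (?z n) x) / of_real (1 + f' x))
      \<longlonglongrightarrow> (Ln (of_real (s x) - of_real a) - (Ln (of_real (s b) - of_real (s x)) + \<i> * pi) -
        of_real (- ((1 + f' x) * diag x))) / of_real (1 + f' x)"
    using np[of "s x - a"] np[of "s b - s x"] s_strict[OF x]
    by (intro tendsto_intros approach_tendsto remainder_tendsto x ne) auto
  also have "Ln (of_real (s x) - of_real a) = of_real (ln (s x - a))"
    using Ln_of_real[of "s x - a"] s_strict[OF x] by simp
  also have "Ln (of_real (s b) - of_real (s x)) = of_real (ln (s b - s x))"
    using Ln_of_real[of "s b - s x"] s_strict[OF x] by simp
  finally show ?thesis unfolding eq A_lim_def by (simp add: algebra_simps)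
qed

lemma abs_ln_le:
  fixes p q r :: real
  assumes "0 < p" "p \<le> r" "r \<le> q"
  shows "\<bar>ln r\<bar> \<le> \<bar>ln p\<bar> + \<bar>ln q\<bar>"
  using assms ln_mono[of p r] ln_mono[of r q] by linarith

text \<open>Horizontally the points are at most \<open>s b - a\<close> apart; the summand 1 accounts
  for the height.\<close>

lemma norm_approach_le:
  assumes "\<bar>e\<bar> \<le> 1" "r \<in> {a..s b}"
  shows "norm (approach x e - of_real r) \<le> s b - a + 1"
proof -
  have "norm (approach x e - of_real r) \<le> \<bar>s x - r\<bar> + \<bar>e\<bar>"
    using cmod_le[of "approach x e - of_real r"] by simp
  also have "\<dots> \<le> (s b - a) + 1"
    using assms s_bounds[of x] s_eq[of b] ab by auto
  finally show ?thesis by simp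
qed

text \<open>In \<open>A_eq\<close> the real part of a logarithm is the logarithm of a modulus, which
  lies between the distance of the interval to the ends in the coordinate \<open>s\<close> and
  \<open>s b - a + 1\<close>, and \<open>remainder\<close> is bounded uniformly in \<open>x\<close>.
  The real part determines the modulus of \<open>exp\<close>, so this will dominate both transforms
  on compact intervals.\<close>

lemma Re_A_bounded:
  assumes sub: "{x1..x2} \<subseteq> U"
  shows "\<exists>B. \<forall>x\<in>{x1..x2}. \<forall>n. \<bar>Re (A (approach x (eps n)) b)\<bar> \<le> B"
proof (cases "x1 \<le> x2")
  case True
  then have x12: "x1 \<in> U" "x2 \<in> U" using sub by auto
  obtain K where K: "0 \<le> K" "\<And>x u. x \<in> {x1..x2} \<Longrightarrow> u \<in> {a..b} \<Longrightarrow> \<bar>f' u - f' x\<bar> \<le> K * \<bar>s u - s x\<bar>"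
    using difference_quotient_bound[OF sub] by blast
  let ?q = "s b - a + 1"
  let ?B = "(\<bar>ln (s x1 - a)\<bar> + \<bar>ln ?q\<bar>) + (\<bar>ln (s b - s x2)\<bar> + \<bar>ln ?q\<bar>) + K * (b - a)"
  have "\<bar>Re (A (approach x (eps n)) b)\<bar> \<le> ?B" if x: "x \<in> {x1..x2}" for x n
  proof -
    let ?z = "approach x (eps n)"
    have e: "0 < eps n" "\<bar>eps n\<bar> \<le> 1" using eps(1,2)[of n] by auto
    have 1: "\<bar>ln (norm (?z - of_real a))\<bar> \<le> \<bar>ln (s x1 - a)\<bar> + \<bar>ln ?q\<bar>"
    proof (rule abs_ln_le)
      show "s x1 - a \<le> norm (?z - of_real a)"
        using norm_approach_ge(1)[of x a "eps n"] s_mono[of x1 x] x by simp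
    qed (use s_strict[OF x12(1)] s_strict[OF x12(2)] norm_approach_le[OF e(2)] s_mono[of a b] ab in auto)
    have 2: "\<bar>ln (norm (?z - of_real (s b)))\<bar> \<le> \<bar>ln (s b - s x2)\<bar> + \<bar>ln ?q\<bar>"
    proof (rule abs_ln_le)
      show "s b - s x2 \<le> norm (?z - of_real (s b))"
        using norm_approach_ge(1)[of x b "eps n"] s_mono[of x x2] x by simp
    qed (use s_strict[OF x12(1)] s_strict[OF x12(2)] norm_approach_le[OF e(2)] s_mono[of a b] ab in auto)
    have ne: "?z - of_real r \<noteq> 0" for r using e by (auto simp: complex_eq_iff)
    have "(1 + f' x) * Re (A ?z b) = Re (of_real (1 + f' x) * A ?z b)" by simp
    also have "\<dots> = ln (norm (?z - of_real a)) - ln (norm (?z - of_real (s b))) - Re (remainder ?z x)"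
      using A_eq[of ?z x] e ne by simp
    finally have "\<bar>(1 + f' x) * Re (A ?z b)\<bar> \<le> ?B"
      using 1 2 norm_remainder[OF K(1) K(2)[OF x] e(1)] abs_Re_le_cmod[of "remainder ?z x"] by linarith
    \<comment> \<open>Since \<open>1 + f' x \<ge> 1\<close>, dropping this factor can only decrease
      the absolute value.\<close>
    moreover have "\<bar>Re (A ?z b)\<bar> \<le> \<bar>(1 + f' x) * Re (A ?z b)\<bar>"
      using f'_pos[of x] by (simp add: abs_mult mult_le_cancel_right1)
    ultimately show ?thesis by linarith
  qed
  then show ?thesis by blast
qed auto

lemma Re_cauchy_kernel: "Re (cauchy_kernel (approach x e) u) = (s x - s u) / (norm (approach x e - of_real (s u)))\<^sup>2"
  by (simp add: cauchy_kernel_def Re_divide cmod_def)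

text \<open>On each side of \<open>x\<close> the real part of the kernel has constant sign, so it is comparable to its
  product with \<open>1 + f'\<close>, which integrates to a logarithm.\<close>

lemma Re_A_estimates:
  assumes x: "a \<le> x" "x \<le> b" and e: "0 < e"
  defines "z \<equiv> approach x e"
  shows "0 \<le> Re (A z x)" "(1 + c) * Re (A z x) \<le> ln (norm (z - of_real a)) - ln e"
    and "0 \<le> Re (A z x - A z b)" "(1 + c) * Re (A z x - A z b) \<le> ln (norm (z - of_real (s b))) - ln e"
    and "ln (norm (z - of_real (s b))) - ln e \<le> (1 + C) * Re (A z x - A z b)"
proof -
  have z: "0 < Im z" "Im z \<noteq> 0" using e by (simp_all add: z_def)
  have ne: "z - of_real r \<noteq> 0" for r using z by (auto simp: complex_eq_iff)
  have cont: "continuous_on T (\<lambda>u. Re (cauchy_kernel z u))" for T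
    by (intro continuous_intros continuous_cauchy_kernel z)
  have zx: "norm (z - of_real (s x)) = e"
    using e by (simp add: z_def cmod_def)
  have i1: "((\<lambda>u. Re (cauchy_kernel z u)) has_integral Re (A z x)) {a..x}"
  proof -
    have "(cauchy_kernel z has_integral A z x) {a..x}"
      unfolding A_def using x
      by (auto intro!: integrable_integral integrable_continuous_real continuous_cauchy_kernel z continuous_on_id)
    from has_integral_linear[OF this bounded_linear_Re] show ?thesis by (simp add: o_def)
  qed
  have i2: "((\<lambda>u. - Re (cauchy_kernel z u)) has_integral Re (A z x - A z b)) {x..b}"
  proof -
    have int: "cauchy_kernel z integrable_on {p..q}" for p q
      by (intro integrable_continuous_real continuous_cauchy_kernel z continuous_on_id)
    have "A z x + integral {x..b} (cauchy_kernel z) = A z b"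
      unfolding A_def using x ab
      by (simp add: Henstock_Kurzweil_Integration.integral_combine[OF x int])
    then have "integral {x..b} (cauchy_kernel z) = A z b - A z x" by (simp add: algebra_simps)
    then have "(cauchy_kernel z has_integral A z b - A z x) {x..b}"
      using integrable_integral[OF int[of x b]] by simp
    from has_integral_neg[OF has_integral_linear[OF this bounded_linear_Re]] show ?thesis
      by (simp add: o_def)
  qed
  have l1: "((\<lambda>u. (1 + f' u) * Re (cauchy_kernel z u)) has_integral ln (norm (z - of_real a)) - ln e) {a..x}"
    using has_integral_linear[OF integral_log[OF z(2) order_refl x(1,2) z(1)] bounded_linear_Re] ne zx
    by (simp add: o_def)
  have l2: "((\<lambda>u. (1 + f' u) * - Re (cauchy_kernel z u)) has_integral ln (norm (z - of_real (s b))) - ln e) {x..b}"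
    using has_integral_neg[OF has_integral_linear[OF integral_log[OF z(2) x order_refl z(1)] bounded_linear_Re]] ne zx
    by (simp add: o_def)
  have p1: "0 \<le> Re (cauchy_kernel z u)" if "u \<in> {a..x}" for u
    using that s_mono[of u x] by (simp add: z_def Re_cauchy_kernel)
  have p2: "0 \<le> - Re (cauchy_kernel z u)" if "u \<in> {x..b}" for u
    using that s_mono[of x u] by (simp add: z_def Re_cauchy_kernel divide_nonpos_nonneg)
  show "0 \<le> Re (A z x)" by (rule has_integral_nonneg[OF i1 p1])
  show "0 \<le> Re (A z x - A z b)" by (rule has_integral_nonneg[OF i2 p2])
  show "(1 + c) * Re (A z x) \<le> ln (norm (z - of_real a)) - ln e"
    by (rule has_integral_le[OF has_integral_mult_right[OF i1] l1])
       (use p1 c in \<open>auto intro!: mult_right_mono\<close>)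
  show "(1 + c) * Re (A z x - A z b) \<le> ln (norm (z - of_real (s b))) - ln e"
    by (rule has_integral_le[OF has_integral_mult_right[OF i2] l2], rule mult_right_mono)
       (use p2 c in auto)
  show "ln (norm (z - of_real (s b))) - ln e \<le> (1 + C) * Re (A z x - A z b)"
    by (rule has_integral_le[OF l2 has_integral_mult_right[OF i2]], rule mult_right_mono)
       (use p2 C in auto)
qed

end

section \<open>Stieltjes inversion\<close>

lemma open_eq_Union_rational_intervals:
  fixes V :: "real set"
  assumes "open V"
  shows "V = \<Union>{{p..q} |p q. p \<in> \<rat> \<and> q \<in> \<rat> \<and> {p..q} \<subseteq> V}"
proof (intro equalityI subsetI)
  fix x assume "x \<in> V"
  then obtain e where e: "0 < e" "ball x e \<subseteq> V" using assms open_contains_ball by blast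
  obtain p q where pq: "p \<in> \<rat>" "x - e < p" "p < x" "q \<in> \<rat>" "x < q" "q < x + e"
    using Rats_dense_in_real[of "x - e" x] Rats_dense_in_real[of x "x + e"] e by auto
  then have "{p..q} \<subseteq> ball x e" by (auto simp: dist_real_def)
  then show "x \<in> \<Union>{{p..q} |p q. p \<in> \<rat> \<and> q \<in> \<rat> \<and> {p..q} \<subseteq> V}"
    using pq e by (intro UnionI[of "{p..q}"]) auto
qed auto

lemma countable_rational_intervals: "countable {{p..q} |p q :: real. p \<in> \<rat> \<and> q \<in> \<rat> \<and> {p..q} \<subseteq> V}"
proof -
  have "{{p..q} |p q :: real. p \<in> \<rat> \<and> q \<in> \<rat> \<and> {p..q} \<subseteq> V} \<subseteq> (\<lambda>(p, q). {p..q}) ` (\<rat> \<times> \<rat>)"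
    by auto
  then show ?thesis by (rule countable_subset) (intro countable_image countable_SIGMA countable_rat)
qed

text \<open>Closed intervals inside \<open>U\<close> form an intersection-stable generator of the
  trace of the Borel sets on \<open>U\<close>, and those with rational end points are a countable
  cover. Intervals that meet the complement of \<open>U\<close> never have to be compared.\<close>

lemma measure_eqI_compact_intervals:
  fixes M N :: "real measure"
  assumes sets: "sets M = sets borel" "sets N = sets borel" and U: "open U"
    and ae: "AE x in M. x \<in> U" "AE x in N. x \<in> U"
    and eq: "\<And>p q. {p..q} \<subseteq> U \<Longrightarrow> emeasure M {p..q} = emeasure N {p..q}"
    and fin: "\<And>p q. {p..q} \<subseteq> U \<Longrightarrow> emeasure M {p..q} \<noteq> \<infinity>"
  shows "M = N"
proof -
  let ?E = "{{p..q} |p q. {p..q} \<subseteq> U}"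
  have E: "sets (restrict_space L U) = sigma_sets U ?E" if "sets L = sets borel" for L :: "real measure"
  proof -
    have "sets (restrict_space L U) = (\<inter>) U ` sigma_sets UNIV {V. open V}"
      using that by (simp add: sets_restrict_space borel_def)
    also have "\<dots> = sigma_sets U ((\<inter>) U ` {V. open V})"
      using U by (intro sigma_sets_Int) auto
    also have "\<dots> = sigma_sets U ?E"
    proof (rule sigma_sets_eqI)
      fix W assume "W \<in> (\<inter>) U ` {V. open V}"
      then have W: "open W" "W \<subseteq> U" using U by auto
      have "\<Union>{{p..q} |p q. p \<in> \<rat> \<and> q \<in> \<rat> \<and> {p..q} \<subseteq> W} \<in> sigma_sets U ?E"
        using W(2) by (intro sigma_sets_UNION countable_rational_intervals) blast
      then show "W \<in> sigma_sets U ?E"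
        using open_eq_Union_rational_intervals[OF W(1)] by simp
    next
      fix W assume "W \<in> ?E"
      then obtain p q where W: "W = {p..q}" "{p..q} \<subseteq> U" by auto
      \<comment> \<open>An interval inside \<open>U\<close> is the complement, relative to
        \<open>U\<close>, of the trace of an open set.\<close>
      have "U \<inter> - {p..q} \<in> sigma_sets U ((\<inter>) U ` {V. open V})"
        by (intro sigma_sets.Basic imageI) auto
      from sigma_sets.Compl[OF this] show "W \<in> sigma_sets U ((\<inter>) U ` {V. open V})"
        using W by (simp add: Diff_Int double_diff Diff_Compl Int_absorb1 Int_absorb2)
    qed
    finally show ?thesis .
  qed
  let ?A = "{{p..q} |p q. p \<in> \<rat> \<and> q \<in> \<rat> \<and> {p..q} \<subseteq> U}"
  show ?thesis
  proof (rule measure_eqI_restrict_generator[where E="?E" and \<Omega>=U and A="?A"])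
    show "Int_stable ?E"
    proof (rule Int_stableI)
      fix P Q assume "P \<in> ?E" "Q \<in> ?E"
      then obtain p q p' q' where "P = {p..q}" "Q = {p'..q'}" "{p..q} \<subseteq> U" by auto
      then have "P \<inter> Q = {max p p'..min q q'}" "P \<inter> Q \<subseteq> U" by auto
      then show "P \<inter> Q \<in> ?E" by (intro CollectI exI[of _ "max p p'"] exI[of _ "min q q'"]) simp
    qed
    show "U \<in> sets M" using U sets by simp
    \<comment> \<open>The empty interval \<open>{1..0}\<close> belongs to the family whatever
      \<open>U\<close> is.\<close>
    show "?A \<noteq> {}"
      by (rule ex_in_conv[THEN iffD1], rule exI[of _ "{1..0}"], rule CollectI, rule exI[of _ 1], rule exI[of _ 0]) simp
    show "\<Union>?A = U" by (rule open_eq_Union_rational_intervals[OF U, symmetric])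
  qed (use sets ae eq fin E countable_rational_intervals[of U] in auto)
qed

context smooth_diagram
begin

definition poisson :: "real \<Rightarrow> real \<Rightarrow> real \<Rightarrow> real" where
  "poisson e x t = e / ((s x - s t)\<^sup>2 + e\<^sup>2)"

lemma Im_cauchy_kernel: "Im (cauchy_kernel (approach x e) t) = - poisson e x t"
  by (simp add: cauchy_kernel_def Im_divide poisson_def)

lemma poisson_bounds: "0 < e \<Longrightarrow> 0 \<le> poisson e x t" "0 < e \<Longrightarrow> poisson e x t \<le> 1 / e"
proof -
  assume e: "0 < e"
  then show "0 \<le> poisson e x t" by (simp add: poisson_def)
  have "poisson e x t \<le> e / e\<^sup>2"
    unfolding poisson_def using e by (intro divide_left_mono mult_pos_pos add_nonneg_pos) auto
  then show "poisson e x t \<le> 1 / e" using e by (simp add: power2_eq_square)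
qed

lemma weighted_poisson_bound:
  assumes e: "0 < e"
  shows "norm ((1 + f' x) * poisson e x t / pi) \<le> (1 + C) * (1 / e) / pi"
proof -
  have "(1 + f' x) * poisson e x t \<le> (1 + C) * (1 / e)"
    using C[of x] f'_pos(2)[of x] poisson_bounds[OF e] by (intro mult_mono) auto
  moreover have "0 \<le> (1 + f' x) * poisson e x t / pi"
    using f'_pos(2)[of x] poisson_bounds[OF e] by simp
  ultimately show ?thesis
    unfolding real_norm_def by (simp only: abs_of_nonneg, intro divide_right_mono) simp_all
qed

text \<open>The weight \<open>1 + f'\<close> is the derivative of \<open>s\<close>, so the
  substitution is exact and arctangents result, across kinks too, as \<open>s\<close> is
  continuous.\<close>

lemma integral_poisson:
  assumes "a \<le> p" "p \<le> q" "q \<le> b" and e: "0 < e"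
  shows "((\<lambda>x. (1 + f' x) * poisson e x t) has_integral arctan ((s q - s t) / e) - arctan ((s p - s t) / e)) {p..q}"
proof (rule fundamental_theorem_of_calculus_interior_strong[OF fin assms(2)])
  fix x assume x: "x \<in> {p<..<q} - S"
  have "((\<lambda>x. arctan ((s x - s t) / e)) has_real_derivative (1 + f' x) / e * inverse (1 + ((s x - s t) / e)\<^sup>2)) (at x)"
    using x assms by (auto intro!: derivative_eq_intros s_deriv)
  also have "(1 + f' x) / e * inverse (1 + ((s x - s t) / e)\<^sup>2) = (1 + f' x) * poisson e x t"
    using e by (simp add: poisson_def divide_simps power2_eq_square)
  finally show "((\<lambda>x. arctan ((s x - s t) / e)) has_vector_derivative (1 + f' x) * poisson e x t) (at x)"
    by (simp add: has_real_derivative_iff_has_vector_derivative)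
qed (use e in \<open>auto intro!: continuous_intros\<close>)

lemma arctan_eps_tendsto: "(\<lambda>n. arctan (t / eps n)) \<longlonglongrightarrow> sgn t * (pi / 2)"
proof -
  have pos: "(\<lambda>n. arctan (t / eps n)) \<longlonglongrightarrow> pi / 2" if "0 < t" for t
  proof (rule filterlim_compose[OF tendsto_arctan_at_top])
    have "filterlim (\<lambda>n. t * real (Suc n)) at_top sequentially"
      by (rule filterlim_tendsto_pos_mult_at_top[OF tendsto_const that])
         (rule filterlim_compose[OF filterlim_real_sequentially filterlim_Suc])
    then show "filterlim (\<lambda>n. t / eps n) at_top sequentially"
      by (simp add: eps_def divide_inverse)
  qed
  consider "t = 0" | "0 < t" | "0 < - t" by linarith
  then show ?thesis
  proof cases
    case 3
    from tendsto_minus[OF pos[OF 3]] show ?thesis using 3 by (simp add: arctan_minus)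
  qed (use pos in auto)
qed

text \<open>The law of \<open>s X\<close>, smoothed by a Cauchy distribution of scale
  \<open>eps n\<close>, has a density at \<open>s x\<close>; the factor \<open>1 + f' x\<close>
  converts it into a density in \<open>x\<close>.\<close>

definition smoothed :: "real measure \<Rightarrow> nat \<Rightarrow> real \<Rightarrow> real" where
  "smoothed \<nu> n x = (1 + f' x) * (\<integral>t. poisson (eps n) x t \<partial>\<nu>) / pi"

definition boundary_density :: "(real \<Rightarrow> complex) \<Rightarrow> real \<Rightarrow> real" where
  "boundary_density G0 x = (if x \<in> U then - ((1 + f' x) / pi) * Im (G0 x) else 0)"

context
  fixes \<nu> :: "real measure" and G :: "complex \<Rightarrow> complex" and G0 :: "real \<Rightarrow> complex"
  assumes \<nu>: "prob_space \<nu>" "sets \<nu> = sets borel" "AE x in \<nu>. x \<in> {a..b}"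
    and G: "\<And>z. 0 < Im z \<Longrightarrow> (\<integral>x. cauchy_kernel z x \<partial>\<nu>) = G z"
    and lim: "\<And>x. x \<in> U \<Longrightarrow> (\<lambda>n. G (approach x (eps n))) \<longlonglongrightarrow> G0 x"
    and bnd: "\<And>p q. {p..q} \<subseteq> U \<Longrightarrow> \<exists>B. \<forall>x\<in>{p..q}. \<forall>n. norm (G (approach x (eps n))) \<le> B"
    and atom: "\<And>x. x \<in> {a..b} \<Longrightarrow> (\<lambda>n. of_real (eps n) * G (approach x (eps n))) \<longlonglongrightarrow> 0"
begin

interpretation \<nu>: prob_space \<nu> by (rule \<nu>(1))

interpretation pair: pair_sigma_finite lborel \<nu> ..

lemma sets_\<nu> [measurable_cong]: "sets \<nu> = sets borel" by (rule \<nu>(2))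

lemma integrable_cauchy_kernel: "0 < Im z \<Longrightarrow> integrable \<nu> (cauchy_kernel z)"
proof -
  assume z: "0 < Im z"
  then have "cauchy_kernel z \<in> borel_measurable borel"
    by (intro borel_measurable_continuous_onI continuous_cauchy_kernel continuous_on_id) simp
  then show ?thesis
    using norm_cauchy_kernel_le[of z] z
    by (intro \<nu>.integrable_const_bound[where B="1 / \<bar>Im z\<bar>"]) (auto simp: measurable_cong_sets[OF \<nu>(2) refl])
qed

text \<open>\<open>eps n\<close> times the kernel is bounded by 1. It equals \<open>- \<i>\<close>
  at \<open>t = x\<close> and tends to 0 at every other \<open>t\<close> of \<open>{a..b}\<close>,
  because \<open>s\<close> is injective there. The limit of \<open>eps n * G\<close> is therefore
  \<open>- \<i>\<close> times the mass of \<open>x\<close>.\<close>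

lemma no_atom:
  assumes x: "x \<in> {a..b}"
  shows "emeasure \<nu> {x} = 0"
proof -
  have "(\<lambda>n. of_real (eps n) * G (approach x (eps n))) \<longlonglongrightarrow> (\<integral>t. indicator {x} t *\<^sub>R (- \<i>) \<partial>\<nu>)"
  proof -
    have "(\<lambda>n. \<integral>t. of_real (eps n) * cauchy_kernel (approach x (eps n)) t \<partial>\<nu>) \<longlonglongrightarrow> (\<integral>t. indicator {x} t *\<^sub>R (- \<i>) \<partial>\<nu>)"
    proof (rule integral_dominated_convergence[where w="\<lambda>_. 1"])
      show "(\<lambda>t. of_real (eps n) * cauchy_kernel (approach x (eps n)) t) \<in> borel_measurable \<nu>" for n
        using borel_measurable_integrable[OF integrable_cauchy_kernel[of "approach x (eps n)"]] eps(1)[of n] by simp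
      show "AE t in \<nu>. norm (of_real (eps n) * cauchy_kernel (approach x (eps n)) t) \<le> 1" for n
        using norm_cauchy_kernel_le[of "approach x (eps n)"] eps(1)[of n]
        by (intro AE_I2) (simp add: norm_mult field_simps)
      show "AE t in \<nu>. (\<lambda>n. of_real (eps n) * cauchy_kernel (approach x (eps n)) t) \<longlonglongrightarrow> indicator {x} t *\<^sub>R (- \<i>)"
        using \<nu>(3)
      proof eventually_elim
        case (elim t)
        show ?case
        proof (cases "t = x")
          case True
          have "of_real (eps n) * cauchy_kernel (approach x (eps n)) x = - \<i>" for n
          proof -
            have "approach x (eps n) - of_real (s x) = \<i> * of_real (eps n)"
              by (simp add: complex_eq_iff)
            then show ?thesis using eps(1)[of n] by (simp add: cauchy_kernel_def divide_simps)
          qed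
          then show ?thesis using True by simp
        next
          case False
          then have "of_real (s x) - complex_of_real (s t) \<noteq> 0"
            using s_diff_abs[OF x elim] by auto
          then have "(\<lambda>n. of_real (eps n) * (1 / (approach x (eps n) - of_real (s t)))) \<longlonglongrightarrow>
              of_real 0 * (1 / (of_real (s x) - of_real (s t)))"
            by (intro tendsto_intros eps approach_tendsto)
          then show ?thesis using False by (simp add: cauchy_kernel_def)
        qed
      qed
    qed auto
    moreover have "(\<integral>t. of_real (eps n) * cauchy_kernel (approach x (eps n)) t \<partial>\<nu>) = of_real (eps n) * G (approach x (eps n))" for n
      using G[of "approach x (eps n)"] eps(1)[of n] by simp
    ultimately show ?thesis by (simp only:)
  qed
  then have "(\<integral>t. indicator {x} t *\<^sub>R (- \<i>) \<partial>\<nu>) = 0"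
    using atom[OF x] LIMSEQ_unique by blast
  moreover have "(\<integral>t. indicator {x} t *\<^sub>R (- \<i>) \<partial>\<nu>) = measure \<nu> {x} *\<^sub>R (- \<i>)"
    by (subst integral_scaleR_left) (auto intro!: integrable_real_indicator simp: \<nu>.emeasure_eq_measure)
  ultimately have "measure \<nu> {x} = 0" by simp
  then show ?thesis by (simp add: \<nu>.emeasure_eq_measure)
qed

lemma AE_in_U: "AE x in \<nu>. x \<in> U"
proof -
  have "AE x in \<nu>. \<forall>y\<in>(S \<union> {a, b}) \<inter> {a..b}. x \<noteq> y"
  proof (rule AE_finite_allI)
    fix y assume "y \<in> (S \<union> {a, b}) \<inter> {a..b}"
    then have "{y} \<in> null_sets \<nu>" by (intro null_setsI no_atom) auto
    from AE_not_in[OF this] show "AE x in \<nu>. x \<noteq> y" by simp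
  qed (use fin in auto)
  then show ?thesis using \<nu>(3) by eventually_elim force
qed

lemma smoothed_measurable [measurable]: "smoothed \<nu> n \<in> borel_measurable borel"
proof -
  have "(\<lambda>x. \<integral>t. poisson (eps n) x t \<partial>\<nu>) \<in> borel_measurable borel"
    unfolding poisson_def by measurable
  then show ?thesis unfolding smoothed_def[abs_def] by measurable
qed

lemma smoothed_eq: "smoothed \<nu> n x = - ((1 + f' x) / pi) * Im (G (approach x (eps n)))"
proof -
  have "Im (G (approach x (eps n))) = (\<integral>t. Im (cauchy_kernel (approach x (eps n)) t) \<partial>\<nu>)"
    using G[of "approach x (eps n)", symmetric] eps(1)[of n] integral_bounded_linear[OF bounded_linear_Im integrable_cauchy_kernel, of "approach x (eps n)"]
    by simp
  then show ?thesis by (simp add: smoothed_def Im_cauchy_kernel)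
qed

lemma smoothed_tendsto: "x \<in> U \<Longrightarrow> (\<lambda>n. smoothed \<nu> n x) \<longlonglongrightarrow> boundary_density G0 x"
  unfolding smoothed_eq boundary_density_def by (simp only: if_True) (intro tendsto_intros lim)

lemma smoothed_nonneg: "0 \<le> smoothed \<nu> n x"
  unfolding smoothed_def using f'_pos(2)[of x] poisson_bounds(1)[OF eps(1)[of n]] by simp

lemma boundary_density_nonneg: "0 \<le> boundary_density G0 x"
proof (cases "x \<in> U")
  case True
  show ?thesis by (rule LIMSEQ_le_const[OF smoothed_tendsto[OF True]]) (simp add: smoothed_nonneg)
next
  case False
  then show ?thesis unfolding boundary_density_def by (simp only: if_False)
qed

lemma boundary_density_measurable [measurable]: "boundary_density G0 \<in> borel_measurable borel"
proof (rule borel_measurable_LIMSEQ_real)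
  have [measurable]: "U \<in> sets borel" using open_U by simp
  show "(\<lambda>x. indicator U x * smoothed \<nu> n x) \<in> borel_measurable borel" for n by measurable
  show "(\<lambda>n. indicator U x * smoothed \<nu> n x) \<longlonglongrightarrow> boundary_density G0 x" for x
  proof (cases "x \<in> U")
    case True
    then show ?thesis using smoothed_tendsto[OF True] by (simp only: indicator_simps mult_1)
  next
    case False
    then have "indicator U x = (0 :: real)" by (rule indicator_simps(2))
    with False show ?thesis by (simp only: boundary_density_def if_False mult_zero_left tendsto_const)
  qed
qed

text \<open>The integral of \<open>smoothed\<close> over \<open>{p..q}\<close> is computed in two
  ways. Domination by the bound on \<open>G\<close> gives the integral of the boundary density;
  exchanging the integrals gives the mean of a difference of arctangents over \<open>pi\<close>,
  which tends to the indicator of the interval.\<close>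

lemma measure_interval:
  assumes pq: "p < q" "{p..q} \<subseteq> U"
  shows "integrable lborel (\<lambda>x. indicator {p..q} x * boundary_density G0 x)"
    and "(\<integral>x. indicator {p..q} x * boundary_density G0 x \<partial>lborel) = measure \<nu> {p..q}"
proof -
  have "p \<in> {p..q}" "q \<in> {p..q}" using pq(1) by auto
  then have "p \<in> U" "q \<in> U" using pq(2) by blast+
  then have ab': "a \<le> p" "q \<le> b" "p \<in> {a..b}" "q \<in> {a..b}" by auto
  obtain B where B: "\<And>x n. x \<in> {p..q} \<Longrightarrow> norm (G (approach x (eps n))) \<le> B" using bnd[OF pq(2)] by blast
  let ?w = "\<lambda>x. indicator {p..q} x * ((1 + C) / pi * B)"
  have 1: "smoothed \<nu> n x \<le> (1 + C) / pi * B" if "x \<in> {p..q}" for n x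
  proof -
    have "smoothed \<nu> n x \<le> (1 + f' x) / pi * norm (G (approach x (eps n)))"
      unfolding smoothed_eq using f'_pos(2)[of x] abs_Im_le_cmod[of "G (approach x (eps n))"]
      by (simp only: mult_minus_left[symmetric] minus_mult_commute, intro mult_left_mono) auto
    also have "\<dots> \<le> (1 + C) / pi * B"
      using B[OF that] f'_pos(2)[of x] C[of x] by (intro mult_mono divide_right_mono) auto
    finally show ?thesis .
  qed
  have m: "(\<lambda>x. indicator {p..q} x * smoothed \<nu> n x) \<in> borel_measurable lborel"
    "(\<lambda>x. indicator {p..q} x * boundary_density G0 x) \<in> borel_measurable lborel" for n by measurable
  have w: "integrable lborel ?w"
    by (intro integrable_mult_left integrable_real_indicator) (use pq in auto)
  have t: "AE x in lborel. (\<lambda>n. indicator {p..q} x * smoothed \<nu> n x) \<longlonglongrightarrow> indicator {p..q} x * boundary_density G0 x"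
  proof (rule AE_I2)
    show "(\<lambda>n. indicator {p..q} x * smoothed \<nu> n x) \<longlonglongrightarrow> indicator {p..q} x * boundary_density G0 x" for x
    proof (cases "x \<in> {p..q}")
      case True
      then have "x \<in> U" using pq(2) by blast
      then show ?thesis by (intro tendsto_mult tendsto_const smoothed_tendsto)
    qed simp
  qed
  have d: "AE x in lborel. norm (indicator {p..q} x * smoothed \<nu> n x) \<le> ?w x" for n
    using 1 smoothed_nonneg by (intro AE_I2) (auto simp: indicator_def)
  show "integrable lborel (\<lambda>x. indicator {p..q} x * boundary_density G0 x)"
    by (rule integrable_dominated_convergence[OF m(2,1) w t d])
  have lhs: "(\<lambda>n. \<integral>x. indicator {p..q} x * smoothed \<nu> n x \<partial>lborel) \<longlonglongrightarrow> (\<integral>x. indicator {p..q} x * boundary_density G0 x \<partial>lborel)"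
    by (rule integral_dominated_convergence[OF m(2,1) w t d])
  have fub: "(\<integral>x. indicator {p..q} x * smoothed \<nu> n x \<partial>lborel) =
      (\<integral>t. (arctan ((s q - s t) / eps n) - arctan ((s p - s t) / eps n)) / pi \<partial>\<nu>)" for n
  proof -
    let ?h = "\<lambda>x t. indicator {p..q} x * ((1 + f' x) * poisson (eps n) x t / pi)"
    note e = eps(1)[of n]
    have int: "integrable (lborel \<Otimes>\<^sub>M \<nu>) (case_prod ?h)"
    proof (rule integrableI_bounded_set[where A="{p..q} \<times> space \<nu>" and B="(1 + C) * (1 / eps n) / pi"])
      show "{p..q} \<times> space \<nu> \<in> sets (lborel \<Otimes>\<^sub>M \<nu>)" by (intro pair_measureI) auto
      show "emeasure (lborel \<Otimes>\<^sub>M \<nu>) ({p..q} \<times> space \<nu>) < \<infinity>"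
        using pq(1) by (subst \<nu>.emeasure_pair_measure_Times) (auto simp: \<nu>.emeasure_space_1)
      show "case_prod ?h \<in> borel_measurable (lborel \<Otimes>\<^sub>M \<nu>)"
        unfolding case_prod_beta poisson_def by measurable
      have "norm (case_prod ?h y) \<le> (1 + C) * (1 / eps n) / pi" for y
      proof (cases "fst y \<in> {p..q}")
        case True
        then show ?thesis
          using weighted_poisson_bound[OF e] by (simp only: case_prod_beta indicator_simps mult_1)
      next
        case False
        then have "indicator {p..q} (fst y) = (0 :: real)" by simp
        then show ?thesis
          using order_trans[OF norm_ge_zero weighted_poisson_bound[OF e]]
          by (simp only: case_prod_beta mult_zero_left norm_zero)
      qed
      then show "AE y in lborel \<Otimes>\<^sub>M \<nu>. y \<in> {p..q} \<times> space \<nu> \<longrightarrow> norm (case_prod ?h y) \<le> (1 + C) * (1 / eps n) / pi"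
        by simp
    qed (use sets_eq_imp_space_eq[OF \<nu>(2)] in \<open>auto simp: indicator_def\<close>)
    have "(\<integral>x. indicator {p..q} x * smoothed \<nu> n x \<partial>lborel) = (\<integral>x. \<integral>t. ?h x t \<partial>\<nu> \<partial>lborel)"
      by (simp add: smoothed_def)
    also have "\<dots> = (\<integral>t. \<integral>x. ?h x t \<partial>lborel \<partial>\<nu>)"
      by (rule pair.Fubini_integral[OF int, symmetric])
    also have "\<dots> = (\<integral>t. (arctan ((s q - s t) / eps n) - arctan ((s p - s t) / eps n)) / pi \<partial>\<nu>)"
    proof (rule Bochner_Integration.integral_cong[OF refl])
      fix t
      have "set_integrable lborel {p..q} (\<lambda>x. (1 + f' x) * poisson (eps n) x t / pi)"
        unfolding set_integrable_def
      proof (rule integrableI_bounded_set[where A="{p..q}" and B="(1 + C) * (1 / eps n) / pi"])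
        show "AE x in lborel. x \<in> {p..q} \<longrightarrow>
            norm (indicator {p..q} x *\<^sub>R ((1 + f' x) * poisson (eps n) x t / pi)) \<le> (1 + C) * (1 / eps n) / pi"
          using weighted_poisson_bound[OF e] by (intro AE_I2 impI) (simp only: indicator_simps scaleR_one)
        show "(\<lambda>x. indicator {p..q} x *\<^sub>R ((1 + f' x) * poisson (eps n) x t / pi)) \<in> borel_measurable lborel"
          unfolding poisson_def by measurable
      qed (use pq(1) in auto)
      moreover have "((\<lambda>x. (1 + f' x) * poisson (eps n) x t / pi) has_integral
          (arctan ((s q - s t) / eps n) - arctan ((s p - s t) / eps n)) / pi) {p..q}"
        using has_integral_divide[OF integral_poisson[OF ab'(1) _ ab'(2) e]] pq(1) by simp
      ultimately have "(LBINT x:{p..q}. (1 + f' x) * poisson (eps n) x t / pi) =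
          (arctan ((s q - s t) / eps n) - arctan ((s p - s t) / eps n)) / pi"
        by (simp only: set_borel_integral_eq_integral(2) integral_unique)
      then show "(\<integral>x. ?h x t \<partial>lborel) = (arctan ((s q - s t) / eps n) - arctan ((s p - s t) / eps n)) / pi"
        by (simp add: set_lebesgue_integral_def)
    qed
    finally show ?thesis .
  qed
  have rhs: "(\<lambda>n. \<integral>t. (arctan ((s q - s t) / eps n) - arctan ((s p - s t) / eps n)) / pi \<partial>\<nu>) \<longlonglongrightarrow> (\<integral>t. indicator {p..q} t \<partial>\<nu>)"
  proof (rule integral_dominated_convergence[where w="\<lambda>_. 1"])
    have am: "arctan \<in> borel_measurable borel"
      by (intro borel_measurable_continuous_onI continuous_intros)
    show "(\<lambda>t. (arctan ((s q - s t) / eps n) - arctan ((s p - s t) / eps n)) / pi) \<in> borel_measurable \<nu>" for n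
      by (intro borel_measurable_divide borel_measurable_diff measurable_compose[OF _ am]) measurable
    show "AE t in \<nu>. norm ((arctan ((s q - s t) / eps n) - arctan ((s p - s t) / eps n)) / pi) \<le> 1" for n
    proof (rule AE_I2)
      fix t
      show "norm ((arctan ((s q - s t) / eps n) - arctan ((s p - s t) / eps n)) / pi) \<le> 1"
        using arctan_bounded[of "(s q - s t) / eps n"] arctan_bounded[of "(s p - s t) / eps n"]
        by (simp add: divide_le_eq_1 abs_le_iff)
    qed
    \<comment> \<open>At \<open>t = p\<close> and \<open>t = q\<close> the arctangents tend to
      \<open>1 / 2\<close> instead of the indicator; these two points carry no mass.\<close>
    have ne: "AE t in \<nu>. t \<noteq> y" if "y \<in> {a..b}" for y
    proof -
      have "{y} \<in> null_sets \<nu>" using that by (intro null_setsI no_atom) auto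
      from AE_not_in[OF this] show ?thesis by simp
    qed
    show "AE t in \<nu>. (\<lambda>n. (arctan ((s q - s t) / eps n) - arctan ((s p - s t) / eps n)) / pi) \<longlonglongrightarrow> indicator {p..q} t"
      using \<nu>(3) ne[OF ab'(3)] ne[OF ab'(4)]
    proof eventually_elim
      case (elim t)
      have sg: "sgn (s y - s t) = sgn (y - t)" if "y \<in> {a..b}" for y
        using s_diff[of y t] s_diff[of t y] that elim(1) by (cases "y \<le> t") (auto simp: sgn_if)
      have "(\<lambda>n. (arctan ((s q - s t) / eps n) - arctan ((s p - s t) / eps n)) / pi) \<longlonglongrightarrow>
          (sgn (s q - s t) * (pi / 2) - sgn (s p - s t) * (pi / 2)) / pi"
        by (intro tendsto_intros arctan_eps_tendsto) simp
      also have "(sgn (s q - s t) * (pi / 2) - sgn (s p - s t) * (pi / 2)) / pi = indicator {p..q} t"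
        unfolding sg[OF ab'(3)] sg[OF ab'(4)] using elim pq(1) by (auto simp: sgn_if indicator_def)
      finally show ?case .
    qed
  qed auto
  show "(\<integral>x. indicator {p..q} x * boundary_density G0 x \<partial>lborel) = measure \<nu> {p..q}"
    using LIMSEQ_unique[OF lhs rhs[folded fub]] by simp
qed

text \<open>The two measures agree on compact intervals inside \<open>U\<close>. The complement of
  \<open>U\<close> is null for \<open>\<nu>\<close>, which lives on \<open>{a..b}\<close> and has no
  atoms there, and null for the density, which is 0 off \<open>U\<close>.\<close>

lemma stieltjes_inversion: "\<nu> = density lborel (\<lambda>x. ennreal (boundary_density G0 x))"
proof (rule measure_eqI_compact_intervals[OF \<nu>(2) _ open_U AE_in_U])
  show "AE x in density lborel (\<lambda>x. ennreal (boundary_density G0 x)). x \<in> U"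
  proof (subst AE_density)
    show "AE x in lborel. 0 < ennreal (boundary_density G0 x) \<longrightarrow> x \<in> U"
      by (simp add: boundary_density_def)
  qed measurable
  fix p q assume pq: "{p..q} \<subseteq> U"
  have em: "emeasure (density lborel (\<lambda>x. ennreal (boundary_density G0 x))) {p..q} =
      (\<integral>\<^sup>+x. ennreal (indicator {p..q} x * boundary_density G0 x) \<partial>lborel)"
    by (subst emeasure_density) (auto intro!: nn_integral_cong simp: indicator_def)
  consider "q < p" | "p = q" | "p < q" by linarith
  then show "emeasure \<nu> {p..q} = emeasure (density lborel (\<lambda>x. ennreal (boundary_density G0 x))) {p..q}"
  proof cases
    case 2
    have "emeasure (density lborel (\<lambda>x. ennreal (boundary_density G0 x))) {p} = 0"
      by (subst emeasure_density) (auto simp: nn_integral_0_iff_AE indicator_def intro: AE_mp[OF AE_lborel_singleton[of p]])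
    then show ?thesis using 2 pq no_atom[of p] by auto
  next
    case 3
    have "(\<integral>\<^sup>+x. ennreal (indicator {p..q} x * boundary_density G0 x) \<partial>lborel) = ennreal (measure \<nu> {p..q})"
      using measure_interval[OF 3 pq] boundary_density_nonneg by (subst nn_integral_eq_integral) auto
    then show ?thesis unfolding em by (simp add: \<nu>.emeasure_eq_measure)
  qed simp
  show "emeasure \<nu> {p..q} \<noteq> \<infinity>" by simp
qed simp

end

end

section \<open>The densities\<close>

text \<open>Measurability of \<open>h\<close> is inherited from \<open>g\<close>. This allows
  formulas in \<open>deriv f\<close>, whose values at the kinks are arbitrary.\<close>

lemma density_lborel_cong_finite:
  assumes "finite X" and g [measurable]: "g \<in> borel_measurable lborel" and eq: "\<And>x. x \<notin> X \<Longrightarrow> g x = h x"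
  shows "density lborel g = density lborel h"
proof (rule density_cong[OF g])
  show "h \<in> borel_measurable lborel"
    by (rule measurable_discrete_difference[OF g countable_finite[OF assms(1)]]) (auto simp: eq)
  have "AE x in lborel. \<forall>y\<in>X. x \<noteq> y"
    using assms(1) AE_lborel_singleton by (intro AE_finite_allI) auto
  then show "AE x in lborel. g x = h x" by eventually_elim (use eq in blast)
qed

lemma prob_density_integral:
  fixes h :: "'a \<Rightarrow> real"
  assumes "prob_space (density M (\<lambda>x. ennreal (h x)))" and [measurable]: "h \<in> borel_measurable M" and nn: "\<And>x. 0 \<le> h x"
  shows "(\<integral>x. h x \<partial>M) = 1"
proof -
  have "(\<integral>\<^sup>+x. ennreal (h x) \<partial>M) = emeasure (density M (\<lambda>x. ennreal (h x))) (space M)"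
    by (subst emeasure_density) (auto intro!: nn_integral_cong)
  also have "\<dots> = 1" using prob_space.emeasure_space_1[OF assms(1)] by simp
  finally have "(\<integral>\<^sup>+x. ennreal (h x) \<partial>M) = 1" .
  moreover have "(\<integral>x. h x \<partial>M) = enn2real (\<integral>\<^sup>+x. ennreal (h x) \<partial>M)"
    using nn by (intro integral_eq_nn_integral) auto
  ultimately show ?thesis by simp
qed

context smooth_diagram
begin

section \<open>Absence of atoms\<close>

lemma eps_powr_tendsto: "0 < p \<Longrightarrow> (\<lambda>n. eps n powr p) \<longlonglongrightarrow> 0"
  by (rule tendsto_zero_powrI) (auto intro!: eps tendsto_const less_imp_le always_eventually)

text \<open>Up to a constant this is \<open>eps n\<close> to the power
  \<open>1 - 1 / (1 + c) = c / (1 + c)\<close>, which is positive since the slope is bounded away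
  from 0.\<close>

lemma eps_exp_tendsto: "(\<lambda>n. eps n * exp ((k - ln (eps n)) / (1 + c))) \<longlonglongrightarrow> 0"
proof -
  have "eps n * exp ((k - ln (eps n)) / (1 + c)) = exp (k / (1 + c)) * eps n powr (c / (1 + c))" for n
  proof -
    have "l + (k - l) / d = k / d + (d - 1) / d * l" if "d \<noteq> 0" for l d :: real
      using that by (simp add: field_simps)
    from this[of "1 + c" "ln (eps n)"]
    have "ln (eps n) + (k - ln (eps n)) / (1 + c) = k / (1 + c) + c / (1 + c) * ln (eps n)"
      using c(1) by simp
    then show ?thesis
      using eps(1)[of n] by (simp add: powr_def flip: exp_add) (metis exp_add exp_ln)
  qed
  moreover have "(\<lambda>n. exp (k / (1 + c)) * eps n powr (c / (1 + c))) \<longlonglongrightarrow> exp (k / (1 + c)) * 0"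
    using c(1) by (intro tendsto_intros eps_powr_tendsto) simp
  ultimately show ?thesis by simp
qed

lemma s_b: "s b = b + f b" "b \<le> s b" "a < s b"
  using ab f_b_pos by (simp_all add: s_eq)

definition G_ext :: "complex \<Rightarrow> complex" where
  "G_ext z = exp (A z b) / (z - of_real a)"

definition G_int :: "complex \<Rightarrow> complex" where
  "G_int z = (z - of_real b - (z - of_real a) * exp (- A z b)) / of_real area"

lemma ln_norm_approach_le:
  assumes "r \<in> {a..s b}"
  shows "ln (norm (approach x (eps n) - of_real r)) \<le> ln (s b - a + 1)"
proof -
  have "approach x (eps n) - of_real r \<noteq> 0"
    using eps(1)[of n] by (auto simp: complex_eq_iff)
  then show ?thesis
    using norm_approach_le[OF _ assms, of "eps n" x] eps(1,2)[of n] by (intro ln_mono) auto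
qed

text \<open>Away from \<open>a\<close> the denominator of \<open>G_ext\<close> is bounded below, and
  \<open>Re (A z b) \<le> Re (A z x)\<close> leaves only the kernel integral to the left of
  \<open>x\<close>, controlled by \<open>c\<close>. At \<open>x = a\<close> the denominator has
  modulus \<open>eps n\<close> and uses up the factor in front, so \<open>exp (A z b)\<close> itself
  has to tend to 0; the upper bound \<open>C\<close> on the slope provides the rate
  \<open>eps n powr (1 / (1 + C))\<close>.\<close>

lemma no_atom_ext:
  assumes x: "x \<in> {a..b}"
  shows "(\<lambda>n. of_real (eps n) * G_ext (approach x (eps n))) \<longlonglongrightarrow> 0"
proof (cases "x = a")
  case False
  then have d: "0 < s x - a" using x s_diff[of a x] by simp
  let ?h = "\<lambda>n. eps n * exp ((ln (s b - a + 1) - ln (eps n)) / (1 + c)) / (s x - a)"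
  show ?thesis
  proof (rule Lim_null_comparison[OF always_eventually[OF allI]])
    fix n
    let ?z = "approach x (eps n)"
    note e = eps(1)[of n]
    have xab: "a \<le> x" "x \<le> b" using x by auto
    note est = Re_A_estimates[OF xab e]
    have "(1 + c) * Re (A ?z x) \<le> ln (s b - a + 1) - ln (eps n)"
      using est(2) ln_norm_approach_le[of a x n] s_b by simp
    then have "Re (A ?z x) \<le> (ln (s b - a + 1) - ln (eps n)) / (1 + c)"
      using c(1) by (simp add: pos_le_divide_eq mult.commute)
    moreover have "Re (A ?z b) \<le> Re (A ?z x)" using est(3) by simp
    ultimately have "exp (Re (A ?z b)) \<le> exp ((ln (s b - a + 1) - ln (eps n)) / (1 + c))" by simp
    moreover have "s x - a \<le> norm (?z - of_real a)"
      using norm_approach_ge(1)[of x a "eps n"] by simp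
    ultimately have "exp (Re (A ?z b)) / norm (?z - of_real a) \<le>
        exp ((ln (s b - a + 1) - ln (eps n)) / (1 + c)) / (s x - a)"
      using d by (intro frac_le) auto
    then show "norm (of_real (eps n) * G_ext ?z) \<le> ?h n"
      using e mult_left_mono[of _ _ "eps n"] by (fastforce simp: G_ext_def norm_mult norm_divide)
  next
    have "?h \<longlonglongrightarrow> 0 / (s x - a)"
      using d by (intro tendsto_divide eps_exp_tendsto tendsto_const) simp
    then show "?h \<longlonglongrightarrow> 0" by simp
  qed
next
  case True
  have C1: "0 < 1 + C" using f'_pos(2)[of a] C[of a] by linarith
  let ?h = "\<lambda>n. exp (- ln (s b - a) / (1 + C)) * eps n powr (1 / (1 + C))"
  show ?thesis
  proof (rule Lim_null_comparison[OF always_eventually[OF allI]])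
    fix n
    let ?z = "approach x (eps n)"
    note e = eps(1)[of n]
    have xab: "a \<le> x" "x \<le> b" using x by auto
    have "ln (s b - a) \<le> ln (norm (?z - of_real (s b)))"
      using norm_approach_ge(1)[of x b "eps n"] s_b(3) True by (intro ln_mono) auto
    then have "ln (s b - a) - ln (eps n) \<le> (1 + C) * - Re (A ?z b)"
      using Re_A_estimates(5)[OF xab e] True by simp
    then have "Re (A ?z b) \<le> (ln (eps n) - ln (s b - a)) / (1 + C)"
      using C1 by (simp add: pos_le_divide_eq algebra_simps)
    then have "exp (Re (A ?z b)) \<le> exp ((ln (eps n) - ln (s b - a)) / (1 + C))" by simp
    also have "\<dots> = ?h n"
      using e by (simp add: powr_def diff_divide_distrib flip: exp_add)
    finally have "exp (Re (A ?z b)) \<le> ?h n" .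
    moreover have "norm (?z - of_real a) = eps n"
      using True e by (simp add: cmod_def)
    ultimately show "norm (of_real (eps n) * G_ext ?z) \<le> ?h n"
      using e by (simp add: G_ext_def norm_mult norm_divide)
  next
    have "?h \<longlonglongrightarrow> exp (- ln (s b - a) / (1 + C)) * 0"
      using C1 by (intro tendsto_intros eps_powr_tendsto) simp
    then show "?h \<longlonglongrightarrow> 0" by simp
  qed
qed

text \<open>Nothing is divided by \<open>z - a\<close> here, so one estimate covers all
  \<open>x\<close>: \<open>- Re (A z b) \<le> Re (A z x - A z b)\<close> because
  \<open>Re (A z x) \<ge> 0\<close>, and the right side is controlled by the kernel integral to the
  right of \<open>x\<close>.\<close>

lemma no_atom_int:
  assumes x: "x \<in> {a..b}"
  shows "(\<lambda>n. of_real (eps n) * G_int (approach x (eps n))) \<longlonglongrightarrow> 0"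
proof -
  let ?q = "s b - a + 1"
  let ?h = "\<lambda>n. (?q * eps n + ?q * (eps n * exp ((ln ?q - ln (eps n)) / (1 + c)))) / area"
  show ?thesis
  proof (rule Lim_null_comparison[OF always_eventually[OF allI]])
    fix n
    let ?z = "approach x (eps n)"
    note e = eps(1)[of n]
    have e1: "\<bar>eps n\<bar> \<le> 1" using eps(1,2)[of n] by simp
    have xab: "a \<le> x" "x \<le> b" using x by auto
    note est = Re_A_estimates[OF xab e]
    have "(1 + c) * Re (A ?z x - A ?z b) \<le> ln ?q - ln (eps n)"
      using est(4) ln_norm_approach_le[of "s b" x n] s_b by simp
    then have "Re (A ?z x - A ?z b) \<le> (ln ?q - ln (eps n)) / (1 + c)"
      using c(1) by (simp add: pos_le_divide_eq mult.commute)
    moreover have "- Re (A ?z b) \<le> Re (A ?z x - A ?z b)" using est(1) by simp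
    ultimately have ex: "exp (- Re (A ?z b)) \<le> exp ((ln ?q - ln (eps n)) / (1 + c))" by simp
    have nb: "norm (?z - of_real b) \<le> ?q" and na: "norm (?z - of_real a) \<le> ?q"
      using norm_approach_le[OF e1, of b x] norm_approach_le[OF e1, of a x] ab s_b by auto
    have "norm (G_int ?z) \<le> (norm (?z - of_real b) + norm (?z - of_real a) * exp (- Re (A ?z b))) / area"
      unfolding G_int_def norm_divide
      using area_pos norm_triangle_ineq4[of "?z - of_real b" "(?z - of_real a) * exp (- A ?z b)"]
      by (simp add: norm_mult divide_right_mono)
    also have "\<dots> \<le> (?q + ?q * exp ((ln ?q - ln (eps n)) / (1 + c))) / area"
      using area_pos nb na ex order_trans[OF norm_ge_zero na]
      by (intro divide_right_mono add_mono mult_mono) auto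
    finally have "eps n * norm (G_int ?z) \<le> eps n * ((?q + ?q * exp ((ln ?q - ln (eps n)) / (1 + c))) / area)"
      using e by (intro mult_left_mono) auto
    also have "\<dots> = ?h n" by (simp add: algebra_simps)
    finally show "norm (of_real (eps n) * G_int ?z) \<le> ?h n"
      using e by (simp add: norm_mult)
  next
    have "?h \<longlonglongrightarrow> (?q * 0 + ?q * 0) / area"
      using area_pos by (intro tendsto_intros eps eps_exp_tendsto) simp
    then show "?h \<longlonglongrightarrow> 0" by simp
  qed
qed

lemma G_bounded:
  assumes sub: "{p..q} \<subseteq> U"
  shows "\<exists>B. \<forall>x\<in>{p..q}. \<forall>n. norm (G_ext (approach x (eps n))) \<le> B"
    and "\<exists>B. \<forall>x\<in>{p..q}. \<forall>n. norm (G_int (approach x (eps n))) \<le> B"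
proof -
  obtain B where B: "\<And>x n. x \<in> {p..q} \<Longrightarrow> \<bar>Re (A (approach x (eps n)) b)\<bar> \<le> B"
    using Re_A_bounded[OF sub] by blast
  let ?Q = "s b - a + 1"
  have ext: "norm (G_ext (approach x (eps n))) \<le> exp B / (s p - a)"
    and int: "norm (G_int (approach x (eps n))) \<le> (?Q + ?Q * exp B) / area" if x: "x \<in> {p..q}" for x n
  proof -
    let ?z = "approach x (eps n)"
    have "p \<in> {p..q}" using x by auto
    then have "p \<in> U" using sub by blast
    then have d: "0 < s p - a" using s_strict(1)[of p] by simp
    have e1: "\<bar>eps n\<bar> \<le> 1" using eps(1,2)[of n] by simp
    have ex: "exp (Re (A ?z b)) \<le> exp B" "exp (- Re (A ?z b)) \<le> exp B"
      using B[OF x, of n] by auto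
    have "s p - a \<le> norm (?z - of_real a)"
      using norm_approach_ge(1)[of x a "eps n"] s_mono[of p x] x by simp
    then show "norm (G_ext ?z) \<le> exp B / (s p - a)"
      using ex(1) d unfolding G_ext_def norm_divide norm_exp_eq_Re by (intro frac_le) auto
    have nb: "norm (?z - of_real b) \<le> ?Q" and na: "norm (?z - of_real a) \<le> ?Q"
      using norm_approach_le[OF e1, of b x] norm_approach_le[OF e1, of a x] ab s_b by auto
    have "norm (G_int ?z) \<le> (norm (?z - of_real b) + norm (?z - of_real a) * exp (- Re (A ?z b))) / area"
      unfolding G_int_def norm_divide
      using area_pos norm_triangle_ineq4[of "?z - of_real b" "(?z - of_real a) * exp (- A ?z b)"]
      by (simp add: norm_mult divide_right_mono)
    also have "\<dots> \<le> (?Q + ?Q * exp B) / area"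
      using area_pos nb na ex order_trans[OF norm_ge_zero na]
      by (intro divide_right_mono add_mono mult_mono) auto
    finally show "norm (G_int ?z) \<le> (?Q + ?Q * exp B) / area" .
  qed
  show "\<exists>B. \<forall>x\<in>{p..q}. \<forall>n. norm (G_ext (approach x (eps n))) \<le> B" using ext by blast
  show "\<exists>B. \<forall>x\<in>{p..q}. \<forall>n. norm (G_int (approach x (eps n))) \<le> B" using int by blast
qed

definition exterior_density :: "real \<Rightarrow> real" where
  "exterior_density x = 1 / pi * (1 + f' x) * sin (pi / (1 + f' x))
     * (x - a + f x) powr (- (f' x / (1 + f' x)))
     * (b - x + f b - f x) powr (- (1 / (1 + f' x)))
     * exp (diag x)"

text \<open>Not normalised: its integral over \<open>{a..b}\<close> will be \<open>area\<close>.
  Compared with \<open>exterior_density\<close> the two powers and the exponential are inverted, as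
  the interior transform involves \<open>exp (- A z b)\<close> and a factor \<open>z - a\<close> in
  place of a divisor.\<close>

definition interior_weight :: "real \<Rightarrow> real" where
  "interior_weight x = 1 / pi * (1 + f' x) * sin (pi / (1 + f' x))
     * (x - a + f x) powr (f' x / (1 + f' x))
     * (b - x + f b - f x) powr (1 / (1 + f' x))
     * exp (- diag x)"

lemma G_tendsto:
  assumes x: "x \<in> U"
  shows "(\<lambda>n. G_ext (approach x (eps n))) \<longlonglongrightarrow> exp (A_lim x) / of_real (s x - a)"
    and "(\<lambda>n. G_int (approach x (eps n))) \<longlonglongrightarrow>
      (of_real (s x - b) - of_real (s x - a) * exp (- A_lim x)) / of_real area"
proof -
  have "(\<lambda>n. exp (A (approach x (eps n)) b) / (approach x (eps n) - of_real a)) \<longlonglongrightarrow>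
      exp (A_lim x) / (of_real (s x) - of_real a)"
    using s_strict(1)[OF x] by (intro tendsto_intros A_tendsto x approach_tendsto) auto
  then show "(\<lambda>n. G_ext (approach x (eps n))) \<longlonglongrightarrow> exp (A_lim x) / of_real (s x - a)"
    by (simp add: G_ext_def)
  have "(\<lambda>n. (approach x (eps n) - of_real b - (approach x (eps n) - of_real a) * exp (- A (approach x (eps n)) b)) / of_real area)
      \<longlonglongrightarrow> (of_real (s x) - of_real b - (of_real (s x) - of_real a) * exp (- A_lim x)) / of_real area"
    using area_pos by (intro tendsto_intros A_tendsto x approach_tendsto) auto
  then show "(\<lambda>n. G_int (approach x (eps n))) \<longlonglongrightarrow>
      (of_real (s x - b) - of_real (s x - a) * exp (- A_lim x)) / of_real area"
    by (simp add: G_int_def)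
qed

lemma A_lim_parts:
  "Re (A_lim x) = (ln (s x - a) - ln (s b - s x)) / (1 + f' x) + diag x"
  "Im (A_lim x) = - (pi / (1 + f' x))"
proof -
  let ?w = "of_real (ln (s x - a) - ln (s b - s x) + (1 + f' x) * diag x) - \<i> * pi"
  have "A_lim x = ?w / of_real (1 + f' x)" by (simp add: A_lim_def)
  then show "Re (A_lim x) = (ln (s x - a) - ln (s b - s x)) / (1 + f' x) + diag x"
    "Im (A_lim x) = - (pi / (1 + f' x))"
    using f'_pos(2)[of x] by (simp_all only: Re_divide_of_real Im_divide_of_real) (simp_all add: field_simps)
qed

text \<open>\<open>Im (A_lim x) = - pi / k\<close> with \<open>k = 1 + f' x\<close> yields the sine.
  \<open>Re (A_lim x)\<close> contributes the power \<open>1 / k\<close> of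
  \<open>r = s x - a\<close>, from which dividing by \<open>r\<close> makes
  \<open>1 / k - 1 = - (f' x / k)\<close>; in the interior case the sign is reversed and multiplying
  by \<open>r\<close> makes \<open>f' x / k\<close>. The term \<open>s x - b\<close> of the interior
  transform is real and drops out.\<close>

lemma boundary_values:
  assumes x: "x \<in> U"
  shows "- ((1 + f' x) / pi) * Im (exp (A_lim x) / of_real (s x - a)) = exterior_density x"
    and "- ((1 + f' x) / pi) * Im ((of_real (s x - b) - of_real (s x - a) * exp (- A_lim x)) / of_real area) =
      1 / area * interior_weight x"
proof -
  define k where "k = 1 + f' x"
  have k: "0 < k" "f' x = k - 1" using f'_pos(2)[of x] by (simp_all add: k_def)
  define r where "r = s x - a"
  define t where "t = s b - s x"
  have r: "0 < r" and t: "0 < t" using s_strict[OF x] by (simp_all add: r_def t_def)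
  have rt: "x - a + f x = r" "b - x + f b - f x = t"
    using x s_b by (auto simp: r_def t_def s_eq)
  have Re: "Re (A_lim x) = (ln r - ln t) / k + diag x" and Im: "Im (A_lim x) = - (pi / k)"
    by (simp_all add: A_lim_parts r_def t_def k_def)
  have "exp (Re (A_lim x)) / r = exp (Re (A_lim x) - ln r)"
    using r by (simp add: exp_diff)
  also have "Re (A_lim x) - ln r = - ((k - 1) / k) * ln r + - (1 / k) * ln t + diag x"
    unfolding Re using k(1) by (simp add: field_simps)
  finally have e1: "exp (Re (A_lim x)) / r = r powr (- ((k - 1) / k)) * t powr (- (1 / k)) * exp (diag x)"
    unfolding exp_add using r t by (simp add: powr_def)
  have "r * exp (- Re (A_lim x)) = exp (ln r + - Re (A_lim x))"
    unfolding exp_add using r by simp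
  also have "ln r + - Re (A_lim x) = (k - 1) / k * ln r + 1 / k * ln t + - diag x"
    unfolding Re using k(1) by (simp add: field_simps)
  finally have e2: "r * exp (- Re (A_lim x)) = r powr ((k - 1) / k) * t powr (1 / k) * exp (- diag x)"
    unfolding exp_add using r t by (simp add: powr_def)
  have "Im (exp (A_lim x) / of_real r) = - (exp (Re (A_lim x)) / r * sin (pi / k))"
    by (simp only: Im_divide_of_real Im_exp Im sin_minus) simp
  then show "- ((1 + f' x) / pi) * Im (exp (A_lim x) / of_real (s x - a)) = exterior_density x"
    unfolding exterior_density_def rt k_def[symmetric] r_def[symmetric] e1 k(2) by simp
  have im: "Im ((of_real (s x - b) - of_real r * exp (- A_lim x)) / of_real area) =
      - (r * exp (- Re (A_lim x)) * sin (pi / k)) / area"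
    by (simp only: Im_divide_of_real minus_complex.sel Im_complex_of_real) (simp add: Im_exp Im)
  show "- ((1 + f' x) / pi) * Im ((of_real (s x - b) - of_real (s x - a) * exp (- A_lim x)) / of_real area) =
      1 / area * interior_weight x"
    unfolding interior_weight_def rt k_def[symmetric] r_def[symmetric] im e2 unfolding k(2) by (simp add: mult_ac)
qed

text \<open>Replaces the boundary density by a formula \<open>\<rho>\<close> on all of
  \<open>{a..b}\<close>, at the price of a finite set. The second claim is the total mass of
  \<open>\<nu>\<close>, from which the integral identities will follow.\<close>

lemma transition_density:
  assumes "prob_space \<nu>" "sets \<nu> = sets borel" "AE x in \<nu>. x \<in> {a..b}"
    and "\<And>z. 0 < Im z \<Longrightarrow> (\<integral>x. cauchy_kernel z x \<partial>\<nu>) = G z"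
    and "\<And>x. x \<in> U \<Longrightarrow> (\<lambda>n. G (approach x (eps n))) \<longlonglongrightarrow> G0 x"
    and "\<And>p q. {p..q} \<subseteq> U \<Longrightarrow> \<exists>B. \<forall>x\<in>{p..q}. \<forall>n. norm (G (approach x (eps n))) \<le> B"
    and "\<And>x. x \<in> {a..b} \<Longrightarrow> (\<lambda>n. of_real (eps n) * G (approach x (eps n))) \<longlonglongrightarrow> 0"
    and \<rho>: "\<And>x. x \<in> U \<Longrightarrow> - ((1 + f' x) / pi) * Im (G0 x) = \<rho> x"
  shows "\<nu> = density lborel (\<lambda>x. ennreal (indicator {a..b} x * \<rho> x))"
    and "(\<integral>x. indicator {a..b} x * \<rho> x \<partial>lborel) = 1"
    and "(\<lambda>x. ennreal (indicator {a..b} x * \<rho> x)) \<in> borel_measurable lborel"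
proof -
  note st = stieltjes_inversion[OF assms(1-7)]
  have m [measurable]: "boundary_density G0 \<in> borel_measurable borel"
    by (rule boundary_density_measurable[OF assms(1-7)])
  have nn: "0 \<le> boundary_density G0 x" for x
    by (rule boundary_density_nonneg[OF assms(1-7)])
  have eq: "boundary_density G0 x = indicator {a..b} x * \<rho> x" if "x \<notin> S \<union> {a, b}" for x
  proof (cases "x \<in> U")
    case True
    then have "boundary_density G0 x = \<rho> x"
      unfolding boundary_density_def \<rho>[OF True, symmetric] by (simp only: if_True)
    then show ?thesis using True by simp
  next
    case False
    then have "x \<notin> {a..b}" using that by auto
    then have "indicator {a..b} x = (0 :: real)" by (rule indicator_simps(2))
    with False show ?thesis by (simp only: boundary_density_def if_False mult_zero_left)
  qed
  have X: "finite (S \<union> {a, b})" using fin by simp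
  have "density lborel (\<lambda>x. ennreal (boundary_density G0 x)) = density lborel (\<lambda>x. ennreal (indicator {a..b} x * \<rho> x))"
    by (rule density_lborel_cong_finite[OF X]) (auto simp: eq simp del: Un_insert_right)
  with st show "\<nu> = density lborel (\<lambda>x. ennreal (indicator {a..b} x * \<rho> x))"
    by (rule trans)
  have "(\<integral>x. boundary_density G0 x \<partial>lborel) = 1"
    by (rule prob_density_integral) (use assms(1) st nn in auto)
  moreover have "(\<integral>x. boundary_density G0 x \<partial>lborel) = (\<integral>x. indicator {a..b} x * \<rho> x \<partial>lborel)"
    by (rule integral_discrete_difference[OF countable_finite[OF X]]) (auto simp: eq simp del: Un_insert_right)
  ultimately show "(\<integral>x. indicator {a..b} x * \<rho> x \<partial>lborel) = 1" by simp
  show "(\<lambda>x. ennreal (indicator {a..b} x * \<rho> x)) \<in> borel_measurable lborel"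
    by (rule measurable_discrete_difference[OF _ countable_finite[OF X], where f="\<lambda>x. ennreal (boundary_density G0 x)"])
       (auto simp: eq simp del: Un_insert_right)
qed

lemma sets_transition_measures:
  "sets (exterior_transition_measure a b f) = sets borel" "sets (interior_transition_measure a b f) = sets borel"
  by (simp_all add: exterior_transition_measure_def interior_transition_measure_def)

lemma exterior_law:
  shows "exterior_transition_measure a b f = density lborel (\<lambda>x. ennreal (indicator {a..b} x * exterior_density x))"
    and "(\<integral>x. indicator {a..b} x * exterior_density x \<partial>lborel) = 1"
    and "(\<lambda>x. ennreal (indicator {a..b} x * exterior_density x)) \<in> borel_measurable lborel"
proof -
  have "(\<integral>x. cauchy_kernel z x \<partial>exterior_transition_measure a b f) = G_ext z" if "0 < Im z" for z
    using exterior_transition(3)[of z] that by (simp add: G_ext_def)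
  note law = transition_density[OF exterior_transition(1) sets_transition_measures(1) exterior_transition(2)
      this G_tendsto(1) G_bounded(1) no_atom_ext boundary_values(1)]
  show "exterior_transition_measure a b f = density lborel (\<lambda>x. ennreal (indicator {a..b} x * exterior_density x))"
    "(\<integral>x. indicator {a..b} x * exterior_density x \<partial>lborel) = 1"
    "(\<lambda>x. ennreal (indicator {a..b} x * exterior_density x)) \<in> borel_measurable lborel"
    by (rule law; assumption)+
qed

lemma interior_law:
  shows "interior_transition_measure a b f = density lborel (\<lambda>x. ennreal (indicator {a..b} x * (1 / area * interior_weight x)))"
    and "(\<integral>x. indicator {a..b} x * (1 / area * interior_weight x) \<partial>lborel) = 1"
    and "(\<lambda>x. ennreal (indicator {a..b} x * (1 / area * interior_weight x))) \<in> borel_measurable lborel"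
proof -
  have "(\<integral>x. cauchy_kernel z x \<partial>interior_transition_measure a b f) = G_int z" if "0 < Im z" for z
    using interior_transition(3)[of z] that by (simp add: G_int_def)
  note law = transition_density[OF interior_transition(1) sets_transition_measures(2) interior_transition(2)
      this G_tendsto(2) G_bounded(2) no_atom_int boundary_values(2)]
  show "interior_transition_measure a b f = density lborel (\<lambda>x. ennreal (indicator {a..b} x * (1 / area * interior_weight x)))"
    "(\<integral>x. indicator {a..b} x * (1 / area * interior_weight x) \<partial>lborel) = 1"
    "(\<lambda>x. ennreal (indicator {a..b} x * (1 / area * interior_weight x))) \<in> borel_measurable lborel"
    by (rule law; assumption)+
qed

end

section \<open>From the extended diagram back to the given function\<close>

theorem theorem7:
  fixes a b :: real and f :: "real \<Rightarrow> real" and S :: "real set" and c C M :: real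
  assumes "a < b"
    and "continuous_on {a..b} f"
    and "mono_on {a..b} f"
    and "f a = 0"
    and "finite S"
    and "\<And>x. x \<in> {a<..<b} - S \<Longrightarrow> f differentiable (at x)"
    and "\<And>x. x \<in> {a<..<b} - S \<Longrightarrow> deriv f differentiable (at x)"
    and "continuous_on ({a<..<b} - S) (deriv (deriv f))"
    and "\<And>x. x \<in> {a<..<b} - S \<Longrightarrow> \<bar>deriv (deriv f) x\<bar> \<le> M"
    and "0 < c" and "\<And>x. x \<in> {a<..<b} - S \<Longrightarrow> c \<le> deriv f x \<and> deriv f x \<le> C"
  shows
    "exterior_transition_measure a b f = density lborel (\<lambda>x. ennreal (indicator {a..b} x *
       (1 / pi * (1 + deriv f x) * sin (pi / (1 + deriv f x))
        * (x - a + f x) powr (- (deriv f x / (1 + deriv f x)))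
        * (b - x + f b - f x) powr (- (1 / (1 + deriv f x)))
        * exp (diagram_integral a b f x))))
     \<and>
     interior_transition_measure a b f = density lborel (\<lambda>x. ennreal (indicator {a..b} x *
       (1 / (LBINT t:{a..b}. f t) *
        (1 / pi * (1 + deriv f x) * sin (pi / (1 + deriv f x))
        * (x - a + f x) powr (deriv f x / (1 + deriv f x))
        * (b - x + f b - f x) powr (1 / (1 + deriv f x))
        * exp (- diagram_integral a b f x)))))
     \<and>
     (LBINT x:{a..b}. f x) = (LBINT x:{a..b}.
        1 / pi * (1 + deriv f x) * sin (pi / (1 + deriv f x))
        * (x - a + f x) powr (deriv f x / (1 + deriv f x))
        * (b - x + f b - f x) powr (1 / (1 + deriv f x))
        * exp (- diagram_integral a b f x))
     \<and>
     pi = (LBINT x:{a..b}.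
        (1 + deriv f x) * sin (pi / (1 + deriv f x))
        * (x - a + f x) powr (- (deriv f x / (1 + deriv f x)))
        * (b - x + f b - f x) powr (- (1 / (1 + deriv f x)))
        * exp (diagram_integral a b f x))"
proof -
  define U where "U = {a<..<b} - S"
  \<comment> \<open>\<open>f\<close> is constrained only on \<open>{a..b}\<close>; clamping the
    argument supplies the constant continuation.\<close>
  define F where "F x = f (max a (min b x))" for x
  \<comment> \<open>Off \<open>U\<close> the values of \<open>deriv f\<close> are unspecified. The
    default \<open>c\<close> makes the derivative measurable and keeps it within the bounds
    everywhere.\<close>
  define d where "d x = (if x \<in> U then deriv f x else c)" for x
  have openU: "open U"
    unfolding U_def using assms(5) by (intro open_Diff finite_imp_closed) auto
  have F: "F x = f x" if "x \<in> {a..b}" for x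
    using that by (simp add: F_def)
  have f_deriv: "(f has_real_derivative deriv f x) (at x)" if "x \<in> U" for x
    using assms(6)[of x] that by (simp add: U_def DERIV_deriv_iff_real_differentiable)
  have f_deriv2: "(deriv f has_real_derivative deriv (deriv f) x) (at x)" if "x \<in> U" for x
    using assms(7)[of x] that by (simp add: U_def DERIV_deriv_iff_real_differentiable)
  interpret D: smooth_diagram a b F d S c C M
  proof
    show "continuous_on UNIV F"
      unfolding F_def[abs_def]
      by (rule continuous_on_compose2[OF assms(2)]) (use assms(1) in \<open>auto intro!: continuous_intros\<close>)
    show "F x = 0" if "x \<le> a" for x
      using that assms(1,4) by (simp add: F_def)
    show "F x = F b" if "b \<le> x" for x
      using that assms(1) by (simp add: F_def)
    show "(F has_real_derivative d x) (at x)" if x: "x \<in> {a<..<b} - S" for x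
    proof -
      have "(f has_real_derivative d x) (at x)"
        using f_deriv[of x] x by (simp add: d_def U_def)
      then show ?thesis
        by (rule has_field_derivative_transform_within_open[where S="{a<..<b}"]) (use x F in auto)
    qed
    have "continuous_on U (deriv f)"
      using f_deriv2 by (intro continuous_at_imp_continuous_on) (auto intro: DERIV_isCont)
    then show "d \<in> borel_measurable borel"
      unfolding d_def[abs_def] using openU
      by (intro borel_measurable_continuous_on_if) auto
    \<comment> \<open>The default value \<open>c\<close> respects the upper bound only if
      \<open>c \<le> C\<close>, which is read off at some point of \<open>U\<close>.\<close>
    have "infinite U"
      unfolding U_def using assms(1,5) by (simp add: infinite_Ioo)
    then obtain x0 where "x0 \<in> U" by fastforce
    then have "c \<le> C" using assms(11)[of x0] by (simp add: U_def)
    then show "d x \<le> C" for x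
      using assms(11)[of x] by (simp add: d_def U_def)
    show "c \<le> d x" for x
      using assms(11)[of x] by (simp add: d_def U_def)
    show "\<bar>d x - d y\<bar> \<le> M * \<bar>x - y\<bar>" if "closed_segment x y \<subseteq> {a<..<b} - S" for x y
    proof -
      have sub: "closed_segment x y \<subseteq> U" using that by (simp add: U_def)
      \<comment> \<open>A segment inside \<open>U\<close> contains no kink, so the bound on the
        second derivative gives the Lipschitz constant \<open>M\<close>.\<close>
      have "norm (deriv f x - deriv f y) \<le> M * norm (x - y)"
      proof (rule field_differentiable_bound[where S="closed_segment x y"])
        show "(deriv f has_field_derivative deriv (deriv f) t) (at t within closed_segment x y)"
          if "t \<in> closed_segment x y" for t
          using f_deriv2[of t] sub that by (auto intro: has_field_derivative_at_within)
        show "norm (deriv (deriv f) t) \<le> M" if "t \<in> closed_segment x y" for t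
          using assms(9)[of t] sub that by (auto simp: U_def)
      qed auto
      then show ?thesis using sub by (auto simp: d_def)
    qed
  qed (use assms in auto)
  \<comment> \<open>The walks depend on the function only through the two domains and the value at
    \<open>b\<close>, all of which ignore what happens outside \<open>{a..b}\<close>.\<close>
  have dom: "dual_domain a b F = dual_domain a b f" "diagram_domain a b F = diagram_domain a b f" and Fb: "F b = f b"
    using F assms(1) by (auto simp: dual_domain_def diagram_domain_def)
  have ext: "exterior_transition_measure a b F = exterior_transition_measure a b f"
    by (simp only: exterior_transition_measure_def exterior_hook_walk_def exterior_hook_def dom Fb)
  have int: "interior_transition_measure a b F = interior_transition_measure a b f"
    by (simp only: interior_transition_measure_def interior_hook_walk_def interior_hook_def dom)
  have area: "D.area = (LBINT t:{a..b}. f t)"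
    unfolding D.area_def by (rule set_lebesgue_integral_cong) (use F in auto)
  define X where "X = S \<union> {a, b}"
  have X: "finite X" using assms(5) by (simp add: X_def)
  have inU: "x \<in> U" if "x \<in> {a..b}" "x \<notin> X" for x
    using that by (auto simp: X_def U_def)
  \<comment> \<open>Here \<open>x\<close> has to be off \<open>X\<close>, since \<open>d x\<close>
    occurs for every \<open>u\<close>; in \<open>u\<close> itself the integrands may differ on a
    finite set.\<close>
  have diag: "D.diag x = diagram_integral a b f x" if x: "x \<in> {a..b}" "x \<notin> X" for x
    unfolding D.diag_def diagram_integral_def set_lebesgue_integral_def
  proof (rule integral_discrete_difference[OF countable_finite[OF X]])
    fix u assume u: "u \<notin> X"
    show "indicator {a..b} u *\<^sub>R (1 / (D.s u - D.s x) * ((d u - d x) / (1 + d x))) =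
        indicator {a..b} u *\<^sub>R (1 / (u - x + f u - f x) * ((deriv f u - deriv f x) / (1 + deriv f x)))"
    proof (cases "u \<in> {a..b}")
      case True
      then have "D.s u - D.s x = u - x + f u - f x" using x F by (simp add: D.s_eq)
      then show ?thesis using inU[OF True u] inU[OF x] by (simp add: d_def)
    qed simp
  qed auto
  define p where "p x = (1 + deriv f x) * sin (pi / (1 + deriv f x))
        * (x - a + f x) powr (- (deriv f x / (1 + deriv f x)))
        * (b - x + f b - f x) powr (- (1 / (1 + deriv f x)))
        * exp (diagram_integral a b f x)" for x
  define q where "q x = 1 / pi * (1 + deriv f x) * sin (pi / (1 + deriv f x))
        * (x - a + f x) powr (deriv f x / (1 + deriv f x))
        * (b - x + f b - f x) powr (1 / (1 + deriv f x))
        * exp (- diagram_integral a b f x)" for x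
  have ext_eq: "indicator {a..b} x * D.exterior_density x = indicator {a..b} x * (1 / pi * p x)" if "x \<notin> X" for x
  proof (cases "x \<in> {a..b}")
    case True
    have "d x = deriv f x" using inU[OF True that] by (simp add: d_def)
    then show ?thesis
      using True diag[OF True that] F[OF True] Fb by (simp add: D.exterior_density_def p_def mult_ac)
  qed simp
  have int_eq: "indicator {a..b} x * (1 / D.area * D.interior_weight x) =
      indicator {a..b} x * (1 / (LBINT t:{a..b}. f t) * q x)" if "x \<notin> X" for x
  proof (cases "x \<in> {a..b}")
    case True
    have "d x = deriv f x" using inU[OF True that] by (simp add: d_def)
    then show ?thesis
      using True diag[OF True that] F[OF True] Fb by (simp add: D.interior_weight_def q_def area)
  qed simp
  have "exterior_transition_measure a b f = density lborel (\<lambda>x. ennreal (indicator {a..b} x * (1 / pi * p x)))"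
    unfolding ext[symmetric] D.exterior_law(1)
    by (rule density_lborel_cong_finite[OF X D.exterior_law(3)]) (rule arg_cong[where f=ennreal], rule ext_eq)
  moreover have "interior_transition_measure a b f =
      density lborel (\<lambda>x. ennreal (indicator {a..b} x * (1 / (LBINT t:{a..b}. f t) * q x)))"
    unfolding int[symmetric] D.interior_law(1)
    by (rule density_lborel_cong_finite[OF X D.interior_law(3)]) (rule arg_cong[where f=ennreal], rule int_eq)
  \<comment> \<open>The interior density has total mass one; multiplying by the area gives the
    identity. The formula for \<open>pi\<close> arises in the same way from the exterior
    density.\<close>
  moreover have "(LBINT x:{a..b}. f x) = (LBINT x:{a..b}. q x)"
  proof -
    have "1 = (\<integral>x. indicator {a..b} x * (1 / (LBINT t:{a..b}. f t) * q x) \<partial>lborel)"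
      by (rule trans[OF D.interior_law(2)[symmetric] integral_discrete_difference[OF countable_finite[OF X]]])
         (simp, simp, rule int_eq)
    also have "\<dots> = (\<integral>x. 1 / (LBINT t:{a..b}. f t) * (indicator {a..b} x *\<^sub>R q x) \<partial>lborel)"
      by (rule Bochner_Integration.integral_cong) (simp_all add: mult_ac)
    also have "\<dots> = 1 / (LBINT t:{a..b}. f t) * (LBINT x:{a..b}. q x)"
      unfolding set_lebesgue_integral_def by (rule integral_mult_right_zero)
    finally show ?thesis using D.area_pos by (simp add: area field_simps)
  qed
  moreover have "pi = (LBINT x:{a..b}. p x)"
  proof -
    have "1 = (\<integral>x. indicator {a..b} x * (1 / pi * p x) \<partial>lborel)"
      by (rule trans[OF D.exterior_law(2)[symmetric] integral_discrete_difference[OF countable_finite[OF X]]])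
         (simp, simp, rule ext_eq)
    also have "\<dots> = (\<integral>x. 1 / pi * (indicator {a..b} x *\<^sub>R p x) \<partial>lborel)"
      by (rule Bochner_Integration.integral_cong) (simp_all add: mult_ac)
    also have "\<dots> = 1 / pi * (LBINT x:{a..b}. p x)"
      unfolding set_lebesgue_integral_def by (rule integral_mult_right_zero)
    finally show ?thesis by (simp add: field_simps)
  qed
  ultimately show ?thesis
    unfolding p_def q_def by (simp only: mult.assoc simp_thms)
qed

end
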